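(* Let $\mathcal H$ be a real separable Hilbert space. Let $\mu=\mathcal N(m_1,Q)$ with $\ker(Q)=\{0\}$, and let $\nu=\mathcal N(m_2,R_\nu)$ be equivalent to $\mu$. Let $S\in\mathrm{Sym}(\mathcal H)\cap\mathrm{HS}(\mathcal H)$ be such that $R_\nu=Q^{1/2}(I-S)Q^{1/2}$ (in particular $I-S$ is strictly positive and invertible and $m_2-m_1\in\mathrm{Im}(Q^{1/2})$). Let $\gamma$ be a Borel probability measure on $\mathcal H$ with finite second moment, absolutely continuous with respect to $\mu$, with mean $m_3$ satisfying $m_3-m_1\in\mathrm{Im}(Q^{1/2})$, and covariance operator $R_\gamma=Q^{1/2}AQ^{1/2}$ with $A\in\mathrm{Sym}^+(\mathcal H)$. Assume that $S\in\mathrm{Tr}(\mathcal H)$ or $I-A\in\mathrm{HS}(\mathcal H)$. Then $$\begin{aligned}\mathrm{KL}(\gamma\|\mu)=\mathrm{KL}(\gamma\|\nu)&-\tfrac12\|(I-S)^{-1/2}Q^{-1/2}(m_2-m_1)\|^2-\tfrac12\langle S(I-S)^{-1}Q^{-1/2}(m_3-m_1),Q^{-1/2}(m_3-m_1)\rangle\\&+\langle (I-S)^{-1}Q^{-1/2}(m_2-m_1),Q^{-1/2}(m_3-m_1)\rangle+\tfrac12\mathrm{Tr}[S(I-(I-S)^{-1}A)]-\tfrac12\log{\det}_2(I-S).\end{aligned}$$ In particular, if $m_3=m_2$ and $A=I-S$ (i.e. $R_\gamma=R_\nu$), then $$\mathrm{KL}(\gamma\|\mu)=\mathrm{KL}(\gamma\|\nu)+\tfrac12\|Q^{-1/2}(m_2-m_1)\|^2-\tfrac12\log{\det}_2(I-S)=\mathrm{KL}(\gamma\|\nu)+\mathrm{KL}(\nu\|\mu),$$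 so $\mathrm{KL}(\gamma\|\mu)\ge\mathrm{KL}(\nu\|\mu)$ with equality if and only if $\gamma=\nu$.
   Context: $\mathrm{Sym}(\mathcal H)$: bounded self-adjoint operators; $\mathrm{Sym}^+(\mathcal H)$: those with $\langle Ax,x\rangle\ge0$ for all $x$; $\mathrm{Tr}(\mathcal H)$, $\mathrm{HS}(\mathcal H)$: trace class and Hilbert–Schmidt operators. $\mathcal N(m,C)$ is the Gaussian measure with mean $m$ and (positive, trace class) covariance $C$. Since $\ker Q=\{0\}$, $Q^{-1/2}$ denotes the inverse of $Q^{1/2}$ defined on $\mathrm{Im}(Q^{1/2})$. $\mathrm{KL}(\nu\|\mu)=\int\log\frac{d\nu}{d\mu}d\nu$ if $\nu\ll\mu$, $+\infty$ otherwise. For $A\in\mathrm{HS}(\mathcal H)$, the Hilbert–Carleman determinant is ${\det}_2(I+A)=\det[(I+A)\exp(-A)]$, where $\det$ is the Fredholm determinant $\det(I+B)=\prod_j(1+\lambda_j(B))$ for trace class $B$. *)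

theory Defs
  imports "HOL-Analysis.Analysis" "HOL-Probability.Probability"
begin

definition op_selfadj :: "('a::real_inner \<Rightarrow> 'a) \<Rightarrow> bool" where
  "op_selfadj T \<longleftrightarrow> bounded_linear T \<and> (\<forall>x y. inner (T x) y = inner x (T y))"

definition op_pos :: "('a::real_inner \<Rightarrow> 'a) \<Rightarrow> bool" where
  "op_pos T \<longleftrightarrow> op_selfadj T \<and> (\<forall>x. 0 \<le> inner (T x) x)"

definition op_sqrt :: "('a::real_inner \<Rightarrow> 'a) \<Rightarrow> ('a \<Rightarrow> 'a)" where
  "op_sqrt T = (THE R. op_pos R \<and> R \<circ> R = T)"

definition op_inv :: "('a \<Rightarrow> 'a) \<Rightarrow> ('a \<Rightarrow> 'a)" where
  "op_inv T y = (THE x. T x = y)"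

definition op_adj :: "('a::real_inner \<Rightarrow> 'a) \<Rightarrow> ('a \<Rightarrow> 'a)" where
  "op_adj T = (THE T'. \<forall>x y. inner (T x) y = inner x (T' y))"

definition onb :: "'a::real_inner set \<Rightarrow> bool" where
  "onb B \<longleftrightarrow> (\<forall>e\<in>B. norm e = 1) \<and> (\<forall>e\<in>B. \<forall>f\<in>B. e \<noteq> f \<longrightarrow> inner e f = 0)
     \<and> closure (span B) = UNIV"

definition hilbert_schmidt :: "('a::real_inner \<Rightarrow> 'a) \<Rightarrow> bool" where
  "hilbert_schmidt T \<longleftrightarrow> bounded_linear T \<and>
     (\<exists>B. onb B \<and> (\<lambda>e. (norm (T e))\<^sup>2) summable_on B)"

definition trace_class :: "('a::real_inner \<Rightarrow> 'a) \<Rightarrow> bool" where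
  "trace_class T \<longleftrightarrow> bounded_linear T \<and>
     (\<exists>B. onb B \<and> (\<lambda>e. inner (op_sqrt (op_adj T \<circ> T) e) e) summable_on B)"

definition op_trace :: "('a::real_inner \<Rightarrow> 'a) \<Rightarrow> real" where
  "op_trace T = infsum (\<lambda>e. inner (T e) e) (SOME B. onb B)"

text \<open>Hilbert--Carleman determinant det_2(I + A) for a self-adjoint Hilbert--Schmidt A:
  det[(I+A) exp(-A)] = prod over the eigenvalues l_j of A (with multiplicity) of
  (1 + l_j) exp(-l_j); the eigenvalues with multiplicity are read off an orthonormal
  basis of eigenvectors, and the product is the unordered infinite product.\<close>
definition det2_id_plus :: "('a::real_inner \<Rightarrow> 'a) \<Rightarrow> real" where
  "det2_id_plus A = (THE d. \<exists>E. onb E \<and> (\<forall>e\<in>E. \<exists>l. A e = l *\<^sub>R e) \<and>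
     ((\<lambda>F. \<Prod>e\<in>F. (1 + inner (A e) e) * exp (- inner (A e) e)) \<longlongrightarrow> d)
        (finite_subsets_at_top E))"

definition gaussian_measure :: "'a::{real_inner,polish_space} measure \<Rightarrow> 'a \<Rightarrow> ('a \<Rightarrow> 'a) \<Rightarrow> bool" where
  "gaussian_measure M m C \<longleftrightarrow> prob_space M \<and> sets M = sets borel \<and> op_pos C \<and> trace_class C \<and>
     (\<forall>h. distr M borel (\<lambda>x. inner h x) =
        (if inner (C h) h = 0 then return borel (inner m h)
         else density lborel (normal_density (inner m h) (sqrt (inner (C h) h)))))"

definition mean_cov :: "'a::{real_inner,polish_space} measure \<Rightarrow> 'a \<Rightarrow> ('a \<Rightarrow> 'a) \<Rightarrow> bool" where
  "mean_cov M m R \<longleftrightarrow> integrable M (\<lambda>x. (norm x)\<^sup>2) \<and>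
     (\<forall>h. (\<integral>x. inner h x \<partial>M) = inner h m) \<and>
     (\<forall>h k. (\<integral>x. inner h (x - m) * inner k (x - m) \<partial>M) = inner (R h) k)"

text \<open>Kullback--Leibler divergence KL(N || M) = \<integral> log (dN/dM) dN, +\<infinity> unless N \<ll> M.
  The negative part of the integrand always has finite integral.\<close>
definition KL :: "'a measure \<Rightarrow> 'a measure \<Rightarrow> ereal" where
  "KL N M = (if absolutely_continuous M N \<and> sets N = sets M then
      enn2ereal (\<integral>\<^sup>+x. ennreal (max 0 (ln (enn2real (RN_deriv M N x)))) \<partial>N)
      - enn2ereal (\<integral>\<^sup>+x. ennreal (max 0 (- ln (enn2real (RN_deriv M N x)))) \<partial>N)
    else \<infinity>)"

end

(*
  Let e range over an orthonormal eigenbasis of S, with eigenvalues s_e. The functionals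
  W_e = <Q^(-1/2) (x - m1), e>, defined as L^2 limits of continuous linear functionals, are
  independent under both Gaussian measures: standard normal under mu, and normal with mean b_e and
  variance 1 - s_e under nu, where b = Q^(-1/2) (m2 - m1). Hence nu has an explicit density exp(L_F)
  with respect to mu on the sigma-algebra generated by finitely many W_e, e in F, and E_gamma L_F
  involves only the first two moments of gamma and converges to the asserted correction term.

  It remains to pass from L_F to the full density, although gamma has only two moments. No
  convergence of L_F under gamma is needed. For g depending on finitely many coordinates, the
  Donsker--Varadhan inequality for (gamma, mu) applied to g + L_F reads
    E_gamma g - log E_nu e^g <= KL(gamma || mu) - E_gamma L_F ,
  since E_mu e^(g + L_F) = E_nu e^g. Let F grow and take the supremum over g: this gives
  KL(gamma || nu) <= KL(gamma || mu) - lim E_gamma L_F. Exchanging the roles of mu and nu gives the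
  reverse inequality.
*)
theory Submission
  imports Defs
begin

section \<open>Orthonormal sets and bases\<close>

text \<open>The functionals \<open>W e\<close> are in general not continuous, and a limit in L2
  would be a different object under each of \<mu>, \<nu> and \<gamma>. They are therefore pointwise
  limits along one sequence with a geometric rate, which converges almost everywhere under all three
  measures. Absolute continuity transfers null sets, but neither rates nor moments. Hence the
  recovery of a point from its coordinates and the approximation of Borel sets by continuous
  functions are proved almost everywhere under one reference measure and only afterwards used under
  the others. That the eigenvalues of \<open>S\<close> lie below 1 and that \<open>m2 - m1\<close>
  lies in the range of the root are extracted from equivalence: otherwise some sequence of linear
  functionals would tend to zero under one Gaussian measure but not under the other. The root and
  the determinant are definite descriptions, and the trace uses an arbitrarily selected basis. So
  uniqueness of positive roots and independence of the basis have to be shown; for the determinant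
  the latter is read off the entropy formula.\<close>

definition orthonormal :: "'a::real_inner set \<Rightarrow> bool" where
  "orthonormal B \<longleftrightarrow> (\<forall>e\<in>B. norm e = 1) \<and> (\<forall>e\<in>B. \<forall>f\<in>B. e \<noteq> f \<longrightarrow> inner e f = 0)"

lemma onb_iff: "onb B \<longleftrightarrow> orthonormal B \<and> closure (span B) = UNIV"
  by (auto simp: onb_def orthonormal_def)

lemma onb_imp_orthonormal: "onb B \<Longrightarrow> orthonormal B"
  by (simp add: onb_iff)

lemma orthonormal_inner:
  assumes "orthonormal B" "e \<in> B" "f \<in> B"
  shows "inner e f = (if e = f then 1 else 0)"
  using assms by (auto simp: orthonormal_def dot_square_norm)

lemma orthonormal_inner_sum:
  assumes B: "orthonormal B" and F: "finite F" "F \<subseteq> B" and e: "e \<in> B"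
  shows "inner (\<Sum>f\<in>F. c f *\<^sub>R f) e = (if e \<in> F then c e else 0)"
proof -
  have "inner (\<Sum>f\<in>F. c f *\<^sub>R f) e = (\<Sum>f\<in>F. if f = e then c f else 0)"
    unfolding inner_sum_left using orthonormal_inner[OF B _ e] F by (intro sum.cong) auto
  also have "\<dots> = (if e \<in> F then c e else 0)" using F by (simp add: sum.delta)
  finally show ?thesis .
qed

lemma orthonormal_norm_sum:
  assumes B: "orthonormal B" and F: "finite F" "F \<subseteq> B"
  shows "(norm (\<Sum>f\<in>F. c f *\<^sub>R f))\<^sup>2 = (\<Sum>f\<in>F. (c f)\<^sup>2)"
proof -
  have "(norm (\<Sum>f\<in>F. c f *\<^sub>R f))\<^sup>2 = inner (\<Sum>f\<in>F. c f *\<^sub>R f) (\<Sum>f\<in>F. c f *\<^sub>R f)"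
    by (simp add: dot_square_norm)
  also have "\<dots> = (\<Sum>e\<in>F. c e * inner (\<Sum>f\<in>F. c f *\<^sub>R f) e)"
    by (subst inner_sum_right) simp
  also have "\<dots> = (\<Sum>f\<in>F. (c f)\<^sup>2)"
    using orthonormal_inner_sum[OF B F] F by (intro sum.cong) (auto simp: power2_eq_square)
  finally show ?thesis .
qed

lemma orthonormal_dist_projection:
  assumes B: "orthonormal B" and F: "finite F" "F \<subseteq> B"
  shows "(norm (x - (\<Sum>f\<in>F. inner x f *\<^sub>R f)))\<^sup>2 = (norm x)\<^sup>2 - (\<Sum>f\<in>F. (inner x f)\<^sup>2)"
proof -
  let ?P = "\<Sum>f\<in>F. inner x f *\<^sub>R f"
  have 1: "inner x ?P = (\<Sum>f\<in>F. (inner x f)\<^sup>2)"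
    by (simp add: inner_sum_right power2_eq_square)
  have 2: "inner ?P ?P = (\<Sum>f\<in>F. (inner x f)\<^sup>2)"
    using orthonormal_norm_sum[OF B F, of "inner x"] by (simp add: dot_square_norm)
  have "(norm (x - ?P))\<^sup>2 = inner x x - 2 * inner x ?P + inner ?P ?P"
    unfolding power2_norm_eq_inner by (simp add: inner_diff_left inner_diff_right inner_commute)
  then show ?thesis using 1 2 by (simp add: dot_square_norm)
qed

lemma bessel_finite:
  assumes "orthonormal B" "finite F" "F \<subseteq> B"
  shows "(\<Sum>f\<in>F. (inner x f)\<^sup>2) \<le> (norm x)\<^sup>2"
  using orthonormal_dist_projection[OF assms, of x] zero_le_power2 by (metis diff_ge_0_iff_ge)

lemma bessel_summable:
  assumes B: "orthonormal B"
  shows "(\<lambda>f. (inner x f)\<^sup>2) summable_on B"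
  by (rule nonneg_bdd_above_summable_on) (auto intro!: bdd_aboveI2[where M = "(norm x)\<^sup>2"] bessel_finite[OF B])

lemma onb_has_sum_expansion:
  fixes x :: "'a::real_inner"
  assumes B: "onb B"
  shows "((\<lambda>e. inner x e *\<^sub>R e) has_sum x) B"
  unfolding has_sum_def tendsto_iff
proof (intro allI impI)
  fix \<epsilon> :: real assume "\<epsilon> > 0"
  have oB: "orthonormal B" using B by (simp add: onb_iff)
  have "x \<in> closure (span B)" using B by (simp add: onb_iff)
  then obtain y where y: "y \<in> span B" "dist y x < \<epsilon>"
    using \<open>\<epsilon> > 0\<close> by (auto simp: closure_approachable)
  obtain F0 c where F0: "finite F0" "F0 \<subseteq> B" "y = (\<Sum>a\<in>F0. c a *\<^sub>R a)"
    using y(1) unfolding span_explicit by blast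
  have "dist (\<Sum>e\<in>F. inner x e *\<^sub>R e) x < \<epsilon>" if F: "finite F" "F0 \<subseteq> F" "F \<subseteq> B" for F
  proof -
    have "(\<Sum>e\<in>F. inner y e *\<^sub>R e) = (\<Sum>e\<in>F. (if e \<in> F0 then c e *\<^sub>R e else 0))"
      using orthonormal_inner_sum[OF oB F0(1,2)] F F0(3) by (intro sum.cong) auto
    also have "\<dots> = y"
      using F F0 by (simp add: sum.inter_restrict[symmetric] Int_absorb1)
    finally have yF: "(\<Sum>e\<in>F. inner y e *\<^sub>R e) = y" .
    \<comment> \<open>The projection onto \<open>F\<close> fixes \<open>y\<close>, so replacing
      \<open>x\<close> by \<open>x - y\<close> leaves the error unchanged, and the error is at most
      \<open>norm (x - y)\<close>.\<close>
    have eq: "x - (\<Sum>e\<in>F. inner x e *\<^sub>R e) = (x - y) - (\<Sum>e\<in>F. inner (x - y) e *\<^sub>R e)"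
      by (simp add: inner_diff_left scaleR_diff_left sum_subtractf yF)
    have "(norm (x - (\<Sum>e\<in>F. inner x e *\<^sub>R e)))\<^sup>2 \<le> (norm (x - y))\<^sup>2"
      unfolding eq using orthonormal_dist_projection[OF oB F(1,3), of "x - y"]
      by (simp add: sum_nonneg)
    then have "norm (x - (\<Sum>e\<in>F. inner x e *\<^sub>R e)) \<le> norm (x - y)"
      using abs_le_square_iff[of "norm (x - (\<Sum>e\<in>F. inner x e *\<^sub>R e))" "norm (x - y)"] by simp
    then show ?thesis using y(2) by (simp add: dist_norm norm_minus_commute)
  qed
  then show "\<forall>\<^sub>F F in finite_subsets_at_top B. dist (\<Sum>e\<in>F. inner x e *\<^sub>R e) x < \<epsilon>"
    unfolding eventually_finite_subsets_at_top using F0(1,2) by blast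
qed

lemma onb_parseval_inner:
  assumes "onb B"
  shows "((\<lambda>e. inner x e * inner y e) has_sum inner x y) B"
  using has_sum_bounded_linear[OF bounded_linear_inner_right[of y] onb_has_sum_expansion[OF assms, of x]]
  by (simp add: inner_commute)

lemma onb_parseval:
  assumes "onb B"
  shows "((\<lambda>e. (inner x e)\<^sup>2) has_sum (norm x)\<^sup>2) B"
  using onb_parseval_inner[OF assms, of x x] by (simp add: power2_eq_square[symmetric] dot_square_norm)

lemma onb_eqI:
  assumes B: "onb B" and "\<And>e. e \<in> B \<Longrightarrow> inner x e = inner y e"
  shows "x = y"
proof -
  have "((\<lambda>e. inner x e *\<^sub>R e) has_sum y) B"
    using onb_has_sum_expansion[OF B, of y] by (rule has_sum_cong[THEN iffD1, rotated]) (use assms(2) in auto)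
  then show ?thesis using onb_has_sum_expansion[OF B, of x] has_sum_unique by blast
qed

text \<open>Distinct elements are at distance \<open>sqrt 2\<close>, so balls of radius 1/2 around
  them are disjoint, and a separable space has only countably many disjoint nonempty open sets.
  Countability turns unordered limits into sequential ones, as almost everywhere arguments
  require.\<close>

lemma orthonormal_countable:
  fixes B :: "'a::{real_inner,second_countable_topology} set"
  assumes B: "orthonormal B"
  shows "countable B"
proof -
  have d: "dist e f = sqrt 2" if "e \<in> B" "f \<in> B" "e \<noteq> f" for e f
  proof -
    have "(norm (e - f))\<^sup>2 = 2"
      unfolding power2_norm_eq_inner
      using orthonormal_inner[OF B that(1,2)] orthonormal_inner[OF B that(1,1)]
        orthonormal_inner[OF B that(2,2)] that
      by (simp add: inner_diff_left inner_diff_right inner_commute)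
    then show ?thesis by (metis dist_norm norm_ge_zero real_sqrt_unique)
  qed
  have disj: "e = f" if "e \<in> B" "f \<in> B" "x \<in> ball e (1/2)" "x \<in> ball f (1/2)" for e f x
  proof (rule ccontr)
    assume "e \<noteq> f"
    have "dist e f \<le> dist e x + dist f x" by (metis dist_commute dist_triangle)
    also have "\<dots> < 1" using that by simp
    finally show False using d[OF that(1,2) \<open>e \<noteq> f\<close>] real_sqrt_ge_one[of 2] by linarith
  qed
  have "countable ((\<lambda>e. ball e (1/2)) ` B)"
    by (rule countable_disjoint_open_subsets) (auto simp: pairwise_def disjnt_def dest: disj)
  moreover have "inj_on (\<lambda>e. ball e (1/2::real)) B"
    by (rule inj_onI) (metis centre_in_ball disj half_gt_zero_iff zero_less_one)
  ultimately show ?thesis by (rule countable_image_inj_on)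
qed

lemma countable_exhaustion:
  assumes "countable E"
  obtains s :: "nat \<Rightarrow> 'b set" where "\<And>n. finite (s n)" "\<And>n. s n \<subseteq> E" "incseq s"
    "filterlim s (finite_subsets_at_top E) sequentially"
proof -
  define s where "s n = {e\<in>E. to_nat_on E e < n}" for n
  have inj: "inj_on (to_nat_on E) E" using assms by (rule inj_on_to_nat_on)
  have fin: "finite (s n)" for n
    by (rule inj_on_finite[of "to_nat_on E" _ "{..<n}"]) (auto simp: s_def intro: inj_on_subset[OF inj])
  have sub: "s n \<subseteq> E" for n by (auto simp: s_def)
  have inc: "incseq s" by (auto simp: s_def incseq_def)
  have "filterlim s (finite_subsets_at_top E) sequentially"
    unfolding filterlim_finite_subsets_at_top
  proof (intro allI impI)
    fix X assume X: "finite X \<and> X \<subseteq> E"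
    obtain N where N: "\<forall>k\<in>to_nat_on E ` X. k < N" 
      using X finite_nat_set_iff_bounded by (metis finite_imageI)
    have "X \<subseteq> s n" if "n \<ge> N" for n
      using N X that by (force simp: s_def)
    then show "\<forall>\<^sub>F n in sequentially. finite (s n) \<and> X \<subseteq> s n \<and> s n \<subseteq> E"
      using fin sub by (auto simp: eventually_sequentially)
  qed
  then show ?thesis using that fin sub inc by blast
qed

text \<open>Completeness of the space enters here. Vectors that are not given explicitly, such as
  values of diagonal operators, projections and preimages under the root, are obtained by
  prescribing coefficients.\<close>

lemma riesz_fischer:
  fixes B :: "'a::{real_inner,polish_space} set"
  assumes B: "orthonormal B" and c: "(\<lambda>e. (c e)\<^sup>2) summable_on B"
  obtains x where "x \<in> closure (span B)" "\<And>e. e \<in> B \<Longrightarrow> inner x e = c e"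
proof -
  obtain s where s: "\<And>n. finite (s n)" "\<And>n. s n \<subseteq> B" "incseq s"
    "filterlim s (finite_subsets_at_top B) sequentially"
    using countable_exhaustion[OF orthonormal_countable[OF B]] by metis
  define y where "y n = (\<Sum>e\<in>s n. c e *\<^sub>R e)" for n
  define S where "S n = (\<Sum>e\<in>s n. (c e)\<^sup>2)" for n
  have "S \<longlonglongrightarrow> infsum (\<lambda>e. (c e)\<^sup>2) B"
    unfolding S_def using infsum_tendsto[OF c] s(4) by (rule filterlim_compose)
  then have CS: "Cauchy S" by (rule LIMSEQ_imp_Cauchy)
  have yS: "(norm (y m - y n))\<^sup>2 = S m - S n" if "n \<le> m" for m n
  proof -
    have sub: "s n \<subseteq> s m" using s(3) that by (auto simp: incseq_def)
    have "y m - y n = (\<Sum>e\<in>s m - s n. c e *\<^sub>R e)"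
      unfolding y_def using sum_diff[OF s(1) sub, of "\<lambda>e. c e *\<^sub>R e"] by simp
    moreover have "S m - S n = (\<Sum>e\<in>s m - s n. (c e)\<^sup>2)"
      unfolding S_def using sum_diff[OF s(1) sub, of "\<lambda>e. (c e)\<^sup>2"] by simp
    moreover have "finite (s m - s n)" "s m - s n \<subseteq> B" using s(1,2) by auto
    ultimately show ?thesis using orthonormal_norm_sum[OF B, of "s m - s n" c] by simp
  qed
  have "Cauchy y"
  proof (rule metric_CauchyI)
    fix \<epsilon> :: real assume "\<epsilon> > 0"
    then obtain M where M: "\<forall>m\<ge>M. \<forall>n\<ge>M. dist (S m) (S n) < \<epsilon>\<^sup>2"
      using CS unfolding Cauchy_def by (meson zero_less_power)
    have *: "dist (y m) (y n) < \<epsilon>" if "m \<ge> n" "n \<ge> M" for m n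
    proof -
      have "(norm (y m - y n))\<^sup>2 < \<epsilon>\<^sup>2"
        using yS[OF that(1)] M[rule_format, of m n] that by (simp add: dist_real_def)
      then show ?thesis using \<open>\<epsilon> > 0\<close> by (simp add: dist_norm power2_less_imp_less)
    qed
    show "\<exists>M. \<forall>m\<ge>M. \<forall>n\<ge>M. dist (y m) (y n) < \<epsilon>"
      by (rule exI[of _ M]) (metis * dist_commute nat_le_linear)
  qed
  then obtain x where x: "y \<longlonglongrightarrow> x" by (auto simp: Cauchy_convergent_iff convergent_def)
  have "inner x e = c e" if e: "e \<in> B" for e
  proof -
    have "(\<lambda>n. inner (y n) e) \<longlonglongrightarrow> inner x e" by (intro tendsto_intros x)
    moreover have "\<forall>\<^sub>F n in sequentially. inner (y n) e = c e"
    proof -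
      have "\<forall>\<^sub>F n in sequentially. {e} \<subseteq> s n"
        using s(4) e unfolding filterlim_finite_subsets_at_top by (auto elim!: allE[of _ "{e}"] eventually_mono)
      then show ?thesis
        by eventually_elim (use orthonormal_inner_sum[OF B s(1,2) e] in \<open>auto simp: y_def\<close>)
    qed
    ultimately show ?thesis by (metis LIMSEQ_unique tendsto_eventually)
  qed
  moreover have "x \<in> closure (span B)"
  proof (rule closed_sequentially[OF closed_closure _ x])
    fix n show "y n \<in> closure (span B)"
      unfolding y_def by (rule subsetD[OF closure_subset]) (use s(2) in \<open>auto intro!: span_sum span_scale intro: span_base\<close>)
  qed
  ultimately show ?thesis using that by blast
qed

section \<open>Hilbert--Schmidt operators\<close>

lemma has_sum_swap_nonneg:
  fixes f :: "'b \<Rightarrow> 'c \<Rightarrow> real"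
  assumes nn: "\<And>x y. x \<in> A \<Longrightarrow> y \<in> B \<Longrightarrow> 0 \<le> f x y"
    and g: "\<And>x. x \<in> A \<Longrightarrow> (f x has_sum g x) B" and S: "(g has_sum S) A"
    and h: "\<And>y. y \<in> B \<Longrightarrow> ((\<lambda>x. f x y) has_sum h y) A"
  shows "(h has_sum S) B"
proof -
  have "(\<lambda>(x,y). f x y) summable_on (A \<times> B)"
    by (rule summable_on_SigmaI[where g = g]) (use nn g S in \<open>auto simp: summable_on_def\<close>)
  then have "((\<lambda>(x,y). f x y) has_sum S) (A \<times> B)"
    using has_sum_SigmaI[where f = "\<lambda>(x,y). f x y" and g = g and B = "\<lambda>_. B"] g S by auto
  then have "((\<lambda>(y,x). f x y) has_sum S) (B \<times> A)"
    by (subst (asm) has_sum_swap) simp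
  then show ?thesis
    by (rule has_sum_SigmaD) (use h in auto)
qed

text \<open>Both sums are the double sum of the squared matrix entries \<open>inner (T e) f\<close>,
  taken by rows for \<open>T\<close> and by columns for its adjoint.\<close>

lemma hs_norm_adjoint:
  assumes B: "onb B" and E: "onb E" and adj: "\<And>x y. inner (T x) y = inner x (T' y)"
    and s: "((\<lambda>e. (norm (T e))\<^sup>2) has_sum s) B"
  shows "((\<lambda>f. (norm (T' f))\<^sup>2) has_sum s) E"
proof (rule has_sum_swap_nonneg[OF _ _ s])
  fix e show "((\<lambda>f. (inner (T e) f)\<^sup>2) has_sum (norm (T e))\<^sup>2) E" by (rule onb_parseval[OF E])
next
  fix f show "((\<lambda>e. (inner (T e) f)\<^sup>2) has_sum (norm (T' f))\<^sup>2) B"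
    using onb_parseval[OF B, of "T' f"] by (simp only: adj inner_commute[of _ "T' f"])
qed auto

text \<open>Passing to the adjoint may change the basis, so passing to it twice returns to
  \<open>T\<close> with the new basis.\<close>

lemma hs_norm_basis_indep:
  fixes T T' :: "'a::real_inner \<Rightarrow> 'a"
  assumes B: "onb B" and E: "onb E" and adj: "\<And>x y. inner (T x) y = inner x (T' y)"
    and s: "((\<lambda>e. (norm (T e))\<^sup>2) has_sum s) B"
  shows "((\<lambda>f. (norm (T f))\<^sup>2) has_sum s) E"
  by (rule hs_norm_adjoint[OF B E, where T = T']) (use hs_norm_adjoint[OF B B _ s] adj in \<open>auto simp: inner_commute\<close>)

text \<open>Polarization: the inner product of \<open>T\<close> and \<open>U\<close> is a
  combination of the Hilbert--Schmidt norms of \<open>T + U\<close> and \<open>T - U\<close>, which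
  do not depend on the basis.\<close>

lemma hs_inner_basis_indep:
  fixes T T' U U' :: "'a::real_inner \<Rightarrow> 'a"
  assumes B: "onb B" and E: "onb E"
    and adjT: "\<And>x y. inner (T x) y = inner x (T' y)" and adjU: "\<And>x y. inner (U x) y = inner x (U' y)"
    and T: "(\<lambda>e. (norm (T e))\<^sup>2) summable_on B" and U: "(\<lambda>e. (norm (U e))\<^sup>2) summable_on B"
  shows "\<exists>s. ((\<lambda>e. inner (T e) (U e)) has_sum s) B \<and> ((\<lambda>e. inner (T e) (U e)) has_sum s) E"
proof -
  have par: "(norm (T e + U e))\<^sup>2 + (norm (T e - U e))\<^sup>2 = 2 * (norm (T e))\<^sup>2 + 2 * (norm (U e))\<^sup>2" for e
    by (simp add: power2_norm_eq_inner inner_add_left inner_add_right inner_diff_left inner_diff_right)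
  have sm: "(\<lambda>e. 2 * (norm (T e))\<^sup>2 + 2 * (norm (U e))\<^sup>2) summable_on B"
    by (intro summable_on_add summable_on_cmult_right T U)
  have "(\<lambda>e. (norm (T e + U e))\<^sup>2) summable_on B" "(\<lambda>e. (norm (T e - U e))\<^sup>2) summable_on B"
    by (rule summable_on_comparison_test[OF sm]; use par in \<open>smt (verit) zero_le_power2\<close>)+
  then obtain p q where p: "((\<lambda>e. (norm (T e + U e))\<^sup>2) has_sum p) B"
    and q: "((\<lambda>e. (norm (T e - U e))\<^sup>2) has_sum q) B" by (auto simp: summable_on_def)
  have pE: "((\<lambda>e. (norm (T e + U e))\<^sup>2) has_sum p) E"
    by (rule hs_norm_basis_indep[OF B E _ p, where T' = "\<lambda>x. T' x + U' x"])
       (simp add: inner_add_left inner_add_right adjT adjU)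
  have qE: "((\<lambda>e. (norm (T e - U e))\<^sup>2) has_sum q) E"
    by (rule hs_norm_basis_indep[OF B E _ q, where T' = "\<lambda>x. T' x - U' x"])
       (simp add: inner_diff_left inner_diff_right adjT adjU)
  have pol: "inner (T e) (U e) = 1/4 * ((norm (T e + U e))\<^sup>2 + - (norm (T e - U e))\<^sup>2)" for e
    by (simp add: power2_norm_eq_inner inner_add_left inner_add_right inner_diff_left inner_diff_right inner_commute)
  show ?thesis unfolding pol
    by (intro exI[of _ "1/4 * (p + - q)"] conjI has_sum_cmult_right has_sum_add p q pE qE has_sum_uminus[THEN iffD2])
       (simp_all add: q qE)
qed

text \<open>Cauchy--Schwarz on the tail of the expansion of \<open>x\<close>. Finite-rank
  truncations thus approximate \<open>T\<close> uniformly on the unit ball, which is the source of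
  compactness.\<close>

lemma hs_tail_bound:
  assumes B: "onb B" and T: "bounded_linear T" and s: "((\<lambda>e. (norm (T e))\<^sup>2) has_sum s) B"
    and F: "finite F" "F \<subseteq> B"
  shows "(norm (T x - (\<Sum>e\<in>F. inner x e *\<^sub>R T e)))\<^sup>2 \<le> (norm x)\<^sup>2 * (s - (\<Sum>e\<in>F. (norm (T e))\<^sup>2))"
proof -
  interpret T: bounded_linear T by (rule T)
  have "((\<lambda>e. inner x e *\<^sub>R T e) has_sum T x) B"
    using has_sum_bounded_linear[OF T onb_has_sum_expansion[OF B, of x]] by (simp add: T.scaleR)
  then have "((\<lambda>G. (norm ((\<Sum>e\<in>G. inner x e *\<^sub>R T e) - (\<Sum>e\<in>F. inner x e *\<^sub>R T e)))\<^sup>2) \<longlongrightarrow>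
     (norm (T x - (\<Sum>e\<in>F. inner x e *\<^sub>R T e)))\<^sup>2) (finite_subsets_at_top B)"
    unfolding has_sum_def by (intro tendsto_intros)
  moreover have "\<forall>\<^sub>F G in finite_subsets_at_top B.
      (norm ((\<Sum>e\<in>G. inner x e *\<^sub>R T e) - (\<Sum>e\<in>F. inner x e *\<^sub>R T e)))\<^sup>2 \<le>
      (norm x)\<^sup>2 * (s - (\<Sum>e\<in>F. (norm (T e))\<^sup>2))"
    unfolding eventually_finite_subsets_at_top
  proof (intro exI[of _ F] conjI F allI impI)
    fix G assume G: "finite G \<and> F \<subseteq> G \<and> G \<subseteq> B"
    have "(norm ((\<Sum>e\<in>G. inner x e *\<^sub>R T e) - (\<Sum>e\<in>F. inner x e *\<^sub>R T e)))\<^sup>2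
        = (norm (\<Sum>e\<in>G-F. inner x e *\<^sub>R T e))\<^sup>2"
      using sum_diff[of G F "\<lambda>e. inner x e *\<^sub>R T e"] G by simp
    also have "\<dots> \<le> (\<Sum>e\<in>G-F. \<bar>inner x e\<bar> * norm (T e))\<^sup>2"
      by (intro power_mono order_trans[OF norm_sum]) auto
    also have "\<dots> \<le> (\<Sum>e\<in>G-F. \<bar>inner x e\<bar>\<^sup>2) * (\<Sum>e\<in>G-F. (norm (T e))\<^sup>2)"
      by (rule Cauchy_Schwarz_ineq_sum)
    also have "\<dots> \<le> (norm x)\<^sup>2 * (s - (\<Sum>e\<in>F. (norm (T e))\<^sup>2))"
    proof (intro mult_mono)
      show "(\<Sum>e\<in>G-F. \<bar>inner x e\<bar>\<^sup>2) \<le> (norm x)\<^sup>2"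
        using bessel_finite[OF onb_imp_orthonormal[OF B], of "G-F" x] G by auto
      have "(\<Sum>e\<in>G. (norm (T e))\<^sup>2) \<le> s"
        by (rule finite_sum_le_has_sum[OF s]) (use G in auto)
      then show "(\<Sum>e\<in>G-F. (norm (T e))\<^sup>2) \<le> s - (\<Sum>e\<in>F. (norm (T e))\<^sup>2)"
        using sum_diff[of G F "\<lambda>e. (norm (T e))\<^sup>2"] G by simp
    qed (auto intro: sum_nonneg)
    finally show "(norm ((\<Sum>e\<in>G. inner x e *\<^sub>R T e) - (\<Sum>e\<in>F. inner x e *\<^sub>R T e)))\<^sup>2
       \<le> (norm x)\<^sup>2 * (s - (\<Sum>e\<in>F. (norm (T e))\<^sup>2))" .
  qed
  ultimately show ?thesis by (rule tendsto_upperbound) simp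
qed

section \<open>Compactness of Hilbert--Schmidt operators\<close>

lemma compact_finite_combinations:
  fixes v :: "'b \<Rightarrow> 'a::real_normed_vector"
  assumes "finite F"
  shows "compact {\<Sum>e\<in>F. c e *\<^sub>R v e | c. \<forall>e\<in>F. \<bar>c e\<bar> \<le> 1}"
  using assms
proof (induction F)
  case empty show ?case by simp
next
  case (insert a F)
  let ?K = "{\<Sum>e\<in>F. c e *\<^sub>R v e | c. \<forall>e\<in>F. \<bar>c e\<bar> \<le> (1::real)}"
  have "{\<Sum>e\<in>insert a F. c e *\<^sub>R v e | c. \<forall>e\<in>insert a F. \<bar>c e\<bar> \<le> 1}
      = {x + y | x y. x \<in> (\<lambda>t. t *\<^sub>R v a) ` {-1..1} \<and> y \<in> ?K}" (is "?L = ?R")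
  proof (intro equalityI subsetI)
    fix z assume "z \<in> ?L"
    then obtain c where c: "z = (\<Sum>e\<in>insert a F. c e *\<^sub>R v e)" "\<forall>e\<in>insert a F. \<bar>c e\<bar> \<le> 1" by auto
    have "z = c a *\<^sub>R v a + (\<Sum>e\<in>F. c e *\<^sub>R v e)" using c(1) insert.hyps by simp
    moreover have "c a *\<^sub>R v a \<in> (\<lambda>t. t *\<^sub>R v a) ` {-1..1}" using c(2) by (intro imageI) (auto simp: abs_le_iff)
    moreover have "(\<Sum>e\<in>F. c e *\<^sub>R v e) \<in> ?K" using c(2) by auto
    ultimately show "z \<in> ?R" by blast
  next
    fix z assume "z \<in> ?R"
    then obtain t c where c: "z = t *\<^sub>R v a + (\<Sum>e\<in>F. c e *\<^sub>R v e)" "t \<in> {-1..1}" "\<forall>e\<in>F. \<bar>c e\<bar> \<le> 1" by auto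
    let ?d = "c(a := t)"
    have "(\<Sum>e\<in>F. ?d e *\<^sub>R v e) = (\<Sum>e\<in>F. c e *\<^sub>R v e)"
      by (rule sum.cong) (use insert.hyps in auto)
    then have "z = (\<Sum>e\<in>insert a F. ?d e *\<^sub>R v e)" using c(1) insert.hyps by simp
    moreover have "\<forall>e\<in>insert a F. \<bar>?d e\<bar> \<le> 1" using c(2,3) by (auto simp: abs_le_iff)
    ultimately show "z \<in> ?L" by blast
  qed
  moreover have "compact ((\<lambda>t. t *\<^sub>R v a) ` {-1..1::real})"
    by (intro compact_continuous_image continuous_intros compact_Icc)
  ultimately show ?case using compact_sums[OF _ insert.IH] by simp
qed

lemma hilbert_schmidt_compact:
  fixes T :: "'a::{real_inner,polish_space} \<Rightarrow> 'a"
  assumes "hilbert_schmidt T"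
  shows "compact (closure (T ` cball 0 1))"
proof -
  obtain B where T: "bounded_linear T" and B: "onb B" and sm: "(\<lambda>e. (norm (T e))\<^sup>2) summable_on B"
    using assms by (auto simp: hilbert_schmidt_def)
  obtain s where s: "((\<lambda>e. (norm (T e))\<^sup>2) has_sum s) B" using sm by (auto simp: summable_on_def)
  have "\<exists>k. finite k \<and> closure (T ` cball 0 1) \<subseteq> (\<Union>x\<in>k. ball x \<epsilon>)" if \<epsilon>: "\<epsilon> > 0" for \<epsilon>
  proof -
    have "\<forall>\<^sub>F F in finite_subsets_at_top B. dist (\<Sum>e\<in>F. (norm (T e))\<^sup>2) s < (\<epsilon>/3)\<^sup>2"
      using s \<epsilon> unfolding has_sum_def tendsto_iff by simp
    then obtain F where F: "finite F" "F \<subseteq> B" "dist (\<Sum>e\<in>F. (norm (T e))\<^sup>2) s < (\<epsilon>/3)\<^sup>2"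
      unfolding eventually_finite_subsets_at_top by blast
    let ?K = "{\<Sum>e\<in>F. c e *\<^sub>R T e | c. \<forall>e\<in>F. \<bar>c e\<bar> \<le> 1}"
    have "compact ?K" by (rule compact_finite_combinations[OF F(1)])
    then obtain k where k: "finite k" "?K \<subseteq> (\<Union>x\<in>k. ball x (\<epsilon>/3))"
      using \<epsilon> unfolding compact_eq_totally_bounded by (meson divide_pos_pos zero_less_numeral)
    \<comment> \<open>Truncation error and mesh of the net contribute \<epsilon>/3 each. The balls
      are closed so that their finite union also covers the closure.\<close>
    have "T ` cball 0 1 \<subseteq> (\<Union>x\<in>k. cball x (2*\<epsilon>/3))"
    proof (intro subsetI)
      fix y assume "y \<in> T ` cball 0 1"
      then obtain x where x: "y = T x" "norm x \<le> 1" by (auto simp: dist_norm)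
      let ?p = "\<Sum>e\<in>F. inner x e *\<^sub>R T e"
      have "\<bar>inner x e\<bar> \<le> 1" if "e \<in> F" for e
        using Cauchy_Schwarz_ineq2[of x e] x(2) that F(2) B by (auto simp: onb_def subset_iff)
      then have "?p \<in> ?K" by (intro CollectI exI[of _ "\<lambda>e. inner x e"] conjI refl ballI)
      then have "?p \<in> (\<Union>x\<in>k. ball x (\<epsilon>/3))" using k(2) by (rule subsetD[rotated])
      then obtain z where z: "z \<in> k" "dist z ?p < \<epsilon>/3" unfolding UN_iff mem_ball by (elim bexE) 
      have "(norm (T x - ?p))\<^sup>2 \<le> (norm x)\<^sup>2 * (s - (\<Sum>e\<in>F. (norm (T e))\<^sup>2))"
        by (rule hs_tail_bound[OF B T s F(1,2)])
      also have "\<dots> \<le> 1 * (\<epsilon>/3)\<^sup>2"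
      proof (rule mult_mono)
        show "(norm x)\<^sup>2 \<le> 1" using x(2) by (simp add: power_le_one)
        show "s - (\<Sum>e\<in>F. (norm (T e))\<^sup>2) \<le> (\<epsilon>/3)\<^sup>2" using F(3) by (auto simp: dist_real_def)
        show "0 \<le> s - (\<Sum>e\<in>F. (norm (T e))\<^sup>2)"
          using finite_sum_le_has_sum[OF s F(1,2)] by simp
      qed simp
      finally have sq: "(norm (T x - ?p))\<^sup>2 \<le> (\<epsilon>/3)\<^sup>2" unfolding mult_1 .
      have "norm (T x - ?p) \<le> \<epsilon>/3"
        by (rule power2_le_imp_le[OF sq]) (use \<epsilon> in simp)
      then have "dist z y \<le> 2*\<epsilon>/3"
        using z(2) x(1) dist_triangle[of z y ?p] by (simp add: dist_norm norm_minus_commute)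
      then show "y \<in> (\<Union>x\<in>k. cball x (2*\<epsilon>/3))" using z(1) by auto
    qed
    then have "closure (T ` cball 0 1) \<subseteq> (\<Union>x\<in>k. cball x (2*\<epsilon>/3))"
      by (rule closure_minimal) (use k(1) in auto)
    also have "\<dots> \<subseteq> (\<Union>x\<in>k. ball x \<epsilon>)" using \<epsilon> by fastforce
    finally show "\<exists>k. finite k \<and> closure (T ` cball 0 1) \<subseteq> (\<Union>x\<in>k. ball x \<epsilon>)" using k(1) by blast
  qed
  then show ?thesis unfolding compact_eq_totally_bounded by (simp add: complete_eq_closed)
qed

section \<open>The spectral theorem for self-adjoint Hilbert--Schmidt operators\<close>

text \<open>Vectors that nearly maximize \<open>norm (T x)\<close> on the unit sphere of
  \<open>V\<close> are approximate eigenvectors of the square of \<open>T\<close>, and compactness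
  produces an exact one. Working with the square avoids deciding beforehand whether \<open>M\<close>
  or \<open>- M\<close> is the eigenvalue of \<open>T\<close>.\<close>

lemma compact_selfadj_eigenvector:
  fixes T :: "'a::real_inner \<Rightarrow> 'a"
  assumes T: "op_selfadj T" and cp: "compact (closure (T ` cball 0 1))"
    and V: "closed V" "subspace V" and inv: "\<And>x. x \<in> V \<Longrightarrow> T x \<in> V"
    and v: "v \<in> V" "v \<noteq> 0"
  obtains u l where "u \<in> V" "norm u = 1" "T u = l *\<^sub>R u"
proof (cases "\<forall>x\<in>V. T x = 0")
  case True
  show ?thesis
  proof (rule that)
    show "v /\<^sub>R norm v \<in> V" using v V(2) by (simp add: subspace_scale)
    then show "T (v /\<^sub>R norm v) = 0 *\<^sub>R (v /\<^sub>R norm v)" using True by simp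
    show "norm (v /\<^sub>R norm v) = 1" using v by simp
  qed
next
  case False
  have bl: "bounded_linear T" and sa: "\<And>x y. inner (T x) y = inner x (T y)"
    using T by (auto simp: op_selfadj_def)
  interpret T: bounded_linear T by (rule bl)
  let ?U = "{x\<in>V. norm x = 1}"
  define M where "M = (SUP x\<in>?U. norm (T x))"
  obtain C where C: "\<And>x. norm (T x) \<le> norm x * C" using T.bounded by blast
  have bdd: "bdd_above ((\<lambda>x. norm (T x)) ` ?U)"
    by (rule bdd_aboveI2[where M = C]) (metis (mono_tags, lifting) C mem_Collect_eq mult_1)
  have neU: "v /\<^sub>R norm v \<in> ?U" using v V(2) by (simp add: subspace_scale)
  have le1: "norm (T x) \<le> M" if "x \<in> ?U" for x
    unfolding M_def by (rule cSUP_upper[OF that bdd])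
  have le: "norm (T x) \<le> M * norm x" if "x \<in> V" for x
  proof (cases "x = 0")
    case False
    have "norm (T (x /\<^sub>R norm x)) \<le> M" using that V(2) False by (intro le1) (simp add: subspace_scale)
    then show ?thesis using False by (simp add: T.scaleR divide_simps)
  qed (simp add: T.zero)
  have M0: "M > 0"
  proof -
    obtain x where x: "x \<in> V" "T x \<noteq> 0" using False by auto
    then have "0 < M * norm x" using le[OF x(1)] by (meson less_le_trans zero_less_norm_iff)
    then show ?thesis by (simp add: zero_less_mult_iff)
  qed
  have "\<exists>x\<in>?U. M - 1/real (Suc n) < norm (T x)" for n
    using less_cSUP_iff[OF _ bdd, of "M - 1/real (Suc n)"] neU unfolding M_def by fastforce
  then obtain x where x: "\<And>n. x n \<in> V" "\<And>n. norm (x n) = 1" "\<And>n. M - 1/real (Suc n) < norm (T (x n))"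
    by (metis (mono_tags, lifting) mem_Collect_eq)
  have "\<forall>n. T (x n) \<in> closure (T ` cball 0 1)"
    using x(2) by (auto intro!: subsetD[OF closure_subset] imageI)
  then have "\<exists>y\<in>closure (T ` cball 0 1). \<exists>r. strict_mono r \<and> ((\<lambda>n. T (x n)) \<circ> r) \<longlonglongrightarrow> y"
    using cp[unfolded compact_def, rule_format, of "\<lambda>n. T (x n)"] by simp
  then obtain y r where r: "strict_mono r" and y: "((\<lambda>n. T (x n)) \<circ> r) \<longlonglongrightarrow> y"
    by (elim bexE exE conjE)
  have nT: "(\<lambda>n. norm (T (x n))) \<longlonglongrightarrow> M"
  proof (rule tendsto_sandwich[OF _ _ _ tendsto_const])
    show "\<forall>\<^sub>F n in sequentially. M - 1/real (Suc n) \<le> norm (T (x n))" using x(3) by (simp add: less_imp_le)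
    show "\<forall>\<^sub>F n in sequentially. norm (T (x n)) \<le> M" using x(1,2) le1 by simp
    show "(\<lambda>n. M - 1/real (Suc n)) \<longlonglongrightarrow> M"
      using tendsto_diff[OF tendsto_const[of M] lim_1_over_n[THEN LIMSEQ_Suc]] by simp
  qed
  \<comment> \<open>The right side tends to 0 because \<open>norm (T (x n))\<close> tends to the
    supremum \<open>M\<close>. Invariance of \<open>V\<close> is what permits the bound
    \<open>M\<close> to be applied a second time, to \<open>T (x n)\<close>.\<close>
  have est: "(norm (T (T (x n)) - M\<^sup>2 *\<^sub>R x n))\<^sup>2 \<le> (M\<^sup>2)\<^sup>2 - M\<^sup>2 * (norm (T (x n)))\<^sup>2" for n
  proof -
    have "(norm (T (T (x n)) - M\<^sup>2 *\<^sub>R x n))\<^sup>2 =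
       (norm (T (T (x n))))\<^sup>2 - 2 * M\<^sup>2 * (norm (T (x n)))\<^sup>2 + (M\<^sup>2)\<^sup>2 * (norm (x n))\<^sup>2"
    proof -
      have "(norm (a - c *\<^sub>R b))\<^sup>2 = (norm a)\<^sup>2 - 2 * c * inner a b + c\<^sup>2 * (norm b)\<^sup>2" for a b :: 'a and c
        unfolding power2_norm_eq_inner
        by (simp add: inner_diff_left inner_diff_right inner_commute[of b a] power2_eq_square right_diff_distrib)
      moreover have "inner (T (T (x n))) (x n) = (norm (T (x n)))\<^sup>2"
        unfolding power2_norm_eq_inner by (rule sa)
      ultimately show ?thesis by simp
    qed
    also have "(norm (T (T (x n))))\<^sup>2 \<le> (M * norm (T (x n)))\<^sup>2"
      by (intro power_mono le inv x(1)) auto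
    finally show ?thesis using x(2) by (simp add: power_mult_distrib)
  qed
  have "(\<lambda>n. (M\<^sup>2)\<^sup>2 - M\<^sup>2 * (norm (T (x n)))\<^sup>2) \<longlonglongrightarrow> (M\<^sup>2)\<^sup>2 - M\<^sup>2 * M\<^sup>2"
    by (intro tendsto_intros nT)
  then have l0: "(\<lambda>n. (M\<^sup>2)\<^sup>2 - M\<^sup>2 * (norm (T (x n)))\<^sup>2) \<longlonglongrightarrow> 0" by (simp add: power2_eq_square)
  have "(\<lambda>n. (norm (T (T (x n)) - M\<^sup>2 *\<^sub>R x n))\<^sup>2) \<longlonglongrightarrow> 0"
    by (rule tendsto_sandwich[OF _ _ tendsto_const l0]) (use est in auto)
  from tendsto_real_sqrt[OF this] have "(\<lambda>n. norm (T (T (x n)) - M\<^sup>2 *\<^sub>R x n)) \<longlonglongrightarrow> 0" by simp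
  then have d0: "(\<lambda>n. T (T (x n)) - M\<^sup>2 *\<^sub>R x n) \<longlonglongrightarrow> 0" by (rule tendsto_norm_zero_cancel)
  have "(\<lambda>n. T (T (x (r n)))) \<longlonglongrightarrow> T y" using T.tendsto[OF y] by (simp add: o_def)
  from tendsto_diff[OF this LIMSEQ_subseq_LIMSEQ[OF d0 r, unfolded o_def]]
  have "(\<lambda>n. M\<^sup>2 *\<^sub>R x (r n)) \<longlonglongrightarrow> T y" by simp
  from tendsto_scaleR[OF tendsto_const[of "1/M\<^sup>2"] this]
  have xu: "(\<lambda>n. x (r n)) \<longlonglongrightarrow> (1/M\<^sup>2) *\<^sub>R T y" (is "_ \<longlonglongrightarrow> ?u") using M0 by simp
  have uV: "?u \<in> V" using closed_sequentially[OF V(1) _ xu] x(1) by auto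
  have "(\<lambda>n. norm (x (r n))) \<longlonglongrightarrow> norm ?u" by (intro tendsto_norm xu)
  then have u1: "norm ?u = 1" unfolding x(2) using LIMSEQ_unique tendsto_const by metis
  have "T ?u = y" using T.tendsto[OF xu] y by (auto simp: o_def intro: LIMSEQ_unique)
  then have TTu: "T (T ?u) = M\<^sup>2 *\<^sub>R ?u" using M0 by simp
  define u where "u = ?u"
  note u = uV[folded u_def] u1[folded u_def] TTu[folded u_def]
  \<comment> \<open>The factorization \<open>(T - M) (T + M)\<close> annihilates \<open>u\<close>:
    either \<open>w\<close> is zero and \<open>u\<close> belongs to the eigenvalue
    \<open>- M\<close>, or \<open>w\<close> is an eigenvector for \<open>M\<close>.\<close>
  define w where "w = T u + M *\<^sub>R u"
  show ?thesis
  proof (cases "w = 0")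
    case True
    then have "T u = (-M) *\<^sub>R u" by (simp add: w_def eq_neg_iff_add_eq_0)
    then show ?thesis using that u by blast
  next
    case w0: False
    have wV: "w \<in> V" unfolding w_def using u V(2) inv by (intro subspace_add subspace_scale) auto
    have "T w = M *\<^sub>R w" unfolding w_def T.add T.scaleR u(3) by (simp add: algebra_simps power2_eq_square)
    then have "T (w /\<^sub>R norm w) = M *\<^sub>R (w /\<^sub>R norm w)" by (simp add: T.scaleR)
    then show ?thesis using that[of "w /\<^sub>R norm w" M] w0 wV V(2) by (simp add: subspace_scale)
  qed
qed

text \<open>Zorn's lemma gives a maximal orthonormal set of eigenvectors, those for eigenvalue 0
  included. Its orthogonal complement is closed and invariant, so a nonzero vector there would
  supply a further eigenvector.\<close>

theorem spectral_hilbert_schmidt: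
  fixes T :: "'a::{real_inner,polish_space} \<Rightarrow> 'a"
  assumes T: "op_selfadj T" and hs: "hilbert_schmidt T"
  obtains E where "onb E" "\<And>e. e \<in> E \<Longrightarrow> \<exists>l. T e = l *\<^sub>R e"
proof -
  have sa: "\<And>x y. inner (T x) y = inner x (T y)" using T by (auto simp: op_selfadj_def)
  define \<A> where "\<A> = {E. orthonormal E \<and> (\<forall>e\<in>E. \<exists>l. T e = l *\<^sub>R e)}"
  have "\<exists>M\<in>\<A>. \<forall>X\<in>\<A>. M \<subseteq> X \<longrightarrow> X = M"
  proof (rule subset_Zorn')
    fix \<C> assume ch: "subset.chain \<A> \<C>"
    have sub: "\<C> \<subseteq> \<A>" using ch by (rule subset_chain_def[THEN iffD1, THEN conjunct1])
    have "\<exists>X\<in>\<C>. e \<in> X \<and> f \<in> X" if "e \<in> \<Union>\<C>" "f \<in> \<Union>\<C>" for e f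
    proof -
      obtain X where X: "X \<in> \<C>" "e \<in> X" using \<open>e \<in> \<Union>\<C>\<close> by blast
      obtain Y where Y: "Y \<in> \<C>" "f \<in> Y" using \<open>f \<in> \<Union>\<C>\<close> by blast
      note XY = X Y
      then have "X \<subseteq> Y \<or> Y \<subseteq> X" using ch by (auto simp: subset_chain_def)
      then show ?thesis using XY by blast
    qed
    note pairs = this
    have on: "orthonormal X" if "X \<in> \<C>" for X using sub that unfolding \<A>_def by blast
    have "orthonormal (\<Union>\<C>)" unfolding orthonormal_def
    proof (intro conjI ballI impI)
      fix e assume "e \<in> \<Union>\<C>"
      then show "norm e = 1" using on unfolding orthonormal_def by blast
    next
      fix e f assume "e \<in> \<Union>\<C>" "f \<in> \<Union>\<C>" "e \<noteq> f"
      then obtain X where X: "X \<in> \<C>" "e \<in> X" "f \<in> X" using pairs by meson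
      show "inner e f = 0" using on[OF X(1)] X(2,3) \<open>e \<noteq> f\<close> unfolding orthonormal_def by blast
    qed
    then show "\<Union>\<C> \<in> \<A>" using sub unfolding \<A>_def by blast
  qed
  then obtain E where "E \<in> \<A>" and mx: "\<And>X. X \<in> \<A> \<Longrightarrow> E \<subseteq> X \<Longrightarrow> X = E" by auto
  then have E: "orthonormal E" "\<And>e. e \<in> E \<Longrightarrow> \<exists>l. T e = l *\<^sub>R e" unfolding \<A>_def by auto
  define V where "V = {x. \<forall>e\<in>E. inner x e = 0}"
  have "V = (\<Inter>e\<in>E. {x. inner x e = 0})" by (auto simp: V_def)
  moreover have "closed {x. inner x e = 0}" for e :: 'a
    by (intro closed_Collect_eq continuous_intros)
  ultimately have Vc: "closed V" by auto
  have Vs: "subspace V" by (auto simp: V_def subspace_def inner_add_left)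
  have inv: "T x \<in> V" if "x \<in> V" for x
    unfolding V_def
  proof (intro CollectI ballI)
    fix e assume e: "e \<in> E"
    then obtain l where "T e = l *\<^sub>R e" using E(2) by blast
    then show "inner (T x) e = 0" using sa[of x e] that e by (simp add: V_def)
  qed
  have V0: "v = 0" if v: "v \<in> V" for v
  proof (rule ccontr)
    assume "v \<noteq> 0"
    then obtain u l where u: "u \<in> V" "norm u = 1" "T u = l *\<^sub>R u"
      using compact_selfadj_eigenvector[OF T hilbert_schmidt_compact[OF hs] Vc Vs inv v] by blast
    have "insert u E \<in> \<A>" unfolding \<A>_def orthonormal_def
      using E u by (auto simp: orthonormal_def V_def inner_commute)
    then have "u \<in> E" using mx[of "insert u E"] by auto
    then have "inner u u = 0" using u(1) by (auto simp: V_def)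
    then show False using u(2) by simp
  qed
  \<comment> \<open>Here \<open>y\<close> is the orthogonal projection of \<open>x\<close> onto the
    closed span; the difference lies in the trivial complement \<open>V\<close>.\<close>
  have "x \<in> closure (span E)" for x
  proof -
    obtain y where y: "y \<in> closure (span E)" "\<And>e. e \<in> E \<Longrightarrow> inner y e = inner x e"
      using riesz_fischer[OF E(1) bessel_summable[OF E(1), of x]] by blast
    have "x - y \<in> V" using y(2) by (auto simp: V_def inner_diff_left)
    then show ?thesis using V0[of "x - y"] y(1) by simp
  qed
  then have "onb E" using E(1) by (auto simp: onb_iff)
  then show ?thesis using that E(2) by blast
qed

section \<open>Positive operators and their square roots\<close>

lemma op_posD:
  assumes "op_pos T"
  shows "bounded_linear T" "op_selfadj T" "\<And>x y. inner (T x) y = inner x (T y)" "\<And>x. 0 \<le> inner (T x) x"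
  using assms by (auto simp: op_pos_def op_selfadj_def)

text \<open>Positivity is evaluated at \<open>x - (1/C) *\<^sub>R P x\<close>, where
  \<open>C\<close> bounds the norm of \<open>P\<close>: the quadratic term uses up half of the cross
  term, and what remains is the claim.\<close>

lemma op_pos_norm_bound:
  assumes P: "op_pos P"
  obtains C where "C > 0" "\<And>x. (norm (P x))\<^sup>2 \<le> C * inner (P x) x"
proof -
  interpret P: bounded_linear P by (rule op_posD(1)[OF P])
  obtain C where C: "C > 0" "\<And>x. norm (P x) \<le> norm x * C" using P.pos_bounded by blast
  have "(norm (P x))\<^sup>2 \<le> C * inner (P x) x" for x
  proof -
    have "0 \<le> inner (P (x - (1/C) *\<^sub>R P x)) (x - (1/C) *\<^sub>R P x)" by (rule op_posD(4)[OF P])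
    also have "\<dots> = inner (P x) x - 2/C * (norm (P x))\<^sup>2 + (1/C)\<^sup>2 * inner (P (P x)) (P x)"
      using op_posD(3)[OF P, of "P x" x]
      unfolding power2_norm_eq_inner
      by (simp add: P.diff P.scaleR inner_diff_left inner_diff_right algebra_simps power2_eq_square)
    also have "inner (P (P x)) (P x) \<le> C * (norm (P x))\<^sup>2"
    proof -
      have "inner (P (P x)) (P x) \<le> norm (P (P x)) * norm (P x)" by (rule norm_cauchy_schwarz)
      also have "\<dots> \<le> (norm (P x) * C) * norm (P x)" by (intro mult_right_mono C(2)) auto
      finally show ?thesis by (simp add: power2_eq_square mult_ac)
    qed
    finally have "0 \<le> inner (P x) x - 2/C * (norm (P x))\<^sup>2 + (1/C)\<^sup>2 * (C * (norm (P x))\<^sup>2)"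
      by (simp add: mult_left_mono)
    then show ?thesis using C(1) by (simp add: field_simps power2_eq_square)
  qed
  then show ?thesis using that C(1) by blast
qed

lemma op_pos_inner_eq_0:
  assumes "op_pos P" "inner (P x) x = 0"
  shows "P x = 0"
proof -
  obtain C where "C > 0" and C: "\<And>x. (norm (P x))\<^sup>2 \<le> C * inner (P x) x"
    using op_pos_norm_bound[OF assms(1)] by metis
  show ?thesis using C[of x] assms(2) by simp
qed

text \<open>Writing a contraction \<open>M \<ge> 0\<close> as a strongly convergent sum of squares of polynomials
  in \<open>M\<close> shows that its product with a commuting square is again positive.\<close>

lemma op_pos_commuting_square:
  fixes M D :: "'a::real_inner \<Rightarrow> 'a"
  assumes M: "op_pos M" and D: "op_selfadj D" and com: "\<And>x. M (D (D x)) = D (D (M x))"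
  shows "0 \<le> inner (M (D (D x))) x"
proof -
  interpret M: bounded_linear M by (rule op_posD(1)[OF M])
  interpret D: bounded_linear D using D by (simp add: op_selfadj_def)
  have Dsa: "inner (D x) y = inner x (D y)" for x y using D by (simp add: op_selfadj_def)
  obtain C where C: "C > 0" "\<And>x. norm (M x) \<le> norm x * C" using M.pos_bounded by blast
  \<comment> \<open>The iteration subtracts from an operator its own square. It starts from the
    contraction \<open>M / C\<close>, stays between 0 and the identity, and telescopes, so that
    \<open>M / C\<close> becomes the sum of the squares of all \<open>T n\<close>.\<close>
  define T where "T n = rec_nat (\<lambda>x. (1/C) *\<^sub>R M x) (\<lambda>_ S x. S x - S (S x)) n" for n
  have T0: "T 0 x = (1/C) *\<^sub>R M x" for x by (simp add: T_def)
  have TS: "T (Suc n) x = T n x - T n (T n x)" for n x by (simp add: T_def)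
  have inv: "op_pos (T n) \<and> (\<forall>x. inner (T n x) x \<le> (norm x)\<^sup>2) \<and> (\<forall>x. T n (D (D x)) = D (D (T n x)))" for n
  proof (induction n)
    case 0
    have "inner (T 0 x) x \<le> (norm x)\<^sup>2" for x
    proof -
      have "inner (M x) x \<le> norm (M x) * norm x" by (rule norm_cauchy_schwarz)
      also have "\<dots> \<le> (norm x * C) * norm x" by (intro mult_right_mono C(2)) auto
      finally show ?thesis using C(1) by (simp add: T0 field_simps power2_eq_square)
    qed
    moreover have "op_pos (T 0)"
      using op_posD(3,4)[OF M] C(1) unfolding op_pos_def op_selfadj_def T0[abs_def]
      by (auto intro!: bounded_linear_const_scaleR M.bounded_linear_axioms divide_nonneg_pos)
    moreover have "T 0 (D (D x)) = D (D (T 0 x))" for x using com by (simp add: T0 D.scaleR)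
    ultimately show ?case by blast
  next
    case (Suc n)
    then have P: "op_pos (T n)" and le: "\<And>x. inner (T n x) x \<le> (norm x)\<^sup>2"
      and c: "\<And>x. T n (D (D x)) = D (D (T n x))" by auto
    interpret S: bounded_linear "T n" by (rule op_posD(1)[OF P])
    have sa: "inner (T n x) y = inner x (T n y)" for x y by (rule op_posD(3)[OF P])
    \<comment> \<open>With \<open>S\<close> for \<open>T n\<close>, the identity
      \<open>S - S\<^sup>2 = S (1 - S) S + (1 - S) S (1 - S)\<close> writes the next iterate as a
      sum of two positive operators.\<close>
    have "0 \<le> inner (T (Suc n) x) x" for x
    proof -
      have "0 \<le> (norm (T n x))\<^sup>2 - inner (T n (T n x)) (T n x)" using le[of "T n x"] by simp
      moreover have "0 \<le> inner (T n (x - T n x)) (x - T n x)" by (rule op_posD(4)[OF P])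
      ultimately have "0 \<le> (norm (T n x))\<^sup>2 - inner (T n (T n x)) (T n x) + inner (T n (x - T n x)) (x - T n x)" by linarith
      also have "\<dots> = inner (T (Suc n) x) x"
        unfolding TS S.diff inner_diff_left inner_diff_right power2_norm_eq_inner
        by (simp add: sa[of "T n x" x])
      finally show ?thesis .
    qed
    moreover have "inner (T (Suc n) x) x \<le> (norm x)\<^sup>2" for x
    proof -
      have "inner (T (Suc n) x) x = inner (T n x) x - inner (T n x) (T n x)"
        by (simp only: TS inner_diff_left sa[of "T n x" x])
      then show ?thesis using le[of x] inner_ge_zero[of "T n x"] by linarith
    qed
    moreover have "bounded_linear (T (Suc n))"
      unfolding TS[abs_def] by (intro bounded_linear_sub bounded_linear_compose[OF S.bounded_linear_axioms] S.bounded_linear_axioms)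
    moreover have "inner (T (Suc n) x) y = inner x (T (Suc n) y)" for x y
      by (simp add: TS inner_diff_left inner_diff_right sa)
    moreover have "T (Suc n) (D (D x)) = D (D (T (Suc n) x))" for x by (simp add: TS c D.diff)
    ultimately show ?case by (auto simp: op_pos_def op_selfadj_def)
  qed
  have P: "op_pos (T n)" and c: "T n (D (D x)) = D (D (T n x))" for n x using inv by auto
  have sa: "inner (T n x) y = inner x (T n y)" for n x y by (rule op_posD(3)[OF P])
  have tel: "inner (T 0 z) y = (\<Sum>k<n. inner (T k (T k z)) y) + inner (T n z) y" for n z y
    by (induction n) (simp_all add: TS inner_diff_left)
  have "summable (\<lambda>k. (norm (T k z))\<^sup>2)" for z
  proof (rule summableI_nonneg_bounded)
    fix n
    have "(\<Sum>k<n. (norm (T k z))\<^sup>2) = (\<Sum>k<n. inner (T k (T k z)) z)"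
      by (simp add: power2_norm_eq_inner sa)
    also have "\<dots> \<le> inner (T 0 z) z" using tel[of z z n] op_posD(4)[OF P, of n z] by simp
    finally show "(\<Sum>k<n. (norm (T k z))\<^sup>2) \<le> inner (T 0 z) z" .
  qed simp
  then have "(\<lambda>k. sqrt ((norm (T k z))\<^sup>2)) \<longlonglongrightarrow> sqrt 0" for z
    by (intro tendsto_real_sqrt summable_LIMSEQ_zero)
  then have "(\<lambda>k. norm (T k z)) \<longlonglongrightarrow> 0" for z by (simp only: real_sqrt_abs abs_norm_cancel real_sqrt_zero)
  then have T0lim: "(\<lambda>k. T k z) \<longlonglongrightarrow> 0" for z by (rule tendsto_norm_zero_cancel)
  let ?z = "D (D x)"
  \<comment> \<open>Since \<open>T k\<close> commutes with the square of \<open>D\<close>, each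
    telescoping term tested against \<open>x\<close> is the squared norm of
    \<open>D (T k x)\<close>.\<close>
  have ge: "inner (T n ?z) x \<le> inner (T 0 ?z) x" for n
  proof -
    have "inner (T k (T k ?z)) x = (norm (D (T k x)))\<^sup>2" for k
      unfolding sa[of k "T k ?z"] unfolding c by (simp add: Dsa[of "D (T k x)"] power2_norm_eq_inner)
    then show ?thesis using tel[of ?z x n] by (simp add: sum_nonneg)
  qed
  have "(\<lambda>n. inner (T n ?z) x) \<longlonglongrightarrow> inner 0 x" by (intro tendsto_intros T0lim)
  then have "inner 0 x \<le> inner (T 0 ?z) x" by (rule LIMSEQ_le_const2) (use ge in auto)
  then show ?thesis using C(1) by (simp add: T0 zero_le_mult_iff zero_le_divide_iff)
qed

text \<open>With \<open>D = A - B\<close> and \<open>M = A + B\<close> one has \<open>M D = - D M\<close>, so \<open>M D\<^sup>2 = - D M D\<close> is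
  both positive and negative.\<close>

theorem op_pos_square_inj:
  fixes A B :: "'a::real_inner \<Rightarrow> 'a"
  assumes A: "op_pos A" and B: "op_pos B" and eq: "A \<circ> A = B \<circ> B"
  shows "A = B"
proof
  fix x
  interpret A: bounded_linear A by (rule op_posD(1)[OF A])
  interpret B: bounded_linear B by (rule op_posD(1)[OF B])
  define D where "D x = A x - B x" for x
  define M where "M x = A x + B x" for x
  have eq': "A (A x) = B (B x)" for x using fun_cong[OF eq, of x] by simp
  have D: "op_selfadj D" unfolding op_selfadj_def D_def[abs_def]
    using op_posD(3)[OF A] op_posD(3)[OF B]
    by (auto intro!: bounded_linear_sub A.bounded_linear_axioms B.bounded_linear_axioms simp: inner_diff_left inner_diff_right)
  have M: "op_pos M" unfolding op_pos_def op_selfadj_def M_def[abs_def]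
    using op_posD(3,4)[OF A] op_posD(3,4)[OF B]
    by (auto intro!: bounded_linear_add A.bounded_linear_axioms B.bounded_linear_axioms simp: inner_add_left inner_add_right)
  have MD: "M (D x) = - D (M x)" for x
    by (simp add: M_def D_def A.add A.diff B.add B.diff eq')
  have Dm: "D (- x) = - D x" for x by (simp add: D_def A.neg B.neg)
  have "0 \<le> inner (M (D (D x))) x"
    by (rule op_pos_commuting_square[OF M D]) (simp add: MD Dm)
  also have "\<dots> = - inner (M (D x)) (D x)"
    using D unfolding MD op_selfadj_def by simp
  finally have "inner (M (D x)) (D x) \<le> 0" by simp
  then have "inner (A (D x)) (D x) = 0" "inner (B (D x)) (D x) = 0"
    using op_posD(4)[OF A, of "D x"] op_posD(4)[OF B, of "D x"] by (simp_all add: M_def inner_add_left)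
  then have "A (D x) = 0" "B (D x) = 0" using op_pos_inner_eq_0[OF A] op_pos_inner_eq_0[OF B] by blast+
  then have "D (D x) = 0" using D_def[of "D x"] by simp
  then have "inner (D x) (D x) = 0" using D unfolding op_selfadj_def by (metis inner_zero_right)
  then show "A x = B x" by (simp add: D_def)
qed

lemma op_sqrt_eqI:
  assumes "op_pos R" "R \<circ> R = T"
  shows "op_sqrt T = R"
  unfolding op_sqrt_def by (rule the_equality) (use assms op_pos_square_inj in auto)

lemma op_adj_selfadj:
  assumes "op_selfadj T"
  shows "op_adj T = T"
  unfolding op_adj_def
proof (rule the_equality)
  show "\<forall>x y. inner (T x) y = inner x (T y)" using assms by (simp add: op_selfadj_def)
next
  fix T' assume "\<forall>x y. inner (T x) y = inner x (T' y)"
  then have *: "inner x (T' y) = inner x (T y)" for x y using assms by (simp add: op_selfadj_def)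
  show "T' = T"
  proof
    fix y show "T' y = T y" using * vector_eq_ldot[of "T' y" "T y"] by blast
  qed
qed

text \<open>A positive operator is its own modulus, so the trace condition concerns the diagonal of
  \<open>C\<close>, which dominates the squared norms by \<open>op_pos_norm_bound\<close>. This
  opens the spectral theorem to covariance operators.\<close>

lemma trace_class_op_pos_imp_hilbert_schmidt:
  assumes C: "op_pos C" and tr: "trace_class C"
  shows "hilbert_schmidt C"
proof -
  have "op_sqrt (op_adj C \<circ> C) = C"
    by (rule op_sqrt_eqI[OF C]) (simp add: op_adj_selfadj[OF op_posD(2)[OF C]])
  then obtain B where B: "onb B" "(\<lambda>e. inner (C e) e) summable_on B"
    using tr by (auto simp: trace_class_def)
  obtain K where K: "K > 0" "\<And>x. (norm (C x))\<^sup>2 \<le> K * inner (C x) x" using op_pos_norm_bound[OF C] by blast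
  have "(\<lambda>e. (norm (C e))\<^sup>2) summable_on B"
    by (rule summable_on_comparison_test[OF summable_on_cmult_right[OF B(2), of K]]) (use K in auto)
  then show ?thesis using B(1) op_posD(1)[OF C] by (auto simp: hilbert_schmidt_def)
qed

section \<open>Diagonal operators\<close>

text \<open>Functional calculus on a fixed eigenbasis: roots, inverses, inverse roots, moduli and
  signed roots are all obtained by a choice of bounded \<open>\<phi>\<close>.\<close>

definition diag_op :: "'a::real_inner set \<Rightarrow> ('a \<Rightarrow> real) \<Rightarrow> 'a \<Rightarrow> 'a" where
  "diag_op E \<phi> x = (SOME y. \<forall>e\<in>E. inner y e = \<phi> e * inner x e)"

lemma inner_diag_op:
  fixes E :: "'a::{real_inner,polish_space} set"
  assumes E: "onb E" and b: "\<And>e. e \<in> E \<Longrightarrow> \<bar>\<phi> e\<bar> \<le> C" and e: "e \<in> E"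
  shows "inner (diag_op E \<phi> x) e = \<phi> e * inner x e"
proof -
  have "(\<lambda>e. (\<phi> e * inner x e)\<^sup>2) summable_on E"
  proof (rule summable_on_comparison_test[OF summable_on_cmult_right[OF bessel_summable[OF onb_imp_orthonormal[OF E], of x], of "C\<^sup>2"]])
    fix e assume "e \<in> E"
    then show "(\<phi> e * inner x e)\<^sup>2 \<le> C\<^sup>2 * (inner x e)\<^sup>2"
      using b[of e] by (simp add: power_mult_distrib abs_le_square_iff[symmetric] mult_right_mono)
  qed simp
  from riesz_fischer[OF onb_imp_orthonormal[OF E] this]
  obtain y where "y \<in> closure (span E)" and y: "\<And>e. e \<in> E \<Longrightarrow> inner y e = \<phi> e * inner x e"
    by blast
  from y have "\<forall>e\<in>E. inner y e = \<phi> e * inner x e" by simp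
  then have "\<forall>e\<in>E. inner (diag_op E \<phi> x) e = \<phi> e * inner x e"
    unfolding diag_op_def by (rule someI)
  then show ?thesis using e by blast
qed

lemma op_selfadj_diag_op:
  fixes E :: "'a::{real_inner,polish_space} set"
  assumes E: "onb E" and b: "\<And>e. e \<in> E \<Longrightarrow> \<bar>\<phi> e\<bar> \<le> C"
  shows "op_selfadj (diag_op E \<phi>)"
proof -
  note I = inner_diag_op[OF E b]
  have "bounded_linear (diag_op E \<phi>)"
  proof (rule bounded_linear_intro[where K = "\<bar>C\<bar>"])
    fix x y r
    show "diag_op E \<phi> (x + y) = diag_op E \<phi> x + diag_op E \<phi> y"
      by (rule onb_eqI[OF E]) (simp add: I inner_add_left algebra_simps)
    show "diag_op E \<phi> (r *\<^sub>R x) = r *\<^sub>R diag_op E \<phi> x"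
      by (rule onb_eqI[OF E]) (simp add: I)
    have "(norm (diag_op E \<phi> x))\<^sup>2 \<le> C\<^sup>2 * (norm x)\<^sup>2"
    proof (rule has_sum_mono[OF onb_parseval[OF E] has_sum_cmult_right[OF onb_parseval[OF E]]])
      fix e assume e: "e \<in> E"
      then show "(inner (diag_op E \<phi> x) e)\<^sup>2 \<le> C\<^sup>2 * (inner x e)\<^sup>2"
        using b[of e] by (simp add: I power_mult_distrib abs_le_square_iff[symmetric] mult_right_mono)
    qed
    then have "(norm (diag_op E \<phi> x))\<^sup>2 \<le> (norm x * \<bar>C\<bar>)\<^sup>2" by (simp add: power_mult_distrib mult.commute)
    then show "norm (diag_op E \<phi> x) \<le> norm x * \<bar>C\<bar>" by (rule power2_le_imp_le) simp
  qed
  moreover have "inner (diag_op E \<phi> x) y = inner x (diag_op E \<phi> y)" for x y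
  proof -
    have "((\<lambda>e. inner (diag_op E \<phi> x) e * inner y e) has_sum inner (diag_op E \<phi> x) y) E"
      by (rule onb_parseval_inner[OF E])
    moreover have "((\<lambda>e. inner x e * inner (diag_op E \<phi> y) e) has_sum inner x (diag_op E \<phi> y)) E"
      by (rule onb_parseval_inner[OF E])
    moreover have "((\<lambda>e. inner (diag_op E \<phi> x) e * inner y e) has_sum z) E \<longleftrightarrow>
        ((\<lambda>e. inner x e * inner (diag_op E \<phi> y) e) has_sum z) E" for z
      by (rule has_sum_cong) (simp add: I)
    ultimately show ?thesis using has_sum_unique by blast
  qed
  ultimately show ?thesis by (auto simp: op_selfadj_def)
qed

lemma op_pos_diag_op:
  fixes E :: "'a::{real_inner,polish_space} set"
  assumes E: "onb E" and b: "\<And>e. e \<in> E \<Longrightarrow> 0 \<le> \<phi> e" "\<And>e. e \<in> E \<Longrightarrow> \<phi> e \<le> C"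
  shows "op_pos (diag_op E \<phi>)"
proof -
  have b': "\<And>e. e \<in> E \<Longrightarrow> \<bar>\<phi> e\<bar> \<le> C" using b by auto
  have "0 \<le> inner (diag_op E \<phi> x) x" for x
    by (rule has_sum_nonneg[OF onb_parseval_inner[OF E]]) (use b in \<open>auto simp: inner_diag_op[OF E b'] mult.assoc\<close>)
  then show ?thesis using op_selfadj_diag_op[OF E b'] by (auto simp: op_pos_def)
qed

lemma diag_op_basis:
  fixes E :: "'a::{real_inner,polish_space} set"
  assumes E: "onb E" and b: "\<And>e. e \<in> E \<Longrightarrow> \<bar>\<phi> e\<bar> \<le> C" and e: "e \<in> E"
  shows "diag_op E \<phi> e = \<phi> e *\<^sub>R e"
  by (rule onb_eqI[OF E]) (use e in \<open>auto simp: inner_diag_op[OF E b] orthonormal_inner[OF onb_imp_orthonormal[OF E]]\<close>)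

lemma op_sqrt_eq_diag_op:
  fixes E :: "'a::{real_inner,polish_space} set"
  assumes E: "onb E" and b: "\<And>e. e \<in> E \<Longrightarrow> 0 \<le> \<phi> e" "\<And>e. e \<in> E \<Longrightarrow> \<phi> e \<le> C"
    and T: "\<And>x e. e \<in> E \<Longrightarrow> inner (T x) e = \<phi> e * inner x e"
  shows "op_sqrt T = diag_op E (\<lambda>e. sqrt (\<phi> e))"
proof (rule op_sqrt_eqI)
  have b': "\<And>e. e \<in> E \<Longrightarrow> sqrt (\<phi> e) \<le> sqrt C" using b by auto
  show "op_pos (diag_op E (\<lambda>e. sqrt (\<phi> e)))"
    by (rule op_pos_diag_op[OF E _ b']) (use b in auto)
  have b'': "\<bar>sqrt (\<phi> e)\<bar> \<le> sqrt C" if "e \<in> E" for e using b(1)[OF that] b'[OF that] by simp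
  have "inner (diag_op E (\<lambda>e. sqrt (\<phi> e)) x) e = sqrt (\<phi> e) * inner x e" if "e \<in> E" for x e
    by (rule inner_diag_op[OF E b'' that])
  then show "diag_op E (\<lambda>e. sqrt (\<phi> e)) \<circ> diag_op E (\<lambda>e. sqrt (\<phi> e)) = T"
    using b(1) by (intro ext onb_eqI[OF E]) (simp add: T)
qed

section \<open>Relative entropy\<close>

context
  fixes M N :: "'b measure"
  assumes M: "prob_space M" and N: "prob_space N"
    and ac: "absolutely_continuous M N" and sets_eq: "sets N = sets M"
begin

private definition r :: "'b \<Rightarrow> real" where "r x = enn2real (RN_deriv M N x)"

private lemma r_measurable [measurable]: "r \<in> borel_measurable M" "r \<in> borel_measurable N"
  unfolding measurable_cong_sets[OF sets_eq refl] r_def by measurable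

private lemma r_nonneg [simp]: "0 \<le> r x"
  by (simp add: r_def)

private lemma nn_integral_r:
  assumes [measurable]: "f \<in> borel_measurable M"
  shows "(\<integral>\<^sup>+x. f x \<partial>N) = (\<integral>\<^sup>+x. ennreal (r x) * f x \<partial>M)"
proof -
  interpret M: prob_space M by (rule M)
  interpret N: prob_space N by (rule N)
  have "(\<integral>\<^sup>+x. f x \<partial>N) = (\<integral>\<^sup>+x. RN_deriv M N x * f x \<partial>M)"
    by (rule M.RN_deriv_nn_integral[OF ac sets_eq]) simp
  also have "\<dots> = (\<integral>\<^sup>+x. ennreal (r x) * f x \<partial>M)"
    by (rule nn_integral_cong_AE)
       (use M.RN_deriv_finite[OF N.sigma_finite_measure_axioms ac sets_eq] in
        \<open>auto simp: r_def less_top elim!: eventually_mono\<close>)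
  finally show ?thesis .
qed

private lemma AE_r_pos: "AE x in N. 0 < r x"
proof (rule AE_I[where N = "{x\<in>space N. r x = 0}"])
  have [measurable]: "{x\<in>space N. r x = 0} \<in> sets N" by measurable
  have "emeasure N {x\<in>space N. r x = 0} = (\<integral>\<^sup>+x. indicator {x\<in>space N. r x = 0} x \<partial>N)" by simp
  also have "\<dots> = (\<integral>\<^sup>+x. ennreal (r x) * indicator {x\<in>space N. r x = 0} x \<partial>M)"
    by (rule nn_integral_r) (use sets_eq in \<open>auto intro!: borel_measurable_indicator\<close>)
  also have "\<dots> = (\<integral>\<^sup>+x. 0 \<partial>M)" by (rule nn_integral_cong) (auto simp: indicator_def)
  finally show "emeasure N {x\<in>space N. r x = 0} = 0" by simp
qed (auto simp: less_le)

text \<open>Under \<open>M\<close> the integrand becomes \<open>- r ln r\<close>, which is at most 1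
  by \<open>ln t \<le> t - 1\<close> at \<open>t = 1 / r\<close>. Hence the subtraction in
  \<open>KL\<close> never meets infinity minus infinity, and an infinite positive part forces
  infinite entropy.\<close>

private lemma neg_part_le_1: "(\<integral>\<^sup>+x. ennreal (- ln (r x)) \<partial>N) \<le> 1"
proof -
  interpret M: prob_space M by (rule M)
  have "(\<integral>\<^sup>+x. ennreal (- ln (r x)) \<partial>N) = (\<integral>\<^sup>+x. ennreal (r x) * ennreal (- ln (r x)) \<partial>M)"
    by (rule nn_integral_r) measurable
  also have "\<dots> \<le> (\<integral>\<^sup>+x. 1 \<partial>M)"
  proof (rule nn_integral_mono)
    fix x
    have "r x * - ln (r x) \<le> 1"
    proof (cases "r x = 0")
      case False
      then have p: "0 < r x" using r_nonneg[of x] by linarith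
      have "ln (1 / r x) \<le> 1 / r x - 1" by (rule ln_le_minus_one) (use p in simp)
      then have "r x * - ln (r x) \<le> r x * (1 / r x - 1)"
        using p by (intro mult_left_mono) (auto simp: ln_div)
      also have "\<dots> \<le> 1" using p by (simp add: algebra_simps)
      finally show ?thesis .
    qed simp
    then show "ennreal (r x) * ennreal (- ln (r x)) \<le> 1"
      by (simp add: ennreal_mult'[symmetric] ennreal_le_1)
  qed
  also have "\<dots> = 1" by (simp add: M.emeasure_space_1)
  finally show ?thesis .
qed

private lemma KL_eq:
  "KL N M = enn2ereal (\<integral>\<^sup>+x. ennreal (ln (r x)) \<partial>N) - enn2ereal (\<integral>\<^sup>+x. ennreal (- ln (r x)) \<partial>N)"
proof -
  have "ennreal (max 0 t) = ennreal t" for t by (simp add: max_def ennreal_neg)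
  then show ?thesis using ac sets_eq by (simp add: KL_def r_def)
qed

private lemma KL_cases:
  obtains "KL N M = \<infinity>" | "integrable N (\<lambda>x. ln (r x))" "KL N M = ereal (\<integral>x. ln (r x) \<partial>N)"
proof (cases "(\<integral>\<^sup>+x. ennreal (ln (r x)) \<partial>N) = \<infinity>")
  case True
  have "enn2ereal (\<integral>\<^sup>+x. ennreal (- ln (r x)) \<partial>N) \<le> 1"
    using neg_part_le_1 by (simp add: less_eq_ennreal.rep_eq one_ennreal.rep_eq)
  then have "KL N M = \<infinity>" unfolding KL_eq True by (cases "enn2ereal (\<integral>\<^sup>+x. ennreal (- ln (r x)) \<partial>N)") auto
  then show ?thesis by (rule that)
next
  case False
  have neg: "(\<integral>\<^sup>+x. ennreal (- ln (r x)) \<partial>N) \<noteq> \<infinity>" using neg_part_le_1 by (auto simp: top_unique)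
  have int: "integrable N (\<lambda>x. ln (r x))"
    unfolding real_integrable_def using False neg by auto
  have "KL N M = ereal (\<integral>x. ln (r x) \<partial>N)"
    unfolding KL_eq real_lebesgue_integral_def[OF int]
    using False neg by (cases "\<integral>\<^sup>+x. ennreal (ln (r x)) \<partial>N"; cases "\<integral>\<^sup>+x. ennreal (- ln (r x)) \<partial>N")
      (auto simp: enn2ereal_ennreal)
  then show ?thesis using that int by blast
qed

lemma KL_cases_real:
  obtains "KL N M = \<infinity>" | k where "KL N M = ereal k"
  by (rule KL_cases) auto

text \<open>The tangent bound \<open>ln t \<le> t - 1\<close> at
  \<open>t = exp (f x) / (r x * c)\<close>, with \<open>c\<close> the exponential integral under
  \<open>M\<close>, is integrated against \<open>N\<close>. The function \<open>f\<close> may be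
  unbounded because it will contain quadratic log-likelihood ratios.\<close>

lemma donsker_varadhan_ge:
  assumes k: "KL N M = ereal k" and f: "integrable N f" and f_meas [measurable]: "f \<in> borel_measurable M"
    and ef: "integrable M (\<lambda>x. exp (f x))"
  shows "(\<integral>x. f x \<partial>N) \<le> k + ln (\<integral>x. exp (f x) \<partial>M)"
proof -
  interpret M: prob_space M by (rule M)
  interpret N: prob_space N by (rule N)
  have int: "integrable N (\<lambda>x. ln (r x))" and k': "k = (\<integral>x. ln (r x) \<partial>N)"
    using k by (auto intro: KL_cases)
  define c where "c = (\<integral>x. exp (f x) \<partial>M)"
  note borel_measurable_integrable[OF f, measurable]
  have c: "0 < c" unfolding c_def
    by (rule M.expectation_greater[OF ef]) simp
  \<comment> \<open>Only an inequality: the mass of \<open>exp f\<close> on the set where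
    \<open>r\<close> vanishes is lost.\<close>
  have nn: "(\<integral>\<^sup>+x. ennreal (exp (f x) / (r x * c)) \<partial>N) \<le> 1"
  proof -
    have "(\<integral>\<^sup>+x. ennreal (exp (f x) / (r x * c)) \<partial>N)
        = (\<integral>\<^sup>+x. ennreal (r x) * ennreal (exp (f x) / (r x * c)) \<partial>M)"
      by (rule nn_integral_r) measurable
    also have "\<dots> \<le> (\<integral>\<^sup>+x. ennreal (exp (f x) / c) \<partial>M)"
      by (rule nn_integral_mono) (use c in \<open>auto simp: ennreal_mult'[symmetric] intro!: ennreal_leI\<close>)
    also have "\<dots> = ennreal (\<integral>x. exp (f x) / c \<partial>M)"
      by (rule nn_integral_eq_integral) (use ef c in auto)
    also have "\<dots> = 1" using c by (simp add: c_def)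
    finally show ?thesis .
  qed
  have int2: "integrable N (\<lambda>x. exp (f x) / (r x * c))"
    by (rule integrableI_nonneg) (use c nn in \<open>auto intro: le_less_trans\<close>)
  have le1: "(\<integral>x. exp (f x) / (r x * c) \<partial>N) \<le> 1"
  proof -
    have "ennreal (\<integral>x. exp (f x) / (r x * c) \<partial>N) \<le> 1"
      by (subst nn_integral_eq_integral[symmetric, OF int2]) (use c nn in auto)
    then show ?thesis by simp
  qed
  have "(\<integral>x. f x - ln (r x) \<partial>N) \<le> (\<integral>x. exp (f x) / (r x * c) - 1 + ln c \<partial>N)"
  proof (rule integral_mono_AE)
    show "integrable N (\<lambda>x. f x - ln (r x))" using f int by simp
    show "integrable N (\<lambda>x. exp (f x) / (r x * c) - 1 + ln c)" using int2 by simp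
    show "AE x in N. f x - ln (r x) \<le> exp (f x) / (r x * c) - 1 + ln c"
      using AE_r_pos
    proof eventually_elim
      case (elim x)
      have "ln (exp (f x) / (r x * c)) \<le> exp (f x) / (r x * c) - 1"
        by (rule ln_le_minus_one) (use elim c in simp)
      then show ?case using elim c by (simp add: ln_div ln_mult)
    qed
  qed
  also have "\<dots> = (\<integral>x. exp (f x) / (r x * c) \<partial>N) - 1 + ln c"
    using int2 by (simp add: N.prob_space)
  also have "\<dots> \<le> ln c" using le1 by simp
  finally show ?thesis using f int by (simp add: k' c_def)
qed

lemma KL_nonneg: "0 \<le> KL N M"
proof (rule KL_cases_real)
  fix k assume k: "KL N M = ereal k"
  interpret M: prob_space M by (rule M)
  show ?thesis using donsker_varadhan_ge[OF k, of "\<lambda>_. 0"] k by (simp add: M.prob_space)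
qed simp

text \<open>The optimal test function \<open>ln r\<close> need not be bounded, so truncations of it
  are inserted and the positive part is recovered by monotone convergence. The negative part
  \<open>q\<close> has integral at most 1 and is subtracted as a whole.\<close>

lemma donsker_varadhan_le:
  assumes K: "\<And>g C. g \<in> borel_measurable M \<Longrightarrow> (\<And>x. \<bar>g x\<bar> \<le> C) \<Longrightarrow>
      (\<integral>x. g x \<partial>N) \<le> K + ln (\<integral>x. exp (g x) \<partial>M)"
  shows "KL N M \<le> ereal K"
proof -
  interpret M: prob_space M by (rule M)
  interpret N: prob_space N by (rule N)
  define p where "p n x = min (real n) (max 0 (ln (r x)))" for n x
  define q where "q x = max 0 (- ln (r x))" for x
  \<comment> \<open>Where \<open>r\<close> vanishes, the value of \<open>ln\<close> is only a
    default. There \<open>g\<close> takes the lower cutoff, so that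
    \<open>exp (g n x) \<le> r x + exp (- n)\<close> holds everywhere and the exponential integral
    stays close to 1.\<close>
  define g where "g n x = (if 0 < r x then max (- real n) (min (real n) (ln (r x))) else - real n)" for n x
  have [measurable]: "p n \<in> borel_measurable M" "g n \<in> borel_measurable M" "q \<in> borel_measurable M"
    "p n \<in> borel_measurable N" "g n \<in> borel_measurable N" "q \<in> borel_measurable N" for n
    unfolding p_def g_def q_def by measurable
  have q_ennreal: "ennreal (q x) = ennreal (- ln (r x))" for x by (simp add: q_def max_def ennreal_neg)
  have q_int: "integrable N q"
    by (rule integrableI_nonneg) (use neg_part_le_1 in \<open>auto simp: q_def[symmetric] q_ennreal intro: le_less_trans, auto simp: q_def\<close>)
  define m where "m = (\<integral>x. q x \<partial>N)"
  have nn_q: "(\<integral>\<^sup>+x. ennreal (- ln (r x)) \<partial>N) = ennreal m"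
    unfolding m_def using nn_integral_eq_integral[OF q_int] by (simp add: q_ennreal) (simp add: q_def)
  have m0: "0 \<le> m" unfolding m_def by (rule integral_nonneg_AE) (simp add: q_def)
  have r_int: "integrable M r" and r_int1: "(\<integral>x. r x \<partial>M) = 1"
  proof -
    have *: "(\<integral>\<^sup>+x. ennreal (r x) \<partial>M) = 1"
      using nn_integral_r[of "\<lambda>_. 1"] by (simp add: N.emeasure_space_1)
    show "integrable M r" by (rule integrableI_nonneg) (use * in auto)
    then show "(\<integral>x. r x \<partial>M) = 1" using nn_integral_eq_integral[of M r] * by simp
  qed
  have g_bd: "\<bar>g n x\<bar> \<le> real n" for n x by (auto simp: g_def)
  have g_int: "integrable N (g n)" for n
    by (rule N.integrable_const_bound[where B = "real n"]) (use g_bd in auto)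
  have p_int: "integrable N (p n)" for n
    by (rule N.integrable_const_bound[where B = "real n"]) (auto simp: p_def)
  have eg_le: "exp (g n x) \<le> r x + exp (- real n)" for n x
  proof (cases "0 < r x")
    case True
    have "exp (g n x) \<le> max (exp (- real n)) (r x)"
    proof (cases "- real n \<le> ln (r x)")
      case t: True
      then have "g n x \<le> ln (r x)" using True by (auto simp: g_def)
      then have "exp (g n x) \<le> exp (ln (r x))" by simp
      then show ?thesis using True by simp
    next
      case False
      then have "g n x = - real n" using True by (auto simp: g_def)
      then show ?thesis by simp
    qed
    also have "\<dots> \<le> r x + exp (- real n)" by simp
    finally show ?thesis .
  next
    case False then show ?thesis by (simp add: g_def)
  qed
  have step: "(\<integral>x. p n x \<partial>N) \<le> K + exp (- real n) + m" for n
  proof -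
    have eg_int: "integrable M (\<lambda>x. exp (g n x))"
      by (rule M.integrable_const_bound[where B = "exp (real n)"]) (use g_bd in \<open>auto simp: abs_le_iff\<close>)
    have pos: "0 < (\<integral>x. exp (g n x) \<partial>M)" by (rule M.expectation_greater[OF eg_int]) simp
    have "(\<integral>x. exp (g n x) \<partial>M) \<le> (\<integral>x. r x + exp (- real n) \<partial>M)"
      by (rule integral_mono) (use eg_int r_int eg_le in auto)
    also have "\<dots> = 1 + exp (- real n)" using r_int r_int1 by (simp add: M.prob_space)
    finally have "ln (\<integral>x. exp (g n x) \<partial>M) \<le> exp (- real n)"
      using ln_le_minus_one[OF pos] by linarith
    moreover have "(\<integral>x. p n x - q x \<partial>N) \<le> (\<integral>x. g n x \<partial>N)"
    proof (rule integral_mono_AE)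
      show "AE x in N. p n x - q x \<le> g n x" using AE_r_pos
        by eventually_elim (auto simp: p_def q_def g_def)
    qed (use p_int q_int g_int in auto)
    ultimately show ?thesis using K[of "g n" "real n"] g_bd p_int q_int by (simp add: m_def)
  qed
  have p_mono: "p i x \<le> p j x" if "i \<le> j" for i j x using that by (auto simp: p_def)
  \<comment> \<open>Since \<open>p n\<close> lies below \<open>p j\<close> for all later
    \<open>j\<close>, the error \<open>exp (- j)\<close> vanishes while \<open>n\<close> stays
    fixed.\<close>
  have p_le: "(\<integral>x. p n x \<partial>N) \<le> K + m" for n
  proof -
    have "(\<lambda>j. exp (- real j)) \<longlonglongrightarrow> 0"
      by (rule filterlim_compose[OF exp_at_bot]) (simp add: filterlim_uminus_at_bot filterlim_real_sequentially)
    then have "(\<lambda>j. K + exp (- real j) + m) \<longlonglongrightarrow> K + 0 + m" by (intro tendsto_intros)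
    then have "(\<integral>x. p n x \<partial>N) \<le> K + 0 + m"
    proof (rule LIMSEQ_le_const)
      show "\<exists>N'. \<forall>j\<ge>N'. (\<integral>x. p n x \<partial>N) \<le> K + exp (- real j) + m"
        by (rule exI[of _ n]) (use step p_mono p_int integral_mono in \<open>meson order_trans\<close>)
    qed
    then show ?thesis by simp
  qed
  have SUPp: "ennreal (ln (r x)) = (SUP n. ennreal (p n x))" for x
  proof -
    have "\<forall>\<^sub>F n in sequentially. ennreal (p n x) = ennreal (ln (r x))"
    proof -
      obtain n0 where "ln (r x) \<le> real n0" using real_arch_simple by blast
      then have "ennreal (p n x) = ennreal (ln (r x))" if "n \<ge> n0" for n
        using that by (auto simp: p_def max_def min_def ennreal_neg)
      then show ?thesis by (auto simp: eventually_sequentially)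
    qed
    then have "(\<lambda>n. ennreal (p n x)) \<longlonglongrightarrow> ennreal (ln (r x))" by (rule tendsto_eventually)
    moreover have "(\<lambda>n. ennreal (p n x)) \<longlonglongrightarrow> (SUP n. ennreal (p n x))"
      by (rule LIMSEQ_SUP) (auto simp: incseq_def p_mono intro: ennreal_leI)
    ultimately show ?thesis by (rule LIMSEQ_unique)
  qed
  have "(\<integral>\<^sup>+x. ennreal (ln (r x)) \<partial>N) = (SUP n. \<integral>\<^sup>+x. ennreal (p n x) \<partial>N)"
    unfolding SUPp
    by (rule nn_integral_monotone_convergence_SUP) (auto simp: incseq_def le_fun_def p_mono intro: ennreal_leI)
  also have "\<dots> \<le> ennreal (K + m)"
  proof (rule SUP_least)
    fix n
    have "(\<integral>\<^sup>+x. ennreal (p n x) \<partial>N) = ennreal (\<integral>x. p n x \<partial>N)"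
      by (rule nn_integral_eq_integral[OF p_int]) (simp add: p_def)
    then show "(\<integral>\<^sup>+x. ennreal (p n x) \<partial>N) \<le> ennreal (K + m)" using p_le[of n] by (simp add: ennreal_leI)
  qed
  finally have le: "(\<integral>\<^sup>+x. ennreal (ln (r x)) \<partial>N) \<le> ennreal (K + m)" .
  have "0 \<le> K + m" using p_le[of 0] by (simp add: p_def)
  then have "enn2ereal (\<integral>\<^sup>+x. ennreal (ln (r x)) \<partial>N) \<le> ereal (K + m)"
    using le by (simp add: less_eq_ennreal.rep_eq enn2ereal_ennreal)
  then show ?thesis unfolding KL_eq nn_q using m0
    by (cases "enn2ereal (\<integral>\<^sup>+x. ennreal (ln (r x)) \<partial>N)") (auto simp: enn2ereal_ennreal)
qed

text \<open>The Donsker--Varadhan inequality for \<open>t * indicator B\<close> bounds the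
  \<open>N\<close>-measure of \<open>B\<close> by its \<open>M\<close>-measure times
  \<open>(exp t - 1) / t\<close>. Letting \<open>t\<close> decrease to 0 gives domination on every
  set, and complements turn it into equality.\<close>

lemma KL_eq_0_imp_eq:
  assumes 0: "KL N M = 0"
  shows "N = M"
proof -
  interpret M: prob_space M by (rule M)
  interpret N: prob_space N by (rule N)
  have le: "measure N B \<le> measure M B" if B [measurable]: "B \<in> sets M" for B
  proof -
    have BN [measurable]: "B \<in> sets N" using B sets_eq by simp
    have t: "measure N B \<le> measure M B * ((exp t - 1) / t)" if t: "t > 0" for t
    proof -
      have i: "integrable N (\<lambda>x. t * indicator B x)"
        by (intro integrable_mult_right integrable_real_indicator) (simp_all add: BN N.emeasure_eq_measure)
      have e: "exp (t * indicator B x) = 1 + (exp t - 1) * indicator B x" for x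
        by (auto simp: indicator_def)
      have ei: "integrable M (\<lambda>x. exp (t * indicator B x))" unfolding e
        by (intro Bochner_Integration.integrable_add integrable_mult_right integrable_real_indicator) (simp_all add: M.emeasure_eq_measure)
      have ev: "(\<integral>x. exp (t * indicator B x) \<partial>M) = 1 + (exp t - 1) * measure M B"
        unfolding e
        by (subst Bochner_Integration.integral_add)
           (auto intro!: integrable_mult_right integrable_real_indicator simp: M.emeasure_eq_measure M.prob_space)
      have "(\<integral>x. t * indicator B x \<partial>N) \<le> 0 + ln (\<integral>x. exp (t * indicator B x) \<partial>M)"
        by (rule donsker_varadhan_ge[OF _ i _ ei]) (use 0 in \<open>auto simp: zero_ereal_def\<close>)
      then have "t * measure N B \<le> ln (1 + (exp t - 1) * measure M B)" by (simp add: ev)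
      also have "\<dots> \<le> (exp t - 1) * measure M B" using t by (intro ln_add_one_self_le_self) auto
      finally show ?thesis using t by (simp add: field_simps)
    qed
    have "((\<lambda>t. (exp t - 1) / t) \<longlongrightarrow> 1) (at_right (0::real))"
      using DERIV_exp[of "0::real"] by (auto simp: has_field_derivative_iff intro: filterlim_mono at_le)
    then have "((\<lambda>t. measure M B * ((exp t - 1) / t)) \<longlongrightarrow> measure M B * 1) (at_right 0)"
      by (intro tendsto_intros)
    then have "measure N B \<le> measure M B * 1"
      by (rule tendsto_lowerbound[OF _ eventually_mono[OF eventually_at_right_less]]) (use t in simp_all)
    then show ?thesis by simp
  qed
  show ?thesis
  proof (rule measure_eqI[OF sets_eq])
    fix B assume B: "B \<in> sets N"
    then have BM: "B \<in> sets M" using sets_eq by simp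
    have sp: "space N = space M" using sets_eq by (rule sets_eq_imp_space_eq)
    have "measure N (space N - B) \<le> measure M (space M - B)"
      using le[of "space M - B"] BM sp by auto
    then have "measure M B \<le> measure N B" using N.prob_compl[OF B] M.prob_compl[OF BM] by simp
    then have "measure N B = measure M B" using le[OF BM] by simp
    then show "emeasure N B = emeasure M B" by (simp add: N.emeasure_eq_measure M.emeasure_eq_measure)
  qed
qed

end

lemma KL_refl:
  assumes "prob_space M"
  shows "KL M M = 0"
proof -
  interpret M: prob_space M by (rule assms)
  have ac: "absolutely_continuous M M" by (simp add: absolutely_continuous_def)
  have "density M (\<lambda>_. 1) = M" by (simp add: density_1)
  then have "AE x in M. 1 = RN_deriv M M x" by (intro M.RN_deriv_unique) auto
  then have "AE x in M. ln (enn2real (RN_deriv M M x)) = 0"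
    by eventually_elim simp
  then have "(\<integral>\<^sup>+x. ennreal (max 0 (ln (enn2real (RN_deriv M M x)))) \<partial>M) = (\<integral>\<^sup>+x. 0 \<partial>M)"
    "(\<integral>\<^sup>+x. ennreal (max 0 (- ln (enn2real (RN_deriv M M x)))) \<partial>M) = (\<integral>\<^sup>+x. 0 \<partial>M)"
    by (intro nn_integral_cong_AE; eventually_elim; simp)+
  then show ?thesis using ac by (simp add: KL_def zero_ennreal.rep_eq)
qed

section \<open>Almost sure approximation\<close>

lemma AE_absolutely_continuous:
  assumes "absolutely_continuous M N" "sets N = sets M" "AE x in M. P x"
  shows "AE x in N. P x"
  using absolutely_continuous_AE[OF assms(2,1,3)] .

text \<open>Summable L1 norms make the pointwise series finite almost everywhere. This is why the
  approximations below are chosen with geometric rates.\<close>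

lemma AE_tendsto_0_of_summable:
  fixes f :: "nat \<Rightarrow> 'b \<Rightarrow> real"
  assumes [measurable]: "\<And>n. f n \<in> borel_measurable M"
    and le: "\<And>n. (\<integral>\<^sup>+x. ennreal \<bar>f n x\<bar> \<partial>M) \<le> ennreal (a n)" and a: "summable a" "\<And>n. 0 \<le> a n"
  shows "AE x in M. summable (\<lambda>n. \<bar>f n x\<bar>)" "AE x in M. (\<lambda>n. f n x) \<longlonglongrightarrow> 0"
proof -
  have "(\<integral>\<^sup>+x. (\<Sum>n. ennreal \<bar>f n x\<bar>) \<partial>M) = (\<Sum>n. \<integral>\<^sup>+x. ennreal \<bar>f n x\<bar> \<partial>M)"
    by (rule nn_integral_suminf) measurable
  also have "\<dots> \<le> (\<Sum>n. ennreal (a n))" by (intro suminf_le le) auto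
  also have "\<dots> = ennreal (\<Sum>n. a n)" using a by (intro suminf_ennreal2) auto
  finally have "(\<integral>\<^sup>+x. (\<Sum>n. ennreal \<bar>f n x\<bar>) \<partial>M) \<noteq> \<infinity>" by (auto simp: top_unique)
  then have "AE x in M. (\<Sum>n. ennreal \<bar>f n x\<bar>) \<noteq> \<infinity>" by (intro nn_integral_PInf_AE) auto
  then show *: "AE x in M. summable (\<lambda>n. \<bar>f n x\<bar>)"
    by eventually_elim (rule summable_suminf_not_top, auto)
  from * show "AE x in M. (\<lambda>n. f n x) \<longlonglongrightarrow> 0"
    by eventually_elim (metis summable_LIMSEQ_zero tendsto_rabs_zero_cancel)
qed

text \<open>Inner regularity replaces the set by a compact subset, and cutoffs of the distance to it
  approximate its indicator. The error \<open>(1/2)^n\<close> in L1 is summable, which upgrades the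
  convergence to almost everywhere.\<close>

lemma borel_set_AE_limit_continuous:
  fixes M :: "'a::polish_space measure"
  assumes M: "prob_space M" and sets: "sets M = sets borel" and A: "A \<in> sets borel"
  obtains u :: "nat \<Rightarrow> 'a \<Rightarrow> real" where "\<And>n. continuous_on UNIV (u n)" "\<And>n x. 0 \<le> u n x" "\<And>n x. u n x \<le> 1"
    "AE x in M. (\<lambda>n. u n x) \<longlonglongrightarrow> indicator A x"
proof -
  interpret M: prob_space M by (rule M)
  have "\<exists>u. continuous_on UNIV u \<and> (\<forall>x. 0 \<le> u x \<and> u x \<le> 1) \<and> (\<integral>x. \<bar>u x - indicator A x\<bar> \<partial>M) \<le> \<epsilon>"
    if \<epsilon>: "\<epsilon> > 0" for \<epsilon> :: real
  proof -
    obtain K where K: "K \<subseteq> A" "compact K" "emeasure M A < emeasure M K + ennreal (\<epsilon>/2)"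
    proof (cases "emeasure M A = 0")
      case True then show ?thesis using that[of "{}"] \<epsilon> by simp
    next
      case False
      have "emeasure M A - ennreal (\<epsilon>/2) < emeasure M A"
        using False \<epsilon> by (simp add: M.emeasure_eq_measure ennreal_minus) (intro ennreal_lessI, simp_all add: zero_less_measure_iff)
      also have "emeasure M A = (SUP K\<in>{K. K \<subseteq> A \<and> compact K}. emeasure M K)"
        by (rule inner_regular[OF sets _ A]) simp
      finally obtain K where "K \<subseteq> A" "compact K" "emeasure M A - ennreal (\<epsilon>/2) < emeasure M K"
        unfolding less_SUP_iff by auto
      moreover from this(3) have "ennreal (measure M A - \<epsilon>/2) < ennreal (measure M K)"
        using \<epsilon> by (simp add: M.emeasure_eq_measure ennreal_minus)
      then have "measure M A - \<epsilon>/2 < measure M K" by (meson ennreal_leI leD linorder_not_less)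
      ultimately show ?thesis using that[of K] \<epsilon>
        by (simp add: M.emeasure_eq_measure ennreal_less_iff flip: ennreal_plus)
    qed
    have [measurable]: "K \<in> sets M" "A \<in> sets M" using K(2) A sets by (auto intro: borel_compact)
    have KA: "(\<integral>x. \<bar>indicator K x - indicator A x\<bar> \<partial>M) < \<epsilon>/2"
    proof -
      have "(\<lambda>x. \<bar>indicator K x - indicator A x :: real\<bar>) = (\<lambda>x. indicator A x - indicator K x)"
        using K(1) by (auto simp: indicator_def fun_eq_iff)
      moreover have "measure M A < measure M K + \<epsilon>/2"
        using K(3) \<epsilon> by (simp add: M.emeasure_eq_measure ennreal_less_iff flip: ennreal_plus)
      ultimately show ?thesis
        by (simp add: Bochner_Integration.integral_diff integrable_real_indicator M.emeasure_eq_measure)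
    qed
    show ?thesis
    proof (cases "K = {}")
      case True
      then show ?thesis using KA \<epsilon> by (intro exI[of _ "\<lambda>_. 0"]) auto
    next
      case False
      \<comment> \<open>Lipschitz cutoffs decreasing to the indicator of \<open>K\<close>. The empty
        set is treated apart because \<open>infdist x {}\<close> is 0, which would make every
        \<open>v k\<close> constantly 1.\<close>
      define v where "v k x = max 0 (1 - real k * infdist x K)" for k x
      have vc: "continuous_on UNIV (v k)" for k unfolding v_def by (intro continuous_intros)
      have [measurable]: "v k \<in> borel_measurable M" for k
        using borel_measurable_continuous_onI[OF vc] measurable_cong_sets[OF sets refl] by blast
      have v01: "0 \<le> v k x" "v k x \<le> 1" for k x by (auto simp: v_def infdist_nonneg)
      have vlim: "(\<lambda>k. v k x) \<longlonglongrightarrow> indicator K x" for x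
      proof (cases "x \<in> K")
        case True then show ?thesis by (simp add: v_def)
      next
        case x: False
        have "0 < infdist x K"
          using in_closed_iff_infdist_zero[OF compact_imp_closed[OF K(2)] False, of x] x infdist_nonneg[of x K] by auto
        then obtain k0 where "1 < real k0 * infdist x K" using reals_Archimedean3 by blast
        then have "v k x = 0" if "k \<ge> k0" for k
          using that mult_right_mono[of "real k0" "real k" "infdist x K"] infdist_nonneg[of x K] by (auto simp: v_def)
        then have "\<forall>\<^sub>F k in sequentially. v k x = 0" by (auto simp: eventually_sequentially)
        then show ?thesis using x by (simp add: tendsto_eventually)
      qed
      have "(\<lambda>k. \<integral>x. \<bar>v k x - indicator A x\<bar> \<partial>M) \<longlonglongrightarrow> (\<integral>x. \<bar>indicator K x - indicator A x\<bar> \<partial>M)"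
      proof (rule integral_dominated_convergence[where w = "\<lambda>_. 1"])
        show "AE x in M. (\<lambda>k. \<bar>v k x - indicator A x\<bar>) \<longlonglongrightarrow> \<bar>indicator K x - indicator A x\<bar>"
          by (intro AE_I2 tendsto_intros vlim)
        show "AE x in M. norm \<bar>v k x - indicator A x\<bar> \<le> 1" for k
        proof (rule AE_I2)
          fix x show "norm \<bar>v k x - indicator A x\<bar> \<le> 1" using v01[of k x] by (auto simp: indicator_def)
        qed
      qed auto
      then have "\<forall>\<^sub>F k in sequentially. (\<integral>x. \<bar>v k x - indicator A x\<bar> \<partial>M) < \<epsilon>"
        by (rule order_tendstoD(2)) (use KA \<epsilon> in linarith)
      then obtain k where "(\<integral>x. \<bar>v k x - indicator A x\<bar> \<partial>M) < \<epsilon>" by (auto simp: eventually_sequentially)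
      then show ?thesis using vc v01 by (intro exI[of _ "v k"]) auto
    qed
  qed
  then have "\<forall>n. \<exists>u. continuous_on UNIV u \<and> (\<forall>x. 0 \<le> u x \<and> u x \<le> 1) \<and> (\<integral>x. \<bar>u x - indicator A x\<bar> \<partial>M) \<le> (1/2::real)^n"
    by simp
  from choice[OF this] obtain u :: "nat \<Rightarrow> 'a \<Rightarrow> real" where u: "\<And>n. continuous_on UNIV (u n)" "\<And>n x. 0 \<le> u n x" "\<And>n x. u n x \<le> 1"
    "\<And>n. (\<integral>x. \<bar>u n x - indicator A x\<bar> \<partial>M) \<le> (1/2)^n" by auto
  have [measurable]: "u n \<in> borel_measurable M" "A \<in> sets M" for n
    using borel_measurable_continuous_onI[OF u(1)] measurable_cong_sets[OF sets refl] A sets by blast+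
  have "AE x in M. (\<lambda>n. u n x - indicator A x) \<longlonglongrightarrow> 0"
  proof (rule AE_tendsto_0_of_summable(2)[where a = "\<lambda>n. (1/2)^n"])
    fix n
    have "integrable M (\<lambda>x. \<bar>u n x - indicator A x\<bar>)"
    proof (rule M.integrable_const_bound[where B = 1])
      show "AE x in M. norm \<bar>u n x - indicator A x\<bar> \<le> 1"
      proof (rule AE_I2)
        fix x show "norm \<bar>u n x - indicator A x\<bar> \<le> 1" using u(2,3)[of n x] by (auto simp: indicator_def)
      qed
    qed simp
    then have "(\<integral>\<^sup>+x. ennreal \<bar>u n x - indicator A x\<bar> \<partial>M) = ennreal (\<integral>x. \<bar>u n x - indicator A x\<bar> \<partial>M)"
      by (rule nn_integral_eq_integral) simp
    then show "(\<integral>\<^sup>+x. ennreal \<bar>u n x - indicator A x\<bar> \<partial>M) \<le> ennreal ((1/2)^n)" using u(4)[of n] by (simp add: ennreal_leI)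
  qed (auto intro: summable_geometric)
  then have "AE x in M. (\<lambda>n. u n x) \<longlonglongrightarrow> indicator A x"
    by eventually_elim (simp add: LIM_zero_iff)
  then show ?thesis using that u(1,2,3) by blast
qed

section \<open>From finitely many coordinates to bounded Borel test functions\<close>

lemma donsker_varadhan_closure:
  fixes g :: "'b \<Rightarrow> real"
  assumes M: "prob_space M" and N: "prob_space N"
    and meas: "\<And>n. G n \<in> borel_measurable M" "\<And>n. G n \<in> borel_measurable N"
      "g \<in> borel_measurable M" "g \<in> borel_measurable N"
    and lim: "AE x in M. (\<lambda>n. G n x) \<longlonglongrightarrow> g x" "AE x in N. (\<lambda>n. G n x) \<longlonglongrightarrow> g x"
    and bd: "\<And>n x. \<bar>G n x\<bar> \<le> C"
    and le: "\<And>n. (\<integral>x. G n x \<partial>N) \<le> K + ln (\<integral>x. exp (G n x) \<partial>M)"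
  shows "(\<integral>x. g x \<partial>N) \<le> K + ln (\<integral>x. exp (g x) \<partial>M)"
proof -
  interpret M: prob_space M by (rule M)
  interpret N: prob_space N by (rule N)
  note meas[measurable]
  have 1: "(\<lambda>n. \<integral>x. G n x \<partial>N) \<longlonglongrightarrow> (\<integral>x. g x \<partial>N)"
    by (rule integral_dominated_convergence[where w = "\<lambda>_. C"]) (use lim(2) bd in auto)
  have explim: "AE x in M. (\<lambda>n. exp (G n x)) \<longlonglongrightarrow> exp (g x)"
    using lim(1) by eventually_elim (rule tendsto_exp)
  have bde: "exp (G n x) \<le> exp C" for n x using bd[of n x] by simp
  have 2: "(\<lambda>n. \<integral>x. exp (G n x) \<partial>M) \<longlonglongrightarrow> (\<integral>x. exp (g x) \<partial>M)"
    by (rule integral_dominated_convergence[where w = "\<lambda>_. exp C"]) (use explim bde in auto)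
  \<comment> \<open>The lower bound keeps the exponential integral away from 0, where
    \<open>ln\<close> is continuous.\<close>
  have ge: "AE x in M. exp (- C) \<le> exp (g x)"
    using explim
  proof eventually_elim
    case (elim x)
    have "exp (- C) \<le> exp (G n x)" for n using bd[of n x] by simp
    then show ?case using elim by (intro LIMSEQ_le_const) auto
  qed
  have le': "AE x in M. exp (g x) \<le> exp C"
    using explim by eventually_elim (rule LIMSEQ_le_const2, use bde in auto)
  have "integrable M (\<lambda>x. exp (g x))"
    by (rule M.integrable_const_bound[where B = "exp C"]) (use le' in auto)
  then have "exp (- C) \<le> (\<integral>x. exp (g x) \<partial>M)" by (rule M.integral_ge_const) (rule ge)
  then have pos: "(\<integral>x. exp (g x) \<partial>M) \<noteq> 0" using exp_gt_zero[of "-C"] by linarith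
  have "(\<lambda>n. K + ln (\<integral>x. exp (G n x) \<partial>M)) \<longlonglongrightarrow> K + ln (\<integral>x. exp (g x) \<partial>M)"
    by (intro tendsto_intros 2 pos)
  from LIMSEQ_le[OF 1 this] show ?thesis using le by auto
qed

text \<open>Convergence of \<open>\<Phi> n x\<close> to \<open>x\<close> helps only when the test
  function is continuous, so the class is enlarged in three rounds: continuous functions, finite
  combinations of indicators, bounded Borel functions. The limits under \<open>\<nu>\<close> and
  \<open>\<gamma>\<close> come from those under \<open>\<mu>\<close> by absolute continuity.\<close>

lemma donsker_varadhan_extend:
  fixes \<mu> \<nu> \<gamma> :: "'a::polish_space measure" and \<Phi> :: "nat \<Rightarrow> 'a \<Rightarrow> 'a" and g :: "'a \<Rightarrow> real"
  assumes prob: "prob_space \<mu>" "prob_space \<nu>" "prob_space \<gamma>"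
    and sets: "sets \<mu> = sets borel" "sets \<nu> = sets borel" "sets \<gamma> = sets borel"
    and ac: "absolutely_continuous \<mu> \<nu>" "absolutely_continuous \<mu> \<gamma>"
    and \<Phi>: "\<And>n. \<Phi> n \<in> borel_measurable borel" "AE x in \<mu>. (\<lambda>n. \<Phi> n x) \<longlonglongrightarrow> x"
    and le: "\<And>n u C. u \<in> borel_measurable borel \<Longrightarrow> (\<And>x. \<bar>u x\<bar> \<le> C) \<Longrightarrow>
       (\<integral>x. u (\<Phi> n x) \<partial>\<gamma>) \<le> K + ln (\<integral>x. exp (u (\<Phi> n x)) \<partial>\<nu>)"
    and g: "g \<in> borel_measurable borel" "\<And>x. \<bar>g x\<bar> \<le> C"
  shows "(\<integral>x. g x \<partial>\<gamma>) \<le> K + ln (\<integral>x. exp (g x) \<partial>\<nu>)"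
proof -
  have meas: "f \<in> borel_measurable \<nu>" "f \<in> borel_measurable \<gamma>" if "f \<in> borel_measurable borel" for f :: "'a \<Rightarrow> real"
    using that measurable_cong_sets[OF sets(2) refl] measurable_cong_sets[OF sets(3) refl] by blast+
  have s: "sets \<nu> = sets \<mu>" "sets \<gamma> = sets \<mu>" by (simp_all only: sets)
  note AE = AE_absolutely_continuous[OF ac(1) s(1)] AE_absolutely_continuous[OF ac(2) s(2)]
  have cont: "(\<integral>x. u x \<partial>\<gamma>) \<le> K + ln (\<integral>x. exp (u x) \<partial>\<nu>)"
    if u: "continuous_on UNIV u" "\<And>x. \<bar>u x\<bar> \<le> C" for u :: "'a \<Rightarrow> real" and C
  proof -
    have um: "u \<in> borel_measurable borel" by (rule borel_measurable_continuous_onI[OF u(1)])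
    have "AE x in \<mu>. (\<lambda>n. u (\<Phi> n x)) \<longlonglongrightarrow> u x"
      using \<Phi>(2) by eventually_elim (rule continuous_on_tendsto_compose[OF u(1)], auto)
    note lim = this
    have uPm: "(\<lambda>x. u (\<Phi> n x)) \<in> borel_measurable borel" for n by (rule measurable_compose[OF \<Phi>(1) um])
    show ?thesis
      by (rule donsker_varadhan_closure[OF prob(2,3) meas(1)[OF uPm] meas(2)[OF uPm] meas(1)[OF um] meas(2)[OF um]
            AE(1)[OF lim] AE(2)[OF lim] u(2) le[OF um u(2)]])
  qed
  have simple: "(\<integral>x. (\<Sum>y\<in>Y. y * indicator (A y) x) \<partial>\<gamma>) \<le> K + ln (\<integral>x. exp (\<Sum>y\<in>Y. y * indicator (A y) x) \<partial>\<nu>)"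
    if Y: "finite Y" and A: "\<And>y. y \<in> Y \<Longrightarrow> A y \<in> sets borel" for Y :: "real set" and A :: "real \<Rightarrow> 'a set"
  proof -
    have "\<exists>u :: nat \<Rightarrow> 'a \<Rightarrow> real. (\<forall>n. continuous_on UNIV (u n)) \<and> (\<forall>n x. 0 \<le> u n x \<and> u n x \<le> 1) \<and>
      (AE x in \<mu>. (\<lambda>n. u n x) \<longlonglongrightarrow> indicator (A y) x)" if "y \<in> Y" for y
      by (rule borel_set_AE_limit_continuous[OF prob(1) sets(1) A[OF that]]) blast
    then have "\<forall>y\<in>Y. \<exists>u :: nat \<Rightarrow> 'a \<Rightarrow> real. (\<forall>n. continuous_on UNIV (u n)) \<and> (\<forall>n x. 0 \<le> u n x \<and> u n x \<le> 1) \<and>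
      (AE x in \<mu>. (\<lambda>n. u n x) \<longlonglongrightarrow> indicator (A y) x)" by blast
    from bchoice[OF this] obtain u :: "real \<Rightarrow> nat \<Rightarrow> 'a \<Rightarrow> real" where
      U: "\<forall>y\<in>Y. (\<forall>n. continuous_on UNIV (u y n)) \<and> (\<forall>n x. 0 \<le> u y n x \<and> u y n x \<le> 1) \<and>
        (AE x in \<mu>. (\<lambda>n. u y n x) \<longlonglongrightarrow> indicator (A y) x)" by (rule exE)
    have u: "\<And>y n. y \<in> Y \<Longrightarrow> continuous_on UNIV (u y n)"
      "\<And>y n x. y \<in> Y \<Longrightarrow> 0 \<le> u y n x \<and> u y n x \<le> 1"
      "\<And>y. y \<in> Y \<Longrightarrow> AE x in \<mu>. (\<lambda>n. u y n x) \<longlonglongrightarrow> indicator (A y) x" using U by blast+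
    define G where "G n x = (\<Sum>y\<in>Y. y * u y n x)" for n x
    have Gc: "continuous_on UNIV (G n)" for n unfolding G_def by (intro continuous_intros u)
    have Gb: "\<bar>G n x\<bar> \<le> (\<Sum>y\<in>Y. \<bar>y\<bar>)" for n x
      unfolding G_def
    proof (rule order_trans[OF sum_abs sum_mono])
      fix y assume "y \<in> Y"
      then show "\<bar>y * u y n x\<bar> \<le> \<bar>y\<bar>" using u(2)[of y n x] by (simp add: abs_mult mult_left_le)
    qed
    have "AE x in \<mu>. \<forall>y\<in>Y. (\<lambda>n. u y n x) \<longlonglongrightarrow> indicator (A y) x"
      using u(3) Y by (simp add: AE_finite_all)
    then have lim: "AE x in \<mu>. (\<lambda>n. G n x) \<longlonglongrightarrow> (\<Sum>y\<in>Y. y * indicator (A y) x)"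
      unfolding G_def by eventually_elim (intro tendsto_intros, auto)
    have sm: "(\<lambda>x. \<Sum>y\<in>Y. y * indicator (A y) x) \<in> borel_measurable borel"
      using A by (intro borel_measurable_sum borel_measurable_times borel_measurable_const borel_measurable_indicator)
    have Gm: "G n \<in> borel_measurable borel" for n by (rule borel_measurable_continuous_onI[OF Gc])
    show ?thesis
      by (rule donsker_varadhan_closure[OF prob(2,3) meas(1)[OF Gm] meas(2)[OF Gm] meas(1)[OF sm] meas(2)[OF sm]
            AE(1)[OF lim] AE(2)[OF lim] Gb cont[OF Gc Gb]])
  qed
  \<comment> \<open>Rounding \<open>g\<close> down to multiples of \<open>1 / (n + 1)\<close> leaves
    finitely many values, because \<open>g\<close> is bounded.\<close>
  define h where "h n x = real_of_int \<lfloor>real (Suc n) * g x\<rfloor> / real (Suc n)" for n x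
  have hg: "h n x \<le> g x" "g x - 1 / real (Suc n) \<le> h n x" for n x
  proof -
    have "real_of_int \<lfloor>real (Suc n) * g x\<rfloor> \<le> real (Suc n) * g x" by simp
    then show "h n x \<le> g x" unfolding h_def by (simp add: pos_divide_le_eq mult.commute del: of_nat_Suc)
    have "real (Suc n) * g x - 1 \<le> real_of_int \<lfloor>real (Suc n) * g x\<rfloor>" by linarith
    then have "(real (Suc n) * g x - 1) / real (Suc n) \<le> h n x" unfolding h_def by (rule divide_right_mono) simp
    then show "g x - 1 / real (Suc n) \<le> h n x" by (simp add: diff_divide_distrib del: of_nat_Suc)
  qed
  have hm [measurable]: "h n \<in> borel_measurable borel" for n
    using g(1) unfolding h_def by measurable
  have hb: "\<bar>h n x\<bar> \<le> C + 1" for n x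
  proof -
    have "1 / real (Suc n) \<le> 1" by simp
    then show ?thesis using hg(1)[of n x] hg(2)[where n=n and x=x] g(2)[of x] by linarith
  qed
  have h_le: "(\<integral>x. h n x \<partial>\<gamma>) \<le> K + ln (\<integral>x. exp (h n x) \<partial>\<nu>)" for n
  proof -
    have fin: "finite (range (h n))"
    proof (rule finite_subset)
      show "range (h n) \<subseteq> (\<lambda>k. real_of_int k / real (Suc n)) ` {\<lfloor>- (real (Suc n) * (C + 1))\<rfloor> .. \<lceil>real (Suc n) * (C + 1)\<rceil>}"
      proof (rule image_subsetI)
        fix x
        have "\<bar>real_of_int \<lfloor>real (Suc n) * g x\<rfloor>\<bar> \<le> real (Suc n) * (C + 1)"
          using hb[where n=n and x=x] unfolding h_def by (simp add: abs_divide pos_divide_le_eq mult.commute del: of_nat_Suc)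
        then have "\<lfloor>real (Suc n) * g x\<rfloor> \<in> {\<lfloor>- (real (Suc n) * (C + 1))\<rfloor> .. \<lceil>real (Suc n) * (C + 1)\<rceil>}"
          unfolding atLeastAtMost_iff by linarith
        then show "h n x \<in> (\<lambda>k. real_of_int k / real (Suc n)) ` {\<lfloor>- (real (Suc n) * (C + 1))\<rfloor> .. \<lceil>real (Suc n) * (C + 1)\<rceil>}"
          unfolding h_def by (rule imageI)
      qed
    qed simp
    have eq: "h n x = (\<Sum>y\<in>range (h n). y * indicator (h n -` {y}) x)" for x
    proof -
      have "(\<Sum>y\<in>range (h n). y * indicator (h n -` {y}) x) = (\<Sum>y\<in>range (h n). if y = h n x then y else 0)"
        by (rule sum.cong) (auto simp: indicator_def)
      then show ?thesis using fin by simp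
    qed
    have "h n -` {y} \<in> sets borel" for y
      using measurable_sets_borel[OF hm[of n], of "{y}"] by simp
    then show ?thesis using simple[OF fin, of "\<lambda>y. h n -` {y}"] unfolding eq[symmetric] by simp
  qed
  have hlim: "(\<lambda>n. h n x) \<longlonglongrightarrow> g x" for x
  proof (rule tendsto_sandwich[OF _ _ _ tendsto_const])
    show "(\<lambda>n. g x - 1 / real (Suc n)) \<longlonglongrightarrow> g x"
      using tendsto_diff[OF tendsto_const[of "g x"] lim_1_over_n[THEN LIMSEQ_Suc]] by simp
  qed (use hg in auto)
  show ?thesis
    by (rule donsker_varadhan_closure[OF prob(2,3) meas(1)[OF hm] meas(2)[OF hm] meas(1)[OF g(1)] meas(2)[OF g(1)]
          AE_I2[OF hlim] AE_I2[OF hlim] hb h_le])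
qed

text \<open>If \<open>exp (L F)\<close> is the density of \<open>\<nu>\<close> with respect to \<open>\<mu>\<close> on the \<open>\<sigma>\<close>-algebra of the
  coordinates in \<open>F\<close>, then the Donsker--Varadhan inequality for \<open>\<gamma>\<close> and \<open>\<mu>\<close> becomes one for
  \<open>\<gamma>\<close> and \<open>\<nu>\<close>, and only the expectations of \<open>L F\<close> under \<open>\<gamma>\<close> have to converge.\<close>

lemma KL_change_of_reference_le:
  fixes \<mu> \<nu> \<gamma> :: "'a::polish_space measure" and \<Phi> :: "nat \<Rightarrow> 'a \<Rightarrow> 'a" and L :: "'i set \<Rightarrow> 'a \<Rightarrow> real"
  assumes prob: "prob_space \<mu>" "prob_space \<nu>" "prob_space \<gamma>"
    and sets: "sets \<mu> = sets borel" "sets \<nu> = sets borel" "sets \<gamma> = sets borel"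
    and ac: "absolutely_continuous \<mu> \<nu>" "absolutely_continuous \<nu> \<mu>" "absolutely_continuous \<mu> \<gamma>"
    and \<Phi>: "\<And>n. \<Phi> n \<in> borel_measurable borel" "AE x in \<mu>. (\<lambda>n. \<Phi> n x) \<longlonglongrightarrow> x"
    and L: "\<And>F. finite F \<Longrightarrow> F \<subseteq> E \<Longrightarrow> L F \<in> borel_measurable borel"
      "\<And>F. finite F \<Longrightarrow> F \<subseteq> E \<Longrightarrow> integrable \<gamma> (L F)"
      "((\<lambda>F. \<integral>x. L F x \<partial>\<gamma>) \<longlongrightarrow> l) (finite_subsets_at_top E)"
    and dens: "\<And>n. \<forall>\<^sub>F F in finite_subsets_at_top E. \<forall>u C. u \<in> borel_measurable borel \<longrightarrow> (\<forall>x. \<bar>u x\<bar> \<le> C) \<longrightarrow>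
      (\<integral>\<^sup>+x. ennreal (exp (u (\<Phi> n x) + L F x)) \<partial>\<mu>) = (\<integral>\<^sup>+x. ennreal (exp (u (\<Phi> n x))) \<partial>\<nu>)"
    and k: "KL \<gamma> \<mu> = ereal k"
  shows "KL \<gamma> \<nu> \<le> ereal (k - l)"
proof (rule donsker_varadhan_le[OF prob(2,3)])
  show acg: "absolutely_continuous \<nu> \<gamma>" using ac(2,3) by (auto simp: absolutely_continuous_def)
  show "sets \<gamma> = sets \<nu>" using sets by simp
  interpret \<nu>: prob_space \<nu> by (rule prob)
  interpret \<gamma>: prob_space \<gamma> by (rule prob)
  have meas: "f \<in> borel_measurable \<mu>" "f \<in> borel_measurable \<nu>" "f \<in> borel_measurable \<gamma>" if "f \<in> borel_measurable borel" for f :: "'a \<Rightarrow> real"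
    using that measurable_cong_sets[OF sets(1) refl] measurable_cong_sets[OF sets(2) refl] measurable_cong_sets[OF sets(3) refl] by blast+
  fix g :: "'a \<Rightarrow> real" and C assume g: "g \<in> borel_measurable \<nu>" "\<And>x. \<bar>g x\<bar> \<le> C"
  have gb: "g \<in> borel_measurable borel" using g(1) measurable_cong_sets[OF sets(2) refl] by blast
  show "(\<integral>x. g x \<partial>\<gamma>) \<le> k - l + ln (\<integral>x. exp (g x) \<partial>\<nu>)"
  proof (rule donsker_varadhan_extend[OF prob sets ac(1,3) \<Phi> _ gb g(2)])
    fix n and u :: "'a \<Rightarrow> real" and C assume u: "u \<in> borel_measurable borel" "\<And>x. \<bar>u x\<bar> \<le> C"
    let ?u = "\<lambda>x. u (\<Phi> n x)"
    have um: "?u \<in> borel_measurable borel" by (rule measurable_compose[OF \<Phi>(1) u(1)])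
    note um[THEN meas(1), measurable] um[THEN meas(2), measurable] um[THEN meas(3), measurable]
    have ui: "integrable \<gamma> ?u" by (rule \<gamma>.integrable_const_bound[where B = C]) (use u in auto)
    have ei: "integrable \<nu> (\<lambda>x. exp (?u x))"
      by (rule \<nu>.integrable_const_bound[where B = "exp C"]) (use u(2) in \<open>auto simp: abs_le_iff\<close>)
    have fin_sub: "\<forall>\<^sub>F F in finite_subsets_at_top E. finite F \<and> F \<subseteq> E"
      by (rule eventually_finite_subsets_at_top_weakI) simp
    have "\<forall>\<^sub>F F in finite_subsets_at_top E. (\<integral>x. ?u x \<partial>\<gamma>) + (\<integral>x. L F x \<partial>\<gamma>) \<le> k + ln (\<integral>x. exp (?u x) \<partial>\<nu>)"
      using dens[of n] fin_sub
    proof eventually_elim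
      case (elim F)
      note Fm = L(1)[of F] and LF = L(1)[of F, THEN meas(1), measurable]
      have eq: "(\<integral>\<^sup>+x. ennreal (exp (?u x + L F x)) \<partial>\<mu>) = (\<integral>\<^sup>+x. ennreal (exp (?u x)) \<partial>\<nu>)"
        using elim(1) u by blast
      also have "\<dots> = ennreal (\<integral>x. exp (?u x) \<partial>\<nu>)" by (rule nn_integral_eq_integral[OF ei]) simp
      finally have eq': "(\<integral>\<^sup>+x. ennreal (exp (?u x + L F x)) \<partial>\<mu>) = ennreal (\<integral>x. exp (?u x) \<partial>\<nu>)" .
      have [measurable]: "L F \<in> borel_measurable \<mu>" using elim(2) LF by blast
      have i: "integrable \<mu> (\<lambda>x. exp (?u x + L F x))" by (rule integrableI_nonneg) (use eq' in auto)
      have "(\<integral>x. exp (?u x + L F x) \<partial>\<mu>) = (\<integral>x. exp (?u x) \<partial>\<nu>)"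
        using nn_integral_eq_integral[OF i] eq' by (simp add: integral_nonneg)
      moreover have "(\<integral>x. ?u x + L F x \<partial>\<gamma>) \<le> k + ln (\<integral>x. exp (?u x + L F x) \<partial>\<mu>)"
        by (rule donsker_varadhan_ge[OF prob(1,3) ac(3) _ k _ _ i]) (use sets ui L(2)[of F] elim(2) in auto)
      ultimately show ?case using ui L(2)[of F] elim(2) by simp
    qed
    moreover have "((\<lambda>F. (\<integral>x. ?u x \<partial>\<gamma>) + (\<integral>x. L F x \<partial>\<gamma>)) \<longlongrightarrow> (\<integral>x. ?u x \<partial>\<gamma>) + l) (finite_subsets_at_top E)"
      by (intro tendsto_intros L)
    ultimately have "(\<integral>x. ?u x \<partial>\<gamma>) + l \<le> k + ln (\<integral>x. exp (?u x) \<partial>\<nu>)"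
      by (intro tendsto_upperbound[OF _ _ finite_subsets_at_top_neq_bot])
    then show "(\<integral>x. ?u x \<partial>\<gamma>) \<le> k - l + ln (\<integral>x. exp (?u x) \<partial>\<nu>)" by simp
  qed
qed

section \<open>Normal laws and independence\<close>

text \<open>Parametrized by the variance, with a point mass at variance 0, to agree with the
  marginals prescribed in \<open>gaussian_measure\<close>.\<close>

definition normal_law :: "real \<Rightarrow> real \<Rightarrow> real measure" where
  "normal_law m v = (if v = 0 then return borel m else density lborel (normal_density m (sqrt v)))"

lemma normal_law_eq_distr:
  assumes v: "0 \<le> v"
  shows "normal_law m v = distr std_normal_distribution borel (\<lambda>z. m + sqrt v * z)"
proof -
  interpret S: real_distribution std_normal_distribution by (rule real_dist_normal_dist)
  show ?thesis
  proof (cases "v = 0")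
    case True
    then show ?thesis by (simp add: normal_law_def S.distr_const)
  next
    case False
    then have v: "0 < v" using v by simp
    have "distributed std_normal_distribution lborel (\<lambda>x. x) std_normal_density"
      unfolding distributed_def by (auto simp: distr_id2)
    from S.normal_density_affine[OF this, of "sqrt v" m]
    have "distributed std_normal_distribution lborel (\<lambda>x. m + sqrt v * x) (normal_density m (sqrt v))"
      using v by simp
    then have "distr std_normal_distribution lborel (\<lambda>x. m + sqrt v * x) = density lborel (normal_density m (sqrt v))"
      by (simp add: distributed_def)
    moreover have "distr std_normal_distribution lborel (\<lambda>x. m + sqrt v * x) = distr std_normal_distribution borel (\<lambda>x. m + sqrt v * x)"
      by (rule distr_cong) auto
    ultimately show ?thesis using v by (simp add: normal_law_def)
  qed
qed

lemma real_distribution_normal_law: "0 \<le> v \<Longrightarrow> real_distribution (normal_law m v)"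
proof -
  assume "0 \<le> v"
  interpret S: real_distribution std_normal_distribution by (rule real_dist_normal_dist)
  show ?thesis unfolding normal_law_eq_distr[OF \<open>0 \<le> v\<close>] by (rule S.real_distribution_distr) simp
qed

lemma char_normal_law:
  assumes v: "0 \<le> v"
  shows "char (normal_law m v) t = exp (\<i> * of_real (t * m) - of_real (t\<^sup>2 * v / 2))"
proof -
  have "char (normal_law m v) t = (CLINT z|std_normal_distribution. iexp (t * (m + sqrt v * z)))"
    unfolding char_def normal_law_eq_distr[OF v] by (subst integral_distr) auto
  also have "\<dots> = (CLINT z|std_normal_distribution. exp (\<i> * of_real (t * m)) * iexp ((t * sqrt v) * z))"
  proof (rule Bochner_Integration.integral_cong[OF refl])
    fix z
    have "t * (m + sqrt v * z) = t * m + t * sqrt v * z" by (simp add: algebra_simps)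
    then show "iexp (t * (m + sqrt v * z)) = exp (\<i> * of_real (t * m)) * iexp ((t * sqrt v) * z)"
      by (simp only: exp_add[symmetric] distrib_left[symmetric] of_real_add[symmetric])
  qed
  also have "\<dots> = exp (\<i> * of_real (t * m)) * char std_normal_distribution (t * sqrt v)"
    unfolding char_def by simp
  also have "\<dots> = exp (\<i> * of_real (t * m) - of_real (t\<^sup>2 * v / 2))"
  proof -
    have "(t * sqrt v)\<^sup>2 = t\<^sup>2 * v" using v by (simp add: power_mult_distrib)
    then show ?thesis
      unfolding char_std_normal_distribution exp_of_real[symmetric] exp_add[symmetric] by simp
  qed
  finally show ?thesis .
qed

lemma normal_law_moments:
  assumes v: "0 \<le> v"
  shows "integrable (normal_law m v) (\<lambda>x. x)" "integrable (normal_law m v) (\<lambda>x. x\<^sup>2)"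
    "(\<integral>x. x \<partial>normal_law m v) = m" "(\<integral>x. x\<^sup>2 \<partial>normal_law m v) = v + m\<^sup>2"
proof -
  interpret S: real_distribution std_normal_distribution by (rule real_dist_normal_dist)
  have pU: "measure std_normal_distribution UNIV = 1" using S.prob_space by simp
  have i1: "integrable std_normal_distribution (\<lambda>z. z)" using integrable_std_normal_distribution_moment[of 1] by simp
  have i2: "integrable std_normal_distribution (\<lambda>z. z\<^sup>2)" using integrable_std_normal_distribution_moment[of 2] by simp
  have e1: "(\<integral>z. z \<partial>std_normal_distribution) = 0" using integral_std_normal_distribution_moment_odd[of 1] by simp
  have e2: "(\<integral>z. z\<^sup>2 \<partial>std_normal_distribution) = 1" using std_normal_distribution_even_moments(1)[of 1] by (simp add: power2_eq_square)
  have sq: "(m + sqrt v * z)\<^sup>2 = m\<^sup>2 + (2 * m * sqrt v) * z + v * z\<^sup>2" for z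
    using v by (simp add: power2_sum power_mult_distrib)
  have "integrable std_normal_distribution (\<lambda>z. m + sqrt v * z)" using i1 by simp
  then show "integrable (normal_law m v) (\<lambda>x. x)"
    unfolding normal_law_eq_distr[OF v] by (subst integrable_distr_eq) auto
  have "integrable std_normal_distribution (\<lambda>z. (m + sqrt v * z)\<^sup>2)" unfolding sq using i1 i2 by simp
  then show "integrable (normal_law m v) (\<lambda>x. x\<^sup>2)"
    unfolding normal_law_eq_distr[OF v] by (subst integrable_distr_eq) auto
  have "(\<integral>x. x \<partial>normal_law m v) = (\<integral>z. m + sqrt v * z \<partial>std_normal_distribution)"
    unfolding normal_law_eq_distr[OF v] by (subst integral_distr) auto
  then show "(\<integral>x. x \<partial>normal_law m v) = m" using i1 e1 by (simp add: pU)
  have "(\<integral>x. x\<^sup>2 \<partial>normal_law m v) = (\<integral>z. m\<^sup>2 + (2 * m * sqrt v) * z + v * z\<^sup>2 \<partial>std_normal_distribution)"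
    unfolding normal_law_eq_distr[OF v] sq[symmetric] by (subst integral_distr) auto
  then show "(\<integral>x. x\<^sup>2 \<partial>normal_law m v) = v + m\<^sup>2" using i1 i2 e1 e2 by (simp add: pU)
qed

text \<open>The log-likelihood ratio of the normal law with mean \<open>b\<close> and variance
  \<open>q\<close> against the one with mean \<open>a\<close> and variance \<open>p\<close>; a
  quadratic polynomial in \<open>w\<close>.\<close>

definition normal_log_ratio :: "real \<Rightarrow> real \<Rightarrow> real \<Rightarrow> real \<Rightarrow> real \<Rightarrow> real" where
  "normal_log_ratio a p b q w = (w - a)\<^sup>2 / (2 * p) - (w - b)\<^sup>2 / (2 * q) + ln p / 2 - ln q / 2"

lemma normal_log_ratio_measurable [measurable]: "normal_log_ratio a p b q \<in> borel_measurable borel"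
  unfolding normal_log_ratio_def by measurable

lemma normal_law_density:
  assumes p: "0 < p" and q: "0 < q"
  shows "normal_law b q = density (normal_law a p) (\<lambda>w. ennreal (exp (normal_log_ratio a p b q w)))"
proof -
  have "normal_density a (sqrt p) w * exp (normal_log_ratio a p b q w) = normal_density b (sqrt q) w" for w
  proof -
    have s: "exp (ln p / 2) = sqrt p" "exp (ln q / 2) = sqrt q"
      unfolding ln_sqrt[OF less_imp_le[OF p], symmetric] ln_sqrt[OF less_imp_le[OF q], symmetric] using p q by (simp_all add: exp_minus divide_inverse)
    have "exp (normal_log_ratio a p b q w) = exp ((w - a)\<^sup>2 / (2 * p)) * exp (- ((w - b)\<^sup>2 / (2 * q))) * exp (ln p / 2) * exp (- (ln q / 2))"
      unfolding normal_log_ratio_def by (simp flip: exp_add)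
    then show ?thesis using p q
      by (simp add: normal_density_def s real_sqrt_mult exp_minus field_simps)
  qed
  then show ?thesis using p q
    by (simp add: normal_law_def density_density_eq ennreal_mult'[symmetric])
qed

text \<open>Levy's uniqueness theorem is applied to \<open>W\<close> under the probability measure with density
  proportional to \<open>2 + Z\<close>, which is bounded away from zero.\<close>

lemma independent_of_char_eq:
  fixes W Z :: "'b \<Rightarrow> real"
  assumes P: "prob_space P" and D: "real_distribution D"
    and W [measurable]: "W \<in> borel_measurable P" and Z [measurable]: "Z \<in> borel_measurable P" and Zb: "\<And>x. \<bar>Z x\<bar> \<le> 1"
    and cW: "\<And>t. (CLINT x|P. iexp (t * W x)) = char D t"
    and cZ: "\<And>t. (CLINT x|P. iexp (t * W x) * of_real (Z x)) = char D t * of_real (\<integral>x. Z x \<partial>P)"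
    and B [measurable]: "B \<in> sets borel"
  shows "(\<integral>x. indicator B (W x) * Z x \<partial>P) = measure D B * (\<integral>x. Z x \<partial>P)"
proof -
  interpret P: prob_space P by (rule P)
  define \<kappa> where "\<kappa> = 2 + (\<integral>x. Z x \<partial>P)"
  have Zi: "integrable P Z" by (rule P.integrable_const_bound[where B = 1]) (use Zb in auto)
  have "\<bar>\<integral>x. Z x \<partial>P\<bar> \<le> 1" using Zb P.integral_le_const[OF Zi, of 1] P.integral_ge_const[OF Zi, of "-1"] by (force simp: abs_le_iff)
  then have \<kappa>: "0 < \<kappa>" by (simp add: \<kappa>_def)
  have Z2: "0 \<le> (2 + Z x) / \<kappa>" for x using Zb[of x] \<kappa> by (simp add: abs_le_iff)
  define P' where "P' = density P (\<lambda>x. ennreal ((2 + Z x) / \<kappa>))"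
  have P'm: "f \<in> borel_measurable P' \<longleftrightarrow> f \<in> borel_measurable P" for f :: "'b \<Rightarrow> real" by (simp add: P'_def)
  have "emeasure P' (space P') = (\<integral>\<^sup>+x. ennreal ((2 + Z x) / \<kappa>) \<partial>P)"
    by (simp add: P'_def emeasure_density cong: nn_integral_cong)
  also have "\<dots> = ennreal (\<integral>x. (2 + Z x) / \<kappa> \<partial>P)"
    by (rule nn_integral_eq_integral) (use Zi Z2 in auto)
  also have "(\<integral>x. (2 + Z x) / \<kappa> \<partial>P) = 1" using Zi \<kappa> by (simp add: \<kappa>_def P.prob_space)
  finally have "prob_space P'" by (intro prob_spaceI) simp
  then interpret P': prob_space P' .
  have r1: "real_distribution (distr P borel W)" by (rule P.real_distribution_distr) simp
  have r2: "real_distribution (distr P' borel W)" by (rule P'.real_distribution_distr) (simp add: P'm)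
  have 1: "distr P borel W = D"
  proof (rule Levy_uniqueness[OF r1 D], rule ext)
    fix t show "char (distr P borel W) t = char D t"
      unfolding cW[symmetric] by (subst char_def, subst integral_distr) auto
  qed
  have iW: "integrable P (\<lambda>x. iexp (t * W x))" for t
    by (rule P.integrable_const_bound[where B = 1]) auto
  have iWZ: "integrable P (\<lambda>x. iexp (t * W x) * of_real (Z x))" for t
    by (rule P.integrable_const_bound[where B = 1]) (use Zb in \<open>auto simp: norm_mult\<close>)
  have 2: "distr P' borel W = D"
  proof (rule Levy_uniqueness[OF r2 D], rule ext)
    fix t
    have "char (distr P' borel W) t = (CLINT x|P'. iexp (t * W x))"
      unfolding char_def by (subst integral_distr) (auto simp: P'm)
    also have "\<dots> = (CLINT x|P. ((2 + Z x) / \<kappa>) *\<^sub>R iexp (t * W x))"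
      unfolding P'_def by (rule integral_density) (use Z2 in auto)
    also have "\<dots> = (CLINT x|P. (2 / \<kappa>) * iexp (t * W x) + (1 / \<kappa>) * (iexp (t * W x) * of_real (Z x)))"
      by (rule Bochner_Integration.integral_cong) (auto simp: scaleR_conv_of_real add_divide_distrib algebra_simps)
    also have "\<dots> = (2 / \<kappa>) * (CLINT x|P. iexp (t * W x)) + (1 / \<kappa>) * (CLINT x|P. iexp (t * W x) * of_real (Z x))"
      by (subst Bochner_Integration.integral_add) (use iW iWZ in auto)
    also have "\<dots> = char D t * of_real (\<kappa> / \<kappa>)"
    proof -
      have "complex_of_real (\<integral>x. Z x \<partial>P) = of_real \<kappa> - 2" by (simp add: \<kappa>_def)
      note E = this
      show ?thesis unfolding cW cZ E using \<kappa> by (simp add: field_simps)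
    qed
    finally show "char (distr P' borel W) t = char D t" using \<kappa> by simp
  qed
  have iB: "integrable P (\<lambda>x. indicator B (W x) :: real)" "integrable P (\<lambda>x. indicator B (W x) * Z x)"
    by (rule P.integrable_const_bound[where B = 1]; use Zb in \<open>auto simp: indicator_def\<close>)+
  have "measure D B = (\<integral>x. indicator B x \<partial>distr P borel W)" unfolding 1 using D by (simp add: real_distribution_def real_distribution_axioms_def)
  also have "\<dots> = (\<integral>x. indicator B (W x) \<partial>P)" by (subst integral_distr) auto
  finally have m1: "measure D B = (\<integral>x. indicator B (W x) \<partial>P)" .
  have "measure D B = (\<integral>x. indicator B x \<partial>distr P' borel W)" unfolding 2 using D by (simp add: real_distribution_def real_distribution_axioms_def)
  also have "\<dots> = (\<integral>x. indicator B (W x) \<partial>P')" by (subst integral_distr) (auto simp: P'm)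
  also have "\<dots> = (\<integral>x. ((2 + Z x) / \<kappa>) *\<^sub>R indicator B (W x) \<partial>P)"
    unfolding P'_def by (rule integral_density) (use Z2 in auto)
  also have "\<dots> = (\<integral>x. (2 / \<kappa>) * indicator B (W x) + (1 / \<kappa>) * (indicator B (W x) * Z x) \<partial>P)"
    by (rule Bochner_Integration.integral_cong) (auto simp: add_divide_distrib algebra_simps)
  also have "\<dots> = (2 / \<kappa>) * (\<integral>x. indicator B (W x) \<partial>P) + (1 / \<kappa>) * (\<integral>x. indicator B (W x) * Z x \<partial>P)"
    by (subst Bochner_Integration.integral_add) (use iB in auto)
  finally have "measure D B = (2 / \<kappa>) * measure D B + (1 / \<kappa>) * (\<integral>x. indicator B (W x) * Z x \<partial>P)"
    unfolding m1[symmetric] .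
  then have "\<kappa> * measure D B = 2 * measure D B + (\<integral>x. indicator B (W x) * Z x \<partial>P)"
    using \<kappa> by (simp add: field_simps)
  then show ?thesis by (simp add: \<kappa>_def algebra_simps)
qed

text \<open>The mixed statement, with indicators on \<open>F'\<close> and exponentials on
  \<open>F\<close>, is what an induction can carry: each step converts one exponential factor into
  an indicator, while everything else plays the role of the bounded weight \<open>Z\<close> in
  \<open>independent_of_char_eq\<close>.\<close>

lemma independent_of_joint_char:
  fixes W :: "'i \<Rightarrow> 'b \<Rightarrow> real"
  assumes P: "prob_space P" and D: "\<And>e. e \<in> I \<Longrightarrow> real_distribution (D e)"
    and W: "\<And>e. e \<in> I \<Longrightarrow> W e \<in> borel_measurable P"
    and jc: "\<And>F t. finite F \<Longrightarrow> F \<subseteq> I \<Longrightarrow> (CLINT x|P. iexp (\<Sum>e\<in>F. t e * W e x)) = (\<Prod>e\<in>F. char (D e) (t e))"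
    and F': "finite F'" "F' \<subseteq> I" and B: "\<And>e. e \<in> I \<Longrightarrow> B e \<in> sets borel"
    and F: "finite F" "F \<subseteq> I" "F \<inter> F' = {}"
  shows "(CLINT x|P. of_real (\<Prod>e\<in>F'. indicator (B e) (W e x)) * iexp (\<Sum>e\<in>F. t e * W e x))
     = of_real (\<Prod>e\<in>F'. measure (D e) (B e)) * (\<Prod>e\<in>F. char (D e) (t e))"
  using F' F
proof (induction F' arbitrary: F t rule: finite_induct)
  case empty then show ?case using jc by simp
next
  case (insert a F')
  interpret P: prob_space P by (rule P)
  have aI: "a \<in> I" and F'I: "F' \<subseteq> I" and aF: "a \<notin> F" and dis: "F \<inter> F' = {}" using insert.prems by auto
  note Wa [measurable] = W[OF aI] and Ba [measurable] = B[OF aI]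
  define G where "G x = (\<Prod>e\<in>F'. indicator (B e) (W e x) :: real)" for x
  define Y where "Y x = (\<Sum>e\<in>F. t e * W e x)" for x
  have Gm [measurable]: "G \<in> borel_measurable P" unfolding G_def
  proof (rule borel_measurable_prod)
    fix e assume "e \<in> F'"
    then have e: "e \<in> I" using F'I by auto
    note W[OF e, measurable] B[OF e, measurable]
    show "(\<lambda>x. indicator (B e) (W e x) :: real) \<in> borel_measurable P" by measurable
  qed
  have Ym [measurable]: "Y \<in> borel_measurable P" unfolding Y_def
    using W insert.prems(3) by (intro borel_measurable_sum borel_measurable_times borel_measurable_const) auto
  have G01: "0 \<le> G x" "G x \<le> 1" for x unfolding G_def by (auto intro!: prod_nonneg prod_le_1 simp: indicator_def)
  define c where "c = complex_of_real (\<Prod>e\<in>F'. measure (D e) (B e))"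
  \<comment> \<open>The parameter \<open>\<sigma>\<close> is used at 1 and -1: both signs of the
    phase are needed to write cosine and sine through exponentials.\<close>
  define \<psi> where "\<psi> \<sigma> = (\<Prod>e\<in>F. char (D e) (\<sigma> * t e))" for \<sigma> :: real
  have key: "(CLINT x|P. of_real (G x) * iexp (s * W a x + \<sigma> * Y x)) = c * (char (D a) s * \<psi> \<sigma>)" for s \<sigma>
  proof -
    let ?t = "\<lambda>e. if e = a then s else \<sigma> * t e"
    have "(\<Sum>e\<in>insert a F. ?t e * W e x) = s * W a x + \<sigma> * Y x" for x
    proof -
      have "(\<Sum>e\<in>F. ?t e * W e x) = (\<Sum>e\<in>F. \<sigma> * (t e * W e x))" by (rule sum.cong) (use aF in auto)
      then show ?thesis using aF insert.prems(2) by (simp add: Y_def sum_distrib_left)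
    qed
    moreover have "(\<Prod>e\<in>insert a F. char (D e) (?t e)) = char (D a) s * \<psi> \<sigma>"
    proof -
      have "(\<Prod>e\<in>F. char (D e) (?t e)) = \<psi> \<sigma>" unfolding \<psi>_def by (rule prod.cong) (use aF in auto)
      then show ?thesis using aF insert.prems(2) by simp
    qed
    moreover have "(CLINT x|P. of_real (\<Prod>e\<in>F'. indicator (B e) (W e x)) * iexp (\<Sum>e\<in>insert a F. ?t e * W e x))
       = of_real (\<Prod>e\<in>F'. measure (D e) (B e)) * (\<Prod>e\<in>insert a F. char (D e) (?t e))"
      by (rule insert.IH) (use insert.prems insert.hyps F'I aI dis in auto)
    ultimately show ?thesis by (simp add: G_def c_def)
  qed
  have D0: "char (D a) 0 = 1" using D[OF aI] by (rule real_distribution.char_zero)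
  have ii: "integrable P (\<lambda>x. of_real (G x) * iexp (s * W a x + \<sigma> * Y x))" for s \<sigma>
    by (rule P.integrable_const_bound[where B = 1]) (use G01 in \<open>auto simp: norm_mult\<close>)
  \<comment> \<open>Real and imaginary parts of the remaining factor, since
    \<open>independent_of_char_eq\<close> takes a real weight.\<close>
  define Z1 where "Z1 x = G x * cos (Y x)" for x
  define Z2 where "Z2 x = G x * sin (Y x)" for x
  have [measurable]: "Z1 \<in> borel_measurable P" "Z2 \<in> borel_measurable P" unfolding Z1_def Z2_def by measurable
  have Zb: "\<bar>Z1 x\<bar> \<le> 1" "\<bar>Z2 x\<bar> \<le> 1" for x
    unfolding Z1_def Z2_def using G01[of x] by (auto simp: abs_mult intro!: mult_le_one)
  have ex: "iexp (s * W a x + \<sigma> * Y x) = iexp (s * W a x) * exp (\<i> * of_real (\<sigma> * Y x))" for s \<sigma> x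
    by (simp add: distrib_left exp_add)
  have cs: "complex_of_real (cos y) = (exp (\<i> * of_real (1 * y)) + exp (\<i> * of_real (-1 * y))) / 2"
    "complex_of_real (sin y) = (exp (\<i> * of_real (1 * y)) - exp (\<i> * of_real (-1 * y))) / (2 * \<i>)" for y :: real
    using cos_exp_eq[of "of_real y"] sin_exp_eq[of "of_real y"] by (simp_all add: cos_of_real sin_of_real)
  have e1: "iexp (s * W a x) * of_real (Z1 x) =
      (1/2) * (of_real (G x) * iexp (s * W a x + 1 * Y x)) + (1/2) * (of_real (G x) * iexp (s * W a x + (-1) * Y x))" for s x
    unfolding Z1_def of_real_mult cs ex by (simp only: add_divide_distrib) (simp add: algebra_simps)
  have e2: "iexp (s * W a x) * of_real (Z2 x) =
      (1/(2*\<i>)) * (of_real (G x) * iexp (s * W a x + 1 * Y x)) + (-1/(2*\<i>)) * (of_real (G x) * iexp (s * W a x + (-1) * Y x))" for s x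
    unfolding Z2_def of_real_mult cs ex by (simp only: diff_divide_distrib) (simp add: algebra_simps)
  have lin: "(CLINT x|P. \<alpha> * (of_real (G x) * iexp (s * W a x + 1 * Y x)) + \<beta> * (of_real (G x) * iexp (s * W a x + (-1) * Y x)))
      = char (D a) s * (c * (\<alpha> * \<psi> 1 + \<beta> * \<psi> (-1)))" for s \<alpha> \<beta>
  proof -
    have "(CLINT x|P. \<alpha> * (of_real (G x) * iexp (s * W a x + 1 * Y x)) + \<beta> * (of_real (G x) * iexp (s * W a x + (-1) * Y x)))
      = \<alpha> * (c * (char (D a) s * \<psi> 1)) + \<beta> * (c * (char (D a) s * \<psi> (-1)))"
      unfolding key[symmetric]
      by (subst Bochner_Integration.integral_add[OF integrable_mult_right integrable_mult_right, OF ii ii])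
         (simp only: integral_mult_right_zero)
    then show ?thesis by (simp only: ring_distribs mult_ac)
  qed
  have c1: "(CLINT x|P. iexp (s * W a x) * of_real (Z1 x)) = char (D a) s * (c * ((1/2) * \<psi> 1 + (1/2) * \<psi> (-1)))" for s
    unfolding e1 by (rule lin)
  have c2: "(CLINT x|P. iexp (s * W a x) * of_real (Z2 x)) = char (D a) s * (c * ((1/(2*\<i>)) * \<psi> 1 + (-1/(2*\<i>)) * \<psi> (-1)))" for s
    unfolding e2 by (rule lin)
  have z1: "of_real (\<integral>x. Z1 x \<partial>P) = c * ((1/2) * \<psi> 1 + (1/2) * \<psi> (-1))"
    using c1[of 0] by (simp add: D0)
  have z2: "of_real (\<integral>x. Z2 x \<partial>P) = c * ((1/(2*\<i>)) * \<psi> 1 + (-1/(2*\<i>)) * \<psi> (-1))"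
    using c2[of 0] by (simp add: D0)
  have cW: "(CLINT x|P. iexp (s * W a x)) = char (D a) s" for s
    using jc[of "{a}" "\<lambda>_. s"] aI by simp
  have i1: "(\<integral>x. indicator (B a) (W a x) * Z1 x \<partial>P) = measure (D a) (B a) * (\<integral>x. Z1 x \<partial>P)"
    by (rule independent_of_char_eq[OF P D[OF aI] _ _ _ cW _ Ba]) (simp_all only: c1 z1 Zb, simp_all)
  have i2: "(\<integral>x. indicator (B a) (W a x) * Z2 x \<partial>P) = measure (D a) (B a) * (\<integral>x. Z2 x \<partial>P)"
    by (rule independent_of_char_eq[OF P D[OF aI] _ _ _ cW _ Ba]) (simp_all only: c2 z2 Zb, simp_all)
  have int1: "integrable P (\<lambda>x. complex_of_real (indicator (B a) (W a x) * Z1 x))"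
    "integrable P (\<lambda>x. complex_of_real (indicator (B a) (W a x) * Z2 x))"
    by (rule P.integrable_const_bound[where B = 1]; use Zb in \<open>auto simp: indicator_def\<close>)+
  have "of_real (\<Prod>e\<in>insert a F'. indicator (B e) (W e x)) * iexp (Y x) =
      of_real (indicator (B a) (W a x) * Z1 x) + \<i> * of_real (indicator (B a) (W a x) * Z2 x)" for x
    using insert.hyps by (simp add: Z1_def Z2_def G_def[symmetric] exp_Euler cos_of_real[symmetric] sin_of_real[symmetric] algebra_simps)
  then have "(CLINT x|P. of_real (\<Prod>e\<in>insert a F'. indicator (B e) (W e x)) * iexp (Y x)) =
      (CLINT x|P. of_real (indicator (B a) (W a x) * Z1 x) + \<i> * of_real (indicator (B a) (W a x) * Z2 x))"
    by (simp only:)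
  also have "\<dots> = of_real (measure (D a) (B a) * (\<integral>x. Z1 x \<partial>P)) + \<i> * of_real (measure (D a) (B a) * (\<integral>x. Z2 x \<partial>P))"
    unfolding i1[symmetric] i2[symmetric]
    by (subst Bochner_Integration.integral_add[OF int1(1) integrable_mult_right[OF int1(2)]])
       (simp only: integral_mult_right_zero integral_complex_of_real)
  also have "\<dots> = of_real (measure (D a) (B a)) * (c * \<psi> 1)"
    unfolding of_real_mult z1 z2 by (simp add: algebra_simps)
  also have "\<dots> = of_real (\<Prod>e\<in>insert a F'. measure (D e) (B e)) * (\<Prod>e\<in>F. char (D e) (t e))"
    using insert.hyps by (simp add: c_def \<psi>_def)
  finally show ?case by (simp only: Y_def)
qed

text \<open>Factorized characteristic functions make the coordinate vector a product law under both
  measures, and the density of one product law against another is the product of the one-dimensional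
  densities.\<close>

lemma nn_integral_change_of_product_law:
  fixes W :: "'i \<Rightarrow> 'b \<Rightarrow> real"
  assumes P: "prob_space P1" "prob_space P2"
    and p: "\<And>e. e \<in> I \<Longrightarrow> 0 < p e" and q: "\<And>e. e \<in> I \<Longrightarrow> 0 < q e"
    and W1: "\<And>e. e \<in> I \<Longrightarrow> W e \<in> borel_measurable P1" and W2: "\<And>e. e \<in> I \<Longrightarrow> W e \<in> borel_measurable P2"
    and jc1: "\<And>F t. finite F \<Longrightarrow> F \<subseteq> I \<Longrightarrow>
      (CLINT x|P1. iexp (\<Sum>e\<in>F. t e * W e x)) = (\<Prod>e\<in>F. char (normal_law (a e) (p e)) (t e))"
    and jc2: "\<And>F t. finite F \<Longrightarrow> F \<subseteq> I \<Longrightarrow>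
      (CLINT x|P2. iexp (\<Sum>e\<in>F. t e * W e x)) = (\<Prod>e\<in>F. char (normal_law (b e) (q e)) (t e))"
    and F: "finite F" "F \<subseteq> I" and h: "h \<in> borel_measurable (PiM F (\<lambda>_. borel))"
  shows "(\<integral>\<^sup>+x. h (\<lambda>e\<in>F. W e x) * ennreal (exp (\<Sum>e\<in>F. normal_log_ratio (a e) (p e) (b e) (q e) (W e x))) \<partial>P1)
       = (\<integral>\<^sup>+x. h (\<lambda>e\<in>F. W e x) \<partial>P2)"
proof -
  \<comment> \<open>Outside \<open>F\<close> a standard normal law is only a filler, because
    \<open>product_sigma_finite\<close> speaks about all indices.\<close>
  define D1 where "D1 e = (if e \<in> F then normal_law (a e) (p e) else normal_law 0 1)" for e
  define D2 where "D2 e = (if e \<in> F then normal_law (b e) (q e) else normal_law 0 1)" for e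
  define \<rho> where "\<rho> e w = ennreal (exp (normal_log_ratio (a e) (p e) (b e) (q e) w))" for e w
  have [measurable]: "\<rho> e \<in> borel_measurable borel" for e unfolding \<rho>_def by measurable
  have rd: "real_distribution (D1 e)" "real_distribution (D2 e)" for e
    using p[of e] q[of e] F(2) by (auto simp: D1_def D2_def intro!: real_distribution_normal_law)
  have sb [simp]: "sets (D1 e) = sets borel" "sets (D2 e) = sets borel" for e
    using rd[of e] by (auto simp: real_distribution_def real_distribution_axioms_def)
  interpret D1: product_sigma_finite D1
    by (rule product_sigma_finite.intro, rule prob_space_imp_sigma_finite) (use rd in \<open>auto simp: real_distribution_def\<close>)
  interpret D2: product_sigma_finite D2
    by (rule product_sigma_finite.intro, rule prob_space_imp_sigma_finite) (use rd in \<open>auto simp: real_distribution_def\<close>)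
  have sP [simp]: "sets (PiM F D1) = sets (PiM F (\<lambda>_. borel))" "sets (PiM F D2) = sets (PiM F (\<lambda>_. borel))"
    by (rule sets_PiM_cong; simp)+
  let ?X = "\<lambda>x. \<lambda>e\<in>F. W e x"
  have law: "distr P (PiM F (\<lambda>_. borel)) ?X = PiM F D"
    if P: "prob_space P" and Wm: "\<And>e. e \<in> I \<Longrightarrow> W e \<in> borel_measurable P" and rd: "\<And>e. real_distribution (D e)"
      and jc: "\<And>G t. finite G \<Longrightarrow> G \<subseteq> F \<Longrightarrow> (CLINT x|P. iexp (\<Sum>e\<in>G. t e * W e x)) = (\<Prod>e\<in>G. char (D e) (t e))"
      for P D
  proof -
    interpret P: prob_space P by (rule P)
    interpret D: product_sigma_finite D
      by (rule product_sigma_finite.intro, rule prob_space_imp_sigma_finite) (use rd in \<open>auto simp: real_distribution_def\<close>)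
    have sb: "sets (D e) = sets borel" for e
      using rd[of e] by (auto simp: real_distribution_def real_distribution_axioms_def)
    have Xm: "?X \<in> measurable P (PiM F (\<lambda>_. borel))"
      by (rule measurable_restrict) (use Wm F(2) in auto)
    show ?thesis
    proof (rule D.PiM_eqI[OF F(1)])
      show "sets (distr P (PiM F (\<lambda>_. borel)) ?X) = sets (PiM F D)"
        by (simp, rule sets_PiM_cong) (simp_all add: sb)
      fix A assume A: "\<And>e. e \<in> F \<Longrightarrow> A e \<in> sets (D e)"
      have As: "A e \<in> sets borel" if "e \<in> F" for e using A[OF that] sb by simp
      have S: "Pi\<^sub>E F A \<in> sets (PiM F (\<lambda>_. borel))" by (rule sets_PiM_I_finite) (use F As in auto)
      let ?S = "?X -` Pi\<^sub>E F A \<inter> space P"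
      have Sm [measurable]: "?S \<in> sets P" by (rule measurable_sets[OF Xm S])
      \<comment> \<open>With no exponential factor left, the mixed identity gives the probability of
        the rectangle, and rectangles determine the product measure.\<close>
      have "(CLINT x|P. of_real (\<Prod>e\<in>F. indicator (A e) (W e x)) * iexp (\<Sum>e\<in>{}. 0 * W e x))
         = of_real (\<Prod>e\<in>F. measure (D e) (A e)) * (\<Prod>e\<in>{}. char (D e) 0)"
        by (rule independent_of_joint_char[OF P, where I = F]) (use rd Wm F As jc in auto)
      then have "(CLINT x|P. of_real (\<Prod>e\<in>F. indicator (A e) (W e x))) = of_real (\<Prod>e\<in>F. measure (D e) (A e))" by simp
      then have "(\<integral>x. (\<Prod>e\<in>F. indicator (A e) (W e x)) \<partial>P) = (\<Prod>e\<in>F. measure (D e) (A e))"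
        unfolding integral_complex_of_real by (simp only: of_real_eq_iff)
      moreover have "(\<integral>x. (\<Prod>e\<in>F. indicat_real (A e) (W e x)) \<partial>P) = (\<integral>x. indicat_real ?S x \<partial>P)"
      proof (rule Bochner_Integration.integral_cong[OF refl])
        fix x assume x: "x \<in> space P"
        show "(\<Prod>e\<in>F. indicator (A e) (W e x)) = (indicator ?S x :: real)"
        proof (cases "\<forall>e\<in>F. W e x \<in> A e")
          case True
          then show ?thesis using x by (auto simp: indicator_def PiE_iff)
        next
          case False
          then obtain e where "e \<in> F" "W e x \<notin> A e" by auto
          then have "(\<Prod>e\<in>F. indicator (A e) (W e x)) = (0::real)"
            by (intro prod_zero[OF F(1)] bexI[of _ e]) simp_all
          then show ?thesis using False by (auto simp: indicator_def PiE_iff)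
        qed
      qed
      ultimately have "measure P ?S = (\<Prod>e\<in>F. measure (D e) (A e))" by simp
      then have "emeasure P ?S = ennreal (\<Prod>e\<in>F. measure (D e) (A e))" by (simp add: P.emeasure_eq_measure)
      also have "\<dots> = (\<Prod>e\<in>F. emeasure (D e) (A e))"
      proof -
        have "emeasure (D e) X = ennreal (measure (D e) X)" for e X
          using rd[of e] unfolding real_distribution_def by (intro finite_measure.emeasure_eq_measure) (auto intro: prob_space.axioms)
        then show ?thesis by (simp add: prod_ennreal)
      qed
      finally show "emeasure (distr P (PiM F (\<lambda>_. borel)) ?X) (Pi\<^sub>E F A) = (\<Prod>e\<in>F. emeasure (D e) (A e))"
        by (simp add: emeasure_distr[OF Xm S])
    qed
  qed
  have Xm: "?X \<in> measurable P1 (PiM F (\<lambda>_. borel))" "?X \<in> measurable P2 (PiM F (\<lambda>_. borel))"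
    by (rule measurable_restrict; use W1 W2 F(2) in auto)+
  have L1: "distr P1 (PiM F (\<lambda>_. borel)) ?X = PiM F D1"
  proof (rule law[OF P(1) W1 rd(1)])
    fix G :: "'i set" and t assume G: "finite G" "G \<subseteq> F"
    then show "(CLINT x|P1. iexp (\<Sum>e\<in>G. t e * W e x)) = (\<Prod>e\<in>G. char (D1 e) (t e))"
      using F(2) by (subst jc1) (auto simp: D1_def intro!: prod.cong)
  qed
  have L2: "distr P2 (PiM F (\<lambda>_. borel)) ?X = PiM F D2"
  proof (rule law[OF P(2) W2 rd(2)])
    fix G :: "'i set" and t assume G: "finite G" "G \<subseteq> F"
    then show "(CLINT x|P2. iexp (\<Sum>e\<in>G. t e * W e x)) = (\<Prod>e\<in>G. char (D2 e) (t e))"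
      using F(2) by (subst jc2) (auto simp: D2_def intro!: prod.cong)
  qed
  define R where "R w = (\<Prod>e\<in>F. \<rho> e (w e))" for w
  have Rm [measurable]: "R \<in> borel_measurable (PiM F (\<lambda>_. borel))" unfolding R_def by measurable
  have Rm1: "R \<in> borel_measurable (PiM F D1)" using Rm measurable_cong_sets[OF sP(1) refl] by blast
  have D12: "density (PiM F D1) R = PiM F D2"
  proof (rule D2.PiM_eqI[OF F(1)])
    show "sets (density (PiM F D1) R) = sets (PiM F D2)" by simp
    fix A assume A: "\<And>e. e \<in> F \<Longrightarrow> A e \<in> sets (D2 e)"
    then have A' [measurable]: "e \<in> F \<Longrightarrow> A e \<in> sets borel" for e by simp
    have PA: "Pi\<^sub>E F A \<in> sets (PiM F D1)" by (rule sets_PiM_I_finite) (use F A' in auto)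
    have "emeasure (density (PiM F D1) R) (Pi\<^sub>E F A) = (\<integral>\<^sup>+w. R w * indicator (Pi\<^sub>E F A) w \<partial>PiM F D1)"
      by (rule emeasure_density[OF Rm1 PA])
    also have "\<dots> = (\<integral>\<^sup>+w. (\<Prod>e\<in>F. \<rho> e (w e) * indicator (A e) (w e)) \<partial>PiM F D1)"
    proof (rule nn_integral_cong)
      fix w assume w: "w \<in> space (PiM F D1)"
      have "indicator (Pi\<^sub>E F A) w = (\<Prod>e\<in>F. indicator (A e) (w e) :: ennreal)"
      proof (cases "\<forall>e\<in>F. w e \<in> A e")
        case True
        then show ?thesis using w by (auto simp: indicator_def space_PiM PiE_iff)
      next
        case False
        then obtain e where "e \<in> F" "w e \<notin> A e" by auto
        then have "(\<Prod>e\<in>F. indicator (A e) (w e)) = (0::ennreal)"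
          by (intro prod_zero[OF F(1)] bexI[of _ e]) simp_all
        then show ?thesis using False by (auto simp: indicator_def PiE_iff)
      qed
      then show "R w * indicator (Pi\<^sub>E F A) w = (\<Prod>e\<in>F. \<rho> e (w e) * indicator (A e) (w e))"
        by (simp add: R_def prod.distrib)
    qed
    also have "\<dots> = (\<Prod>e\<in>F. \<integral>\<^sup>+w. \<rho> e w * indicator (A e) w \<partial>D1 e)"
    proof (rule D1.product_nn_integral_prod[OF F(1)])
      fix e assume e: "e \<in> F"
      have "(\<lambda>w. \<rho> e w * indicator (A e) w) \<in> borel_measurable borel" using A'[OF e] by measurable
      then show "(\<lambda>w. \<rho> e w * indicator (A e) w) \<in> borel_measurable (D1 e)"
        using measurable_cong_sets[OF sb(1) refl] by blast
    qed
    also have "\<dots> = (\<Prod>e\<in>F. emeasure (D2 e) (A e))"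
    proof (rule prod.cong[OF refl])
      fix e assume e: "e \<in> F"
      have "\<rho> e \<in> borel_measurable borel" by measurable
      then have \<rho>m: "\<rho> e \<in> borel_measurable (D1 e)" using measurable_cong_sets[OF sb(1) refl] by blast
      have "D2 e = density (D1 e) (\<rho> e)"
      proof -
        have "e \<in> I" using e F(2) by auto
        then show ?thesis
          using normal_law_density[OF p q, of e e "b e" "a e"] e by (simp add: D1_def D2_def \<rho>_def[abs_def])
      qed
      then show "(\<integral>\<^sup>+w. \<rho> e w * indicator (A e) w \<partial>D1 e) = emeasure (D2 e) (A e)"
        using emeasure_density[OF \<rho>m, of "A e"] A'[OF e] by simp
    qed
    finally show "emeasure (density (PiM F D1) R) (Pi\<^sub>E F A) = (\<Prod>e\<in>F. emeasure (D2 e) (A e))" .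
  qed
  have hm1: "h \<in> borel_measurable (PiM F D1)" using h measurable_cong_sets[OF sP(1) refl] by blast
  have "(\<integral>\<^sup>+x. h (?X x) \<partial>P2) = (\<integral>\<^sup>+w. h w \<partial>distr P2 (PiM F (\<lambda>_. borel)) ?X)"
    by (rule nn_integral_distr[symmetric, OF Xm(2)]) (use h in simp)
  also have "\<dots> = (\<integral>\<^sup>+w. R w * h w \<partial>PiM F D1)"
    unfolding L2 D12[symmetric] by (rule nn_integral_density[OF Rm1 hm1])
  also have "\<dots> = (\<integral>\<^sup>+x. R (?X x) * h (?X x) \<partial>P1)"
    unfolding L1[symmetric] by (rule nn_integral_distr[OF Xm(1)]) (use h in measurable)
  also have "\<dots> = (\<integral>\<^sup>+x. h (?X x) * ennreal (exp (\<Sum>e\<in>F. normal_log_ratio (a e) (p e) (b e) (q e) (W e x))) \<partial>P1)"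
    by (rule nn_integral_cong) (simp add: R_def \<rho>_def prod_ennreal exp_sum[OF F(1)] mult.commute cong: prod.cong)
  finally show ?thesis by simp
qed

section \<open>Rapidly convergent sequences in \<open>L\<^sup>2\<close>\<close>

lemma half_power_square: "((1/2::real)^n)\<^sup>2 = (1/4)^n"
  by (simp add: power2_eq_square power_mult_distrib[symmetric])

lemma AE_tendsto_0_of_L2:
  fixes f :: "nat \<Rightarrow> 'b \<Rightarrow> real"
  assumes [measurable]: "\<And>n. f n \<in> borel_measurable P" and int: "\<And>n. integrable P (\<lambda>x. (f n x)\<^sup>2)"
    and le: "\<And>n. (\<integral>x. (f n x)\<^sup>2 \<partial>P) \<le> C * (1/4)^n" and C: "0 \<le> C"
  shows "AE x in P. (\<lambda>n. f n x) \<longlonglongrightarrow> 0"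
proof -
  have "AE x in P. (\<lambda>n. (f n x)\<^sup>2) \<longlonglongrightarrow> 0"
  proof (rule AE_tendsto_0_of_summable(2)[where a = "\<lambda>n. C * (1/4)^n"])
    fix n
    have "(\<integral>\<^sup>+x. ennreal \<bar>(f n x)\<^sup>2\<bar> \<partial>P) = ennreal (\<integral>x. (f n x)\<^sup>2 \<partial>P)"
      using nn_integral_eq_integral[OF int[of n]] by simp
    then show "(\<integral>\<^sup>+x. ennreal \<bar>(f n x)\<^sup>2\<bar> \<partial>P) \<le> ennreal (C * (1/4)^n)" using le[of n] by (simp add: ennreal_leI)
    show "0 \<le> C * (1/4)^n" using C by simp
  qed (auto intro!: summable_mult summable_geometric)
  then show ?thesis
  proof eventually_elim
    case (elim x)
    from tendsto_real_sqrt[OF elim] show ?case by (simp add: tendsto_rabs_zero_iff)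
  qed
qed

text \<open>The rate yields almost everywhere convergence together with an integrable majorant of
  all squares, so that first and second moments pass to the limit. Since \<open>W\<close> is a
  pointwise limit, it does not depend on \<open>P\<close>.\<close>

lemma L2_fast_limit:
  fixes Y :: "nat \<Rightarrow> 'b \<Rightarrow> real"
  assumes P: "prob_space P" and Y [measurable]: "\<And>k. Y k \<in> borel_measurable P"
    and int: "\<And>k. integrable P (\<lambda>x. (Y k x)\<^sup>2)"
    and fast: "\<And>k. (\<integral>x. (Y (Suc k) x - Y k x)\<^sup>2 \<partial>P) \<le> C * (1/4)^k"
  defines "W x \<equiv> lim (\<lambda>k. Y k x)"
  shows "AE x in P. (\<lambda>k. Y k x) \<longlonglongrightarrow> W x" "integrable P (\<lambda>x. (W x)\<^sup>2)" "integrable P W"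
    "(\<lambda>k. \<integral>x. Y k x \<partial>P) \<longlonglongrightarrow> (\<integral>x. W x \<partial>P)"
    "(\<lambda>k. \<integral>x. (Y k x)\<^sup>2 \<partial>P) \<longlonglongrightarrow> (\<integral>x. (W x)\<^sup>2 \<partial>P)"
proof -
  interpret P: prob_space P by (rule P)
  \<comment> \<open>The weight \<open>2^k\<close> leaves means of order \<open>(1/2)^k\<close>,
    which are still summable, and lets \<open>d\<close> control the sum of the increments
    themselves.\<close>
  define d where "d k x = 2^k * (Y (Suc k) x - Y k x)\<^sup>2" for k x
  have [measurable]: "d k \<in> borel_measurable P" for k unfolding d_def by measurable
  have Wm [measurable]: "W \<in> borel_measurable P" unfolding W_def by (rule borel_measurable_lim_metric) measurable
  have intd: "integrable P (d k)" for k
  proof -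
    have "integrable P (\<lambda>x. (Y (Suc k) x - Y k x)\<^sup>2)"
    proof (rule Bochner_Integration.integrable_bound)
      show "integrable P (\<lambda>x. 2 * (Y (Suc k) x)\<^sup>2 + 2 * (Y k x)\<^sup>2)" using int by simp
      have "(a - b)\<^sup>2 \<le> 2 * a\<^sup>2 + 2 * b\<^sup>2" for a b :: real
        using zero_le_power2[of "a + b"] by (simp add: power2_sum power2_diff)
      then show "AE x in P. norm ((Y (Suc k) x - Y k x)\<^sup>2) \<le> norm (2 * (Y (Suc k) x)\<^sup>2 + 2 * (Y k x)\<^sup>2)" by simp
    qed measurable
    then show ?thesis unfolding d_def by simp
  qed
  have d0: "0 \<le> d k x" for k x by (simp add: d_def)
  have Ed: "(\<integral>x. d k x \<partial>P) \<le> C * (1/2)^k" for k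
  proof -
    have "(\<integral>x. d k x \<partial>P) = 2^k * (\<integral>x. (Y (Suc k) x - Y k x)\<^sup>2 \<partial>P)" by (simp add: d_def)
    also have "\<dots> \<le> 2^k * (C * (1/4)^k)" by (intro mult_left_mono fast) simp
    also have "\<dots> = C * (2 * (1/4))^k" unfolding power_mult_distrib by simp
    finally show ?thesis by simp
  qed
  have "0 \<le> (\<integral>x. (Y (Suc 0) x - Y 0 x)\<^sup>2 \<partial>P)" by (rule Bochner_Integration.integral_nonneg) simp
  then have C0: "0 \<le> C" using order_trans[OF _ fast[of 0], of 0] by simp
  have smC: "summable (\<lambda>k. C * (1/2::real)^k)" by (intro summable_mult summable_geometric) simp
  have nnd: "(\<integral>\<^sup>+x. ennreal \<bar>d k x\<bar> \<partial>P) \<le> ennreal (C * (1/2)^k)" for k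
  proof -
    have "(\<integral>\<^sup>+x. ennreal \<bar>d k x\<bar> \<partial>P) = ennreal (\<integral>x. d k x \<partial>P)"
      using nn_integral_eq_integral[OF intd[of k]] d0 by simp
    then show ?thesis using Ed[of k] by (simp add: ennreal_leI)
  qed
  have "AE x in P. summable (\<lambda>k. \<bar>d k x\<bar>)"
    by (rule AE_tendsto_0_of_summable(1)[OF _ nnd smC]) (use C0 in simp_all)
  then have sd: "AE x in P. summable (\<lambda>k. d k x)" using d0 by simp
  \<comment> \<open>The square of \<open>Y n\<close> is at most twice the square of
    \<open>Y 0\<close> plus twice the square of the difference; by Cauchy--Schwarz and
    \<open>(\<Sum>k. (1/2)^k) = 2\<close> the latter square is at most
    \<open>2 * (\<Sum>k. d k x)\<close>, whence the factor 4.\<close>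
  define D where "D x = 2 * (Y 0 x)\<^sup>2 + 4 * (\<Sum>k. d k x)" for x
  have intS: "integrable P (\<lambda>x. \<Sum>k. d k x)"
  proof (rule integrable_suminf[OF intd])
    show "AE x in P. summable (\<lambda>k. norm (d k x))" using sd d0 by simp
    show "summable (\<lambda>k. \<integral>x. norm (d k x) \<partial>P)"
      by (rule summable_comparison_test'[OF smC, of 0]) (use Ed d0 in \<open>simp add: Bochner_Integration.integral_nonneg\<close>)
  qed
  then have intD: "integrable P D" unfolding D_def using int by simp
  have pt: "(\<lambda>k. Y k x) \<longlonglongrightarrow> W x \<and> (\<forall>k. (Y k x)\<^sup>2 \<le> D x)" if s: "summable (\<lambda>k. d k x)" for x
  proof -
    let ?a = "\<lambda>k. \<bar>Y (Suc k) x - Y k x\<bar>"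
    have am: "?a k \<le> (1/2)^k + d k x" for k
    proof -
      have "0 \<le> ((1/2)^k - ?a k)\<^sup>2 * 2^k" by simp
      also have "\<dots> = (1/2)^k * ((1/2)^k * 2^k) - 2 * ?a k * ((1/2)^k * 2^k) + 2^k * (?a k)\<^sup>2"
        by (simp add: power2_diff power2_eq_square algebra_simps)
      also have "(1/2)^k * 2^k = (1::real)" by (simp add: power_mult_distrib[symmetric])
      finally have "2 * ?a k \<le> (1/2)^k + d k x" by (simp add: d_def)
      moreover have "?a k \<le> 2 * ?a k" by simp
      ultimately show ?thesis by (rule order_trans[rotated])
    qed
    have tele: "(\<Sum>k<n. Y (Suc k) x - Y k x) = Y n x - Y 0 x" for n
      by (rule sum_lessThan_telescope)
    have sa: "summable ?a"
      by (rule summable_comparison_test'[of "\<lambda>k. (1/2)^k + d k x" 0]) (use am s in \<open>auto intro!: summable_add summable_geometric\<close>)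
    have "summable (\<lambda>k. Y (Suc k) x - Y k x)" by (rule summable_rabs_cancel[OF sa])
    then have "convergent (\<lambda>n. \<Sum>k<n. Y (Suc k) x - Y k x)" by (simp add: summable_iff_convergent)
    then have "convergent (\<lambda>n. Y n x - Y 0 x)" by (simp only: tele)
    then have "convergent (\<lambda>n. (Y n x - Y 0 x) + Y 0 x)" by (intro convergent_add convergent_const)
    then have "(\<lambda>k. Y k x) \<longlonglongrightarrow> W x" by (simp add: W_def convergent_LIMSEQ_iff)
    moreover have "(Y n x)\<^sup>2 \<le> D x" for n
    proof -
      have "\<bar>Y n x - Y 0 x\<bar> \<le> (\<Sum>k<n. ?a k)"
        using sum_abs[of "\<lambda>k. Y (Suc k) x - Y k x" "{..<n}"] by (simp only: tele)
      then have "\<bar>Y n x - Y 0 x\<bar>\<^sup>2 \<le> (\<Sum>k<n. ?a k)\<^sup>2" by (intro power_mono) auto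
      also have "(\<Sum>k<n. ?a k) = (\<Sum>k<n. sqrt ((1/2)^k) * (sqrt (2^k) * ?a k))"
        by (intro sum.cong refl) (simp add: real_sqrt_mult[symmetric] power_mult_distrib[symmetric] mult.assoc[symmetric])
      also have "(\<Sum>k<n. sqrt ((1/2)^k) * (sqrt (2^k) * ?a k))\<^sup>2 \<le> (\<Sum>k<n. (sqrt ((1/2)^k))\<^sup>2) * (\<Sum>k<n. (sqrt (2^k) * ?a k)\<^sup>2)"
        by (rule Cauchy_Schwarz_ineq_sum)
      also have "\<dots> = (\<Sum>k<n. (1/2)^k) * (\<Sum>k<n. d k x)" by (simp add: d_def power_mult_distrib)
      also have "\<dots> \<le> 2 * (\<Sum>k. d k x)"
      proof (rule mult_mono)
        have "(\<Sum>k<n. (1/2::real)^k) \<le> (\<Sum>k. (1/2)^k)" by (intro sum_le_suminf summable_geometric) auto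
        then show "(\<Sum>k<n. (1/2::real)^k) \<le> 2" by (simp add: suminf_geometric)
        show "(\<Sum>k<n. d k x) \<le> (\<Sum>k. d k x)" by (intro sum_le_suminf s) (use d0 in auto)
      qed (use d0 in \<open>auto intro: sum_nonneg\<close>)
      finally have "(Y n x - Y 0 x)\<^sup>2 \<le> 2 * (\<Sum>k. d k x)" by simp
      moreover have "(Y n x)\<^sup>2 \<le> 2 * (Y 0 x)\<^sup>2 + 2 * (Y n x - Y 0 x)\<^sup>2"
        using zero_le_power2[of "Y n x - 2 * Y 0 x"] by (simp add: power2_diff power_mult_distrib)
      ultimately show ?thesis by (simp add: D_def)
    qed
    ultimately show ?thesis by blast
  qed
  show conv: "AE x in P. (\<lambda>k. Y k x) \<longlonglongrightarrow> W x" using sd by eventually_elim (use pt in blast)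
  have bound: "AE x in P. norm ((Y k x)\<^sup>2) \<le> D x" for k using sd by eventually_elim (use pt in auto)
  have bound1: "AE x in P. norm (Y k x) \<le> 1 + D x" for k
    using bound[of k]
  proof eventually_elim
    case (elim x)
    have "2 * \<bar>Y k x\<bar> \<le> 1 + (Y k x)\<^sup>2" using zero_le_power2[of "\<bar>Y k x\<bar> - 1"] by (simp add: power2_diff)
    then show ?case using elim by simp
  qed
  have conv2: "AE x in P. (\<lambda>k. (Y k x)\<^sup>2) \<longlonglongrightarrow> (W x)\<^sup>2" using conv by eventually_elim (rule tendsto_power)
  show "integrable P (\<lambda>x. (W x)\<^sup>2)" by (rule integrable_dominated_convergence[OF _ _ intD conv2 bound]) measurable
  show "(\<lambda>k. \<integral>x. (Y k x)\<^sup>2 \<partial>P) \<longlonglongrightarrow> (\<integral>x. (W x)\<^sup>2 \<partial>P)"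
    by (rule integral_dominated_convergence[OF _ _ intD conv2 bound]) measurable
  have intD1: "integrable P (\<lambda>x. 1 + D x)" using intD by simp
  show "integrable P W" by (rule integrable_dominated_convergence[OF _ _ intD1 conv bound1]) measurable
  show "(\<lambda>k. \<integral>x. Y k x \<partial>P) \<longlonglongrightarrow> (\<integral>x. W x \<partial>P)"
    by (rule integral_dominated_convergence[OF _ _ intD1 conv bound1]) measurable
qed

section \<open>White-noise coordinates\<close>

text \<open>Here \<open>q\<close> plays the role of \<open>Q\<^sup>1\<^sup>/\<^sup>2\<close>. The coordinate \<open>W e\<close> stands for the functional
  \<open>x \<mapsto> \<langle>q\<^sup>-\<^sup>1 (x - m1), e\<rangle>\<close>, which is defined only almost everywhere: it is the limit of
  \<open>x \<mapsto> \<langle>h, x - m1\<rangle>\<close> as \<open>q h\<close> tends to \<open>e\<close>.\<close>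

locale white_noise =
  fixes m1 :: "'a::{real_inner,polish_space}" and q :: "'a \<Rightarrow> 'a" and E :: "'a set"
  assumes q: "op_selfadj q" and dense: "closure (range q) = UNIV" and E: "onb E"
begin

definition Y :: "'a \<Rightarrow> 'a \<Rightarrow> real" where "Y h x = inner h (x - m1)"

text \<open>One sequence, fixed once and for all with a geometric rate, makes the limit
  \<open>W e\<close> exist almost everywhere under every measure satisfying
  \<open>second_order\<close>, so that all measures share the same coordinate function.\<close>

definition app :: "'a \<Rightarrow> nat \<Rightarrow> 'a" where "app e k = (SOME h. norm (q h - e) \<le> (1/2)^k)"

definition W :: "'a \<Rightarrow> 'a \<Rightarrow> real" where "W e x = lim (\<lambda>k. Y (app e k) x)"

text \<open>Mean \<open>m1 + q c\<close> and covariance \<open>q \<circ> K \<circ> q\<close>, tested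
  on linear functionals; in the coordinates \<open>W e\<close> these become mean \<open>c\<close>
  and covariance \<open>K\<close>.\<close>

definition second_order :: "'a measure \<Rightarrow> ('a \<Rightarrow> 'a) \<Rightarrow> 'a \<Rightarrow> bool" where
  "second_order P K c \<longleftrightarrow> prob_space P \<and> sets P = sets borel \<and> bounded_linear K \<and>
     (\<forall>h. integrable P (\<lambda>x. (Y h x)\<^sup>2) \<and> (\<integral>x. Y h x \<partial>P) = inner (q h) c \<and>
       (\<integral>x. (Y h x)\<^sup>2 \<partial>P) = inner (K (q h)) (q h) + (inner (q h) c)\<^sup>2)"

definition gaussian_char :: "'a measure \<Rightarrow> ('a \<Rightarrow> 'a) \<Rightarrow> 'a \<Rightarrow> bool" where
  "gaussian_char P K c \<longleftrightarrow> (\<forall>h. (CLINT x|P. iexp (Y h x)) =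
     exp (\<i> * of_real (inner (q h) c) - of_real (inner (K (q h)) (q h) / 2)))"

lemma q_linear: "bounded_linear q"
  using q by (simp add: op_selfadj_def)

lemma Y_borel [measurable]: "Y h \<in> borel_measurable borel"
  unfolding Y_def by (intro borel_measurable_continuous_onI continuous_intros)

lemma Y_linear: "Y (\<Sum>e\<in>F. t e *\<^sub>R h e) x = (\<Sum>e\<in>F. t e * Y (h e) x)" "Y (h1 - h2) x = Y h1 x - Y h2 x"
  by (simp_all add: Y_def inner_sum_left inner_diff_left)

lemma W_borel [measurable]: "W e \<in> borel_measurable borel"
  unfolding W_def by (rule borel_measurable_lim_metric) measurable

lemma app: "norm (q (app e k) - e) \<le> (1/2)^k"
proof -
  have "e \<in> closure (range q)" using dense by simp
  then obtain y where "y \<in> range q" "dist y e < (1/2)^k"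
    unfolding closure_approachable by (meson half_gt_zero_iff zero_less_one zero_less_power)
  then have "\<exists>h. norm (q h - e) \<le> (1/2)^k" by (auto simp: dist_norm intro: less_imp_le)
  then show ?thesis unfolding app_def by (rule someI_ex)
qed

lemma q_app_tendsto: "(\<lambda>k. q (app e k)) \<longlonglongrightarrow> e"
proof -
  have "(\<lambda>k. q (app e k) - e) \<longlonglongrightarrow> 0"
    by (rule Lim_null_comparison[OF _ LIMSEQ_realpow_zero[of "1/2"]]) (use app in auto)
  then show ?thesis by (simp add: LIM_zero_iff)
qed

lemma second_order_meas:
  assumes "second_order P K c"
  shows "f \<in> borel_measurable borel \<Longrightarrow> f \<in> borel_measurable P"
  using assms measurable_cong_sets[of P borel] by (auto simp: second_order_def)

text \<open>The L2 norm of \<open>Y h\<close> is controlled by \<open>norm (q h)\<close> alone.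
  Therefore \<open>Y\<close> extends to limits of \<open>q h\<close>, even along sequences in which
  \<open>h\<close> itself diverges.\<close>

lemma second_order_bound:
  assumes P: "second_order P K c"
  obtains C where "0 \<le> C" "\<And>h. (\<integral>x. (Y h x)\<^sup>2 \<partial>P) \<le> C * (norm (q h))\<^sup>2"
proof -
  interpret K: bounded_linear K using P by (simp add: second_order_def)
  obtain k where k: "k \<ge> 0" "\<And>x. norm (K x) \<le> norm x * k" using K.nonneg_bounded by blast
  have "(\<integral>x. (Y h x)\<^sup>2 \<partial>P) \<le> (k + (norm c)\<^sup>2) * (norm (q h))\<^sup>2" for h
  proof -
    have "(\<integral>x. (Y h x)\<^sup>2 \<partial>P) = inner (K (q h)) (q h) + (inner (q h) c)\<^sup>2" using P by (simp add: second_order_def)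
    also have "inner (K (q h)) (q h) \<le> norm (K (q h)) * norm (q h)" by (rule norm_cauchy_schwarz)
    also have "\<dots> \<le> (norm (q h) * k) * norm (q h)" by (intro mult_right_mono k) auto
    also have "(inner (q h) c)\<^sup>2 \<le> (norm (q h) * norm c)\<^sup>2"
      using Cauchy_Schwarz_ineq2[of "q h" c] by (metis abs_ge_zero power2_abs power_mono)
    finally show ?thesis by (simp add: algebra_simps power2_eq_square)
  qed
  then show ?thesis using that[of "k + (norm c)\<^sup>2"] k(1) by simp
qed

lemma second_order_AE_tendsto_0:
  assumes P: "second_order P K c" and h: "\<And>n. norm (q (h n)) \<le> B * (1/2)^n"
  shows "AE x in P. (\<lambda>n. Y (h n) x) \<longlonglongrightarrow> 0"
proof -
  obtain C where C: "0 \<le> C" "\<And>h. (\<integral>x. (Y h x)\<^sup>2 \<partial>P) \<le> C * (norm (q h))\<^sup>2" using second_order_bound[OF P] by blast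
  note [measurable] = second_order_meas[OF P Y_borel]
  show ?thesis
  proof (rule AE_tendsto_0_of_L2)
    fix n
    have "(\<integral>x. (Y (h n) x)\<^sup>2 \<partial>P) \<le> C * (B * (1/2)^n)\<^sup>2"
      by (rule order_trans[OF C(2)]) (intro mult_left_mono C(1) power_mono h norm_ge_zero)
    also have "\<dots> = C * B\<^sup>2 * (1/4)^n" unfolding power_mult_distrib half_power_square by simp
    finally show "(\<integral>x. (Y (h n) x)\<^sup>2 \<partial>P) \<le> C * B\<^sup>2 * (1/4)^n" .
    show "integrable P (\<lambda>x. (Y (h n) x)\<^sup>2)" using P by (simp add: second_order_def)
    show "0 \<le> C * B\<^sup>2" using C(1) by simp
  qed measurable
qed

lemma coordinate_limit:
  assumes P: "second_order P K c"
  shows "AE x in P. (\<lambda>k. Y (app e k) x) \<longlonglongrightarrow> W e x" "integrable P (\<lambda>x. (W e x)\<^sup>2)" "integrable P (W e)"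
    "(\<integral>x. W e x \<partial>P) = inner e c" "(\<integral>x. (W e x)\<^sup>2 \<partial>P) = inner (K e) e + (inner e c)\<^sup>2"
proof -
  interpret q: bounded_linear q by (rule q_linear)
  interpret K: bounded_linear K using P by (simp add: second_order_def)
  obtain C where C: "0 \<le> C" "\<And>h. (\<integral>x. (Y h x)\<^sup>2 \<partial>P) \<le> C * (norm (q h))\<^sup>2" using second_order_bound[OF P] by blast
  have fast: "(\<integral>x. (Y (app e (Suc k)) x - Y (app e k) x)\<^sup>2 \<partial>P) \<le> (4 * C) * (1/4)^k" for k
  proof -
    have "norm (q (app e (Suc k) - app e k)) = norm ((q (app e (Suc k)) - e) - (q (app e k) - e))"
      by (simp add: q.diff)
    also have "\<dots> \<le> (1/2)^Suc k + (1/2)^k"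
      by (rule order_trans[OF norm_triangle_ineq4 add_mono[OF app app]])
    also have "\<dots> \<le> 2 * (1/2)^k" by simp
    finally have n: "norm (q (app e (Suc k) - app e k)) \<le> 2 * (1/2)^k" .
    have "(\<integral>x. (Y (app e (Suc k)) x - Y (app e k) x)\<^sup>2 \<partial>P) \<le> C * (2 * (1/2)^k)\<^sup>2"
      unfolding Y_linear(2)[symmetric]
      by (rule order_trans[OF C(2)]) (intro mult_left_mono C(1) power_mono n norm_ge_zero)
    also have "\<dots> = (4 * C) * (1/4)^k" unfolding power_mult_distrib half_power_square by simp
    finally show ?thesis .
  qed
  have pr: "prob_space P" and int: "\<And>k. integrable P (\<lambda>x. (Y (app e k) x)\<^sup>2)" using P by (auto simp: second_order_def)
  note L = L2_fast_limit[OF pr second_order_meas[OF P Y_borel] int fast, folded W_def]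
  show "AE x in P. (\<lambda>k. Y (app e k) x) \<longlonglongrightarrow> W e x" "integrable P (\<lambda>x. (W e x)\<^sup>2)" "integrable P (W e)"
    using L(1,2,3) by auto
  have "(\<lambda>k. \<integral>x. Y (app e k) x \<partial>P) \<longlonglongrightarrow> inner e c"
    using P by (auto simp: second_order_def intro!: tendsto_intros q_app_tendsto)
  then show "(\<integral>x. W e x \<partial>P) = inner e c" using L(4) LIMSEQ_unique by blast
  have "(\<lambda>k. \<integral>x. (Y (app e k) x)\<^sup>2 \<partial>P) \<longlonglongrightarrow> inner (K e) e + (inner e c)\<^sup>2"
    using P by (auto simp: second_order_def intro!: tendsto_intros q_app_tendsto K.tendsto)
  then show "(\<integral>x. (W e x)\<^sup>2 \<partial>P) = inner (K e) e + (inner e c)\<^sup>2" using L(5) LIMSEQ_unique by blast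
qed

text \<open>The joint characteristic function factorizes because the quadratic form of
  \<open>K\<close> has no cross terms on an eigenbasis; the identity passes from \<open>Y\<close> to
  \<open>W\<close> by dominated convergence.\<close>

lemma coordinates_char:
  assumes P: "second_order P K c" and G: "gaussian_char P K c"
    and K: "\<And>e. e \<in> E \<Longrightarrow> K e = \<kappa> e *\<^sub>R e" and \<kappa>: "\<And>e. e \<in> E \<Longrightarrow> 0 \<le> \<kappa> e"
    and F: "finite F" "F \<subseteq> E"
  shows "(CLINT x|P. iexp (\<Sum>e\<in>F. t e * W e x)) = (\<Prod>e\<in>F. char (normal_law (inner e c) (\<kappa> e)) (t e))"
proof -
  interpret P: prob_space P using P by (simp add: second_order_def)
  interpret q: bounded_linear q by (rule q_linear)
  interpret K: bounded_linear K using P by (simp add: second_order_def)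
  note [measurable] = second_order_meas[OF P Y_borel] second_order_meas[OF P W_borel]
  define h where "h k = (\<Sum>e\<in>F. t e *\<^sub>R app e k)" for k
  define f where "f = (\<Sum>e\<in>F. t e *\<^sub>R e)"
  have "AE x in P. \<forall>e\<in>F. (\<lambda>k. Y (app e k) x) \<longlonglongrightarrow> W e x"
    using coordinate_limit(1)[OF P] F(1) by (simp add: AE_finite_all)
  then have lim: "AE x in P. (\<lambda>k. iexp (Y (h k) x)) \<longlonglongrightarrow> iexp (\<Sum>e\<in>F. t e * W e x)"
    unfolding h_def Y_linear by eventually_elim (intro tendsto_intros, auto)
  have 1: "(\<lambda>k. CLINT x|P. iexp (Y (h k) x)) \<longlonglongrightarrow> (CLINT x|P. iexp (\<Sum>e\<in>F. t e * W e x))"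
    by (rule integral_dominated_convergence[where w = "\<lambda>_. 1"]) (use lim in auto)
  have qh: "(\<lambda>k. q (h k)) \<longlonglongrightarrow> f"
    unfolding h_def f_def q.sum q.scaleR by (intro tendsto_intros q_app_tendsto)
  have 2: "(\<lambda>k. CLINT x|P. iexp (Y (h k) x)) \<longlonglongrightarrow> exp (\<i> * of_real (inner f c) - of_real (inner (K f) f / 2))"
    using G unfolding gaussian_char_def by (auto intro!: tendsto_intros qh K.tendsto)
  have fc: "inner f c = (\<Sum>e\<in>F. t e * inner e c)" by (simp add: f_def inner_sum_left)
  have Kf: "K f = (\<Sum>e\<in>F. (t e * \<kappa> e) *\<^sub>R e)"
    unfolding f_def K.sum K.scaleR by (rule sum.cong) (use F K in auto)
  have "inner (K f) f = (\<Sum>e\<in>F. t e * inner (K f) e)"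
    by (subst (2) f_def) (simp add: inner_sum_right)
  also have "\<dots> = (\<Sum>e\<in>F. (t e)\<^sup>2 * \<kappa> e)"
    unfolding Kf using orthonormal_inner_sum[OF onb_imp_orthonormal[OF E] F] F
    by (intro sum.cong refl) (auto simp: power2_eq_square)
  finally have KF: "inner (K f) f / 2 = (\<Sum>e\<in>F. (t e)\<^sup>2 * \<kappa> e / 2)" by (simp add: sum_divide_distrib)
  have "(\<Prod>e\<in>F. char (normal_law (inner e c) (\<kappa> e)) (t e))
     = (\<Prod>e\<in>F. exp (\<i> * of_real (t e * inner e c) - of_real ((t e)\<^sup>2 * \<kappa> e / 2)))"
    by (rule prod.cong) (use F \<kappa> in \<open>auto simp: char_normal_law\<close>)
  also have "\<dots> = exp (\<Sum>e\<in>F. \<i> * of_real (t e * inner e c) - of_real ((t e)\<^sup>2 * \<kappa> e / 2))"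
    by (rule exp_sum[OF F(1), symmetric])
  also have "\<dots> = exp (\<i> * of_real (inner f c) - of_real (inner (K f) f / 2))"
    unfolding fc KF of_real_sum sum_subtractf sum_distrib_left by (rule refl)
  finally have "(\<Prod>e\<in>F. char (normal_law (inner e c) (\<kappa> e)) (t e))
     = exp (\<i> * of_real (inner f c) - of_real (inner (K f) f / 2))" .
  with LIMSEQ_unique[OF 1 2] show ?thesis by (rule trans[OF _ sym])
qed

text \<open>The coefficient of \<open>x - m1\<close> along \<open>f\<close> is \<open>Y f x\<close>,
  and expanding \<open>q f\<close> in \<open>E\<close> suggests the approximation of
  \<open>Y f\<close> by the corresponding combination of the \<open>W e\<close>. Thus almost every
  point is recovered from its coordinates.\<close>

lemma reconstruction:
  assumes P: "second_order P id 0"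
  obtains s :: "nat \<Rightarrow> 'a set" and G :: "nat \<Rightarrow> 'a set" where
    "\<And>n. finite (G n)" "\<And>n. G n \<subseteq> E" "\<And>n. finite (s n)"
    "AE x in P. (\<lambda>n. m1 + (\<Sum>f\<in>s n. (\<Sum>e\<in>G n. inner (q f) e * W e x) *\<^sub>R f)) \<longlonglongrightarrow> x"
proof -
  interpret P: prob_space P using P by (simp add: second_order_def)
  interpret q: bounded_linear q by (rule q_linear)
  note [measurable] = second_order_meas[OF P Y_borel] second_order_meas[OF P W_borel]
  have oE: "orthonormal E" by (rule onb_imp_orthonormal[OF E])
  obtain s where s: "\<And>n. finite (s n)" "\<And>n. s n \<subseteq> E" "filterlim s (finite_subsets_at_top E) sequentially"
    using countable_exhaustion[OF orthonormal_countable[OF oE]] by metis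
  \<comment> \<open>Dividing by the number of coefficients keeps the total L1 error over
    \<open>s n\<close> below \<open>(1/2)^n\<close>; the added 1 covers an empty
    \<open>s n\<close>.\<close>
  define \<delta> where "\<delta> n = (1/2)^n / (1 + real (card (s n)))" for n
  have \<delta>: "0 < \<delta> n" for n unfolding \<delta>_def by simp
  have "\<exists>G. finite G \<and> G \<subseteq> E \<and> (\<forall>f\<in>s n. norm (q f - (\<Sum>e\<in>G. inner (q f) e *\<^sub>R e)) < \<delta> n)" for n
  proof -
    have "\<forall>\<^sub>F G in finite_subsets_at_top E. dist (\<Sum>e\<in>G. inner (q f) e *\<^sub>R e) (q f) < \<delta> n" for f
      using onb_has_sum_expansion[OF E, of "q f"] \<delta>[of n] unfolding has_sum_def tendsto_iff by blast
    then have "\<forall>\<^sub>F G in finite_subsets_at_top E. \<forall>f\<in>s n. dist (\<Sum>e\<in>G. inner (q f) e *\<^sub>R e) (q f) < \<delta> n"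
      using s(1)[of n] by (simp add: eventually_ball_finite)
    then show ?thesis unfolding eventually_finite_subsets_at_top by (metis dist_commute dist_norm subset_refl)
  qed
  then obtain G where G: "\<And>n. finite (G n)" "\<And>n. G n \<subseteq> E"
    "\<And>n f. f \<in> s n \<Longrightarrow> norm (q f - (\<Sum>e\<in>G n. inner (q f) e *\<^sub>R e)) < \<delta> n" by metis
  define Z where "Z n f x = (\<Sum>e\<in>G n. inner (q f) e * W e x)" for n f x
  have [measurable]: "Z n f \<in> borel_measurable P" for n f unfolding Z_def by measurable
  \<comment> \<open>The difference is an almost everywhere limit of functionals
    \<open>Y (h k)\<close> whose second moments are explicit, so Fatou's lemma bounds its second
    moment.\<close>
  have est2: "(\<integral>\<^sup>+x. ennreal ((Y f x - Z n f x)\<^sup>2) \<partial>P) \<le> ennreal ((\<delta> n)\<^sup>2)" if f: "f \<in> s n" for n f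
  proof -
    define h where "h k = f - (\<Sum>e\<in>G n. inner (q f) e *\<^sub>R app e k)" for k
    have "AE x in P. \<forall>e\<in>G n. (\<lambda>k. Y (app e k) x) \<longlonglongrightarrow> W e x"
      using coordinate_limit(1)[OF P] G(1) by (simp add: AE_finite_all)
    then have lim: "AE x in P. (\<lambda>k. ennreal ((Y (h k) x)\<^sup>2)) \<longlonglongrightarrow> ennreal ((Y f x - Z n f x)\<^sup>2)"
      unfolding h_def Y_linear Z_def by eventually_elim (intro tendsto_ennrealI tendsto_intros, auto)
    have "(\<integral>\<^sup>+x. ennreal ((Y f x - Z n f x)\<^sup>2) \<partial>P) = (\<integral>\<^sup>+x. liminf (\<lambda>k. ennreal ((Y (h k) x)\<^sup>2)) \<partial>P)"
    proof (rule nn_integral_cong_AE)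
      show "AE x in P. ennreal ((Y f x - Z n f x)\<^sup>2) = liminf (\<lambda>k. ennreal ((Y (h k) x)\<^sup>2))"
        using lim by eventually_elim (rule lim_imp_Liminf[symmetric], simp)
    qed
    also have "\<dots> \<le> liminf (\<lambda>k. \<integral>\<^sup>+x. ennreal ((Y (h k) x)\<^sup>2) \<partial>P)"
      by (rule nn_integral_liminf) measurable
    also have "(\<lambda>k. \<integral>\<^sup>+x. ennreal ((Y (h k) x)\<^sup>2) \<partial>P) = (\<lambda>k. ennreal ((norm (q (h k)))\<^sup>2))"
    proof
      fix k
      have "(\<integral>\<^sup>+x. ennreal ((Y (h k) x)\<^sup>2) \<partial>P) = ennreal (\<integral>x. (Y (h k) x)\<^sup>2 \<partial>P)"
        by (rule nn_integral_eq_integral) (use P in \<open>auto simp: second_order_def\<close>)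
      then show "(\<integral>\<^sup>+x. ennreal ((Y (h k) x)\<^sup>2) \<partial>P) = ennreal ((norm (q (h k)))\<^sup>2)"
        using P by (simp add: second_order_def power2_norm_eq_inner)
    qed
    also have "liminf (\<lambda>k. ennreal ((norm (q (h k)))\<^sup>2)) = ennreal ((norm (q f - (\<Sum>e\<in>G n. inner (q f) e *\<^sub>R e)))\<^sup>2)"
    proof (rule lim_imp_Liminf)
      show "(\<lambda>k. ennreal ((norm (q (h k)))\<^sup>2)) \<longlonglongrightarrow> ennreal ((norm (q f - (\<Sum>e\<in>G n. inner (q f) e *\<^sub>R e)))\<^sup>2)"
        unfolding h_def q.diff q.sum q.scaleR by (intro tendsto_ennrealI tendsto_intros q_app_tendsto)
    qed simp
    also have "\<dots> \<le> ennreal ((\<delta> n)\<^sup>2)"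
      using G(3)[OF f] by (intro ennreal_leI power_mono) auto
    finally show ?thesis .
  qed
  have est1: "(\<integral>\<^sup>+x. ennreal \<bar>Y f x - Z n f x\<bar> \<partial>P) \<le> ennreal (\<delta> n)" if f: "f \<in> s n" for n f
  proof -
    \<comment> \<open>Weighted arithmetic-geometric mean, balanced so that each of the two terms
      contributes \<open>\<delta> n / 2\<close> after integration.\<close>
    have pt: "\<bar>u\<bar> \<le> \<delta> n / 2 + 1 / (2 * \<delta> n) * u\<^sup>2" for u
    proof -
      have "0 \<le> (\<delta> n - \<bar>u\<bar>)\<^sup>2" by simp
      then show ?thesis using \<delta>[of n] by (simp add: power2_diff field_simps power2_eq_square)
    qed
    have "(\<integral>\<^sup>+x. ennreal \<bar>Y f x - Z n f x\<bar> \<partial>P) \<le> (\<integral>\<^sup>+x. ennreal (\<delta> n / 2) + ennreal (1 / (2 * \<delta> n)) * ennreal ((Y f x - Z n f x)\<^sup>2) \<partial>P)"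
    proof (rule nn_integral_mono)
      fix x show "ennreal \<bar>Y f x - Z n f x\<bar> \<le> ennreal (\<delta> n / 2) + ennreal (1 / (2 * \<delta> n)) * ennreal ((Y f x - Z n f x)\<^sup>2)"
      proof -
        have "ennreal \<bar>Y f x - Z n f x\<bar> \<le> ennreal (\<delta> n / 2 + 1 / (2 * \<delta> n) * (Y f x - Z n f x)\<^sup>2)"
          by (intro ennreal_leI pt)
        also have "\<dots> = ennreal (\<delta> n / 2) + ennreal (1 / (2 * \<delta> n)) * ennreal ((Y f x - Z n f x)\<^sup>2)"
          using \<delta>[of n] by (simp add: ennreal_mult[symmetric] del: times_divide_eq_left)
        finally show ?thesis .
      qed
    qed
    also have "\<dots> = ennreal (\<delta> n / 2) + ennreal (1 / (2 * \<delta> n)) * (\<integral>\<^sup>+x. ennreal ((Y f x - Z n f x)\<^sup>2) \<partial>P)"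
      by (subst nn_integral_add) (auto simp: nn_integral_cmult P.emeasure_space_1)
    also have "\<dots> \<le> ennreal (\<delta> n / 2) + ennreal (1 / (2 * \<delta> n)) * ennreal ((\<delta> n)\<^sup>2)"
      by (intro add_mono mult_left_mono est2[OF f]) auto
    also have "\<dots> = ennreal (\<delta> n)"
      using \<delta>[of n] by (simp add: ennreal_mult[symmetric] ennreal_plus[symmetric] power2_eq_square del: ennreal_plus)
    finally show ?thesis .
  qed
  define r where "r n x = (\<Sum>f\<in>s n. \<bar>Y f x - Z n f x\<bar>)" for n x
  have [measurable]: "r n \<in> borel_measurable P" for n unfolding r_def by measurable
  have "AE x in P. (\<lambda>n. r n x) \<longlonglongrightarrow> 0"
  proof (rule AE_tendsto_0_of_summable(2)[where a = "\<lambda>n. (1/2)^n"])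
    fix n
    have "(\<integral>\<^sup>+x. ennreal \<bar>r n x\<bar> \<partial>P) = (\<Sum>f\<in>s n. \<integral>\<^sup>+x. ennreal \<bar>Y f x - Z n f x\<bar> \<partial>P)"
      by (subst nn_integral_sum[symmetric]) (auto simp: r_def sum_nonneg sum_ennreal)
    also have "\<dots> \<le> (\<Sum>f\<in>s n. ennreal (\<delta> n))" by (intro sum_mono est1)
    also have "\<dots> = ennreal (real (card (s n)) * \<delta> n)"
      using \<delta>[of n] by (simp add: ennreal_mult ennreal_of_nat_eq_real_of_nat)
    also have "\<dots> \<le> ennreal ((1/2)^n)"
    proof (rule ennreal_leI)
      have "real (card (s n)) * \<delta> n = (real (card (s n)) / (1 + real (card (s n)))) * (1/2)^n"
        by (simp add: \<delta>_def)
      also have "\<dots> \<le> 1 * (1/2)^n" by (intro mult_right_mono) simp_all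
      finally show "real (card (s n)) * \<delta> n \<le> (1/2)^n" by simp
    qed
    finally show "(\<integral>\<^sup>+x. ennreal \<bar>r n x\<bar> \<partial>P) \<le> ennreal ((1/2)^n)" .
  qed (auto intro: summable_geometric)
  then have "AE x in P. (\<lambda>n. m1 + (\<Sum>f\<in>s n. Z n f x *\<^sub>R f)) \<longlonglongrightarrow> x"
  proof eventually_elim
    case (elim x)
    have bd: "norm ((\<Sum>f\<in>s n. inner (x - m1) f *\<^sub>R f) - (\<Sum>f\<in>s n. Z n f x *\<^sub>R f)) \<le> r n x" for n
    proof -
      have "(\<Sum>f\<in>s n. inner (x - m1) f *\<^sub>R f) - (\<Sum>f\<in>s n. Z n f x *\<^sub>R f) = (\<Sum>f\<in>s n. (Y f x - Z n f x) *\<^sub>R f)"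
        by (simp add: Y_def inner_commute scaleR_diff_left sum_subtractf)
      also have "norm \<dots> \<le> (\<Sum>f\<in>s n. norm ((Y f x - Z n f x) *\<^sub>R f))" by (rule norm_sum)
      also have "\<dots> = r n x" unfolding r_def by (rule sum.cong) (use s(2) oE in \<open>auto simp: orthonormal_def\<close>)
      finally show ?thesis .
    qed
    have 1: "(\<lambda>n. (\<Sum>f\<in>s n. inner (x - m1) f *\<^sub>R f) - (\<Sum>f\<in>s n. Z n f x *\<^sub>R f)) \<longlonglongrightarrow> 0"
      by (rule Lim_null_comparison[OF _ elim]) (use bd in auto)
    have 2: "(\<lambda>n. \<Sum>f\<in>s n. inner (x - m1) f *\<^sub>R f) \<longlonglongrightarrow> x - m1"
      using onb_has_sum_expansion[OF E, of "x - m1"] s(3) unfolding has_sum_def by (rule filterlim_compose)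
    have "(\<lambda>n. m1 + ((\<Sum>f\<in>s n. inner (x - m1) f *\<^sub>R f) - ((\<Sum>f\<in>s n. inner (x - m1) f *\<^sub>R f) - (\<Sum>f\<in>s n. Z n f x *\<^sub>R f)))) \<longlonglongrightarrow> m1 + ((x - m1) - 0)"
      by (intro tendsto_intros 1 2)
    then show ?case by simp
  qed
  then show ?thesis unfolding Z_def by (rule that[OF G(1,2) s(1)])
qed

end

section \<open>Entropy in coordinates\<close>

context white_noise
begin

lemma cylinder_density:
  assumes P1: "second_order P1 K1 c1" "gaussian_char P1 K1 c1" and P2: "second_order P2 K2 c2" "gaussian_char P2 K2 c2"
    and K1: "\<And>e. e \<in> E \<Longrightarrow> K1 e = p e *\<^sub>R e" "\<And>e. e \<in> E \<Longrightarrow> 0 < p e"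
    and K2: "\<And>e. e \<in> E \<Longrightarrow> K2 e = r e *\<^sub>R e" "\<And>e. e \<in> E \<Longrightarrow> 0 < r e"
    and G: "finite G" "G \<subseteq> F" and F: "finite F" "F \<subseteq> E" and s: "finite s" and u: "u \<in> borel_measurable borel"
  shows "(\<integral>\<^sup>+x. ennreal (exp (u (m1 + (\<Sum>f\<in>s. (\<Sum>e\<in>G. inner (q f) e * W e x) *\<^sub>R f)) +
            (\<Sum>e\<in>F. normal_log_ratio (inner e c1) (p e) (inner e c2) (r e) (W e x)))) \<partial>P1)
       = (\<integral>\<^sup>+x. ennreal (exp (u (m1 + (\<Sum>f\<in>s. (\<Sum>e\<in>G. inner (q f) e * W e x) *\<^sub>R f)))) \<partial>P2)"
proof -
  define h where "h w = ennreal (exp (u (m1 + (\<Sum>f\<in>s. (\<Sum>e\<in>G. inner (q f) e * w e) *\<^sub>R f))))" for w :: "'a \<Rightarrow> real"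
  have "(\<lambda>w. w e) \<in> borel_measurable (PiM F (\<lambda>_. borel))" if "e \<in> G" for e
    using that G(2) by (intro measurable_component_singleton) auto
  then have "(\<lambda>w. m1 + (\<Sum>f\<in>s. (\<Sum>e\<in>G. inner (q f) e * w e) *\<^sub>R f)) \<in> borel_measurable (PiM F (\<lambda>_. borel))"
    by (intro borel_measurable_add borel_measurable_sum borel_measurable_scaleR borel_measurable_times borel_measurable_const) auto
  then have "(\<lambda>w. u (m1 + (\<Sum>f\<in>s. (\<Sum>e\<in>G. inner (q f) e * w e) *\<^sub>R f))) \<in> borel_measurable (PiM F (\<lambda>_. borel))"
    using u by (rule measurable_compose)
  then have hm: "h \<in> borel_measurable (PiM F (\<lambda>_. borel))" unfolding h_def by measurable
  have hW: "h (\<lambda>e\<in>F. W e x) = ennreal (exp (u (m1 + (\<Sum>f\<in>s. (\<Sum>e\<in>G. inner (q f) e * W e x) *\<^sub>R f))))" for x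
  proof -
    have "(\<Sum>e\<in>G. inner (q f) e * (\<lambda>e\<in>F. W e x) e) = (\<Sum>e\<in>G. inner (q f) e * W e x)" for f
      by (rule sum.cong) (use G in auto)
    then show ?thesis by (simp only: h_def)
  qed
  have pr: "prob_space P1" "prob_space P2" using P1(1) P2(1) by (auto simp: second_order_def)
  have "(\<integral>\<^sup>+x. h (\<lambda>e\<in>F. W e x) * ennreal (exp (\<Sum>e\<in>F. normal_log_ratio (inner e c1) (p e) (inner e c2) (r e) (W e x))) \<partial>P1)
       = (\<integral>\<^sup>+x. h (\<lambda>e\<in>F. W e x) \<partial>P2)"
    by (rule nn_integral_change_of_product_law[OF pr K1(2) K2(2)
          second_order_meas[OF P1(1) W_borel] second_order_meas[OF P2(1) W_borel]
          coordinates_char[OF P1 K1(1) less_imp_le[OF K1(2)]] coordinates_char[OF P2 K2(1) less_imp_le[OF K2(2)]] F hm])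
  then show ?thesis unfolding hW by (simp add: exp_add ennreal_mult)
qed

text \<open>The pair \<open>P1\<close>, \<open>P2\<close> is kept general so that it can be used in
  both orders. The separate \<open>\<mu>\<close> is the measure with standard coordinates for which
  \<open>reconstruction\<close> is proved; its null sets are transferred to
  \<open>P1\<close>.\<close>

lemma KL_coordinates_le:
  assumes P1: "second_order P1 K1 c1" "gaussian_char P1 K1 c1" and P2: "second_order P2 K2 c2" "gaussian_char P2 K2 c2"
    and K1: "\<And>e. e \<in> E \<Longrightarrow> K1 e = p e *\<^sub>R e" "\<And>e. e \<in> E \<Longrightarrow> 0 < p e"
    and K2: "\<And>e. e \<in> E \<Longrightarrow> K2 e = r e *\<^sub>R e" "\<And>e. e \<in> E \<Longrightarrow> 0 < r e"
    and \<mu>: "second_order \<mu> id 0" and ac\<mu>: "absolutely_continuous \<mu> P1"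
    and \<gamma>: "second_order \<gamma> A c"
    and ac: "absolutely_continuous P1 P2" "absolutely_continuous P2 P1" "absolutely_continuous P1 \<gamma>"
    and lim: "((\<lambda>F. \<Sum>e\<in>F. \<integral>x. normal_log_ratio (inner e c1) (p e) (inner e c2) (r e) (W e x) \<partial>\<gamma>) \<longlongrightarrow> l)
        (finite_subsets_at_top E)"
    and int: "\<And>e. e \<in> E \<Longrightarrow> integrable \<gamma> (\<lambda>x. normal_log_ratio (inner e c1) (p e) (inner e c2) (r e) (W e x))"
    and k: "KL \<gamma> P1 = ereal k"
  shows "KL \<gamma> P2 \<le> ereal (k - l)"
proof -
  obtain s :: "nat \<Rightarrow> 'a set" and G where G: "\<And>n. finite (G n)" "\<And>n. G n \<subseteq> E" "\<And>n. finite (s n)"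
    and rec: "AE x in \<mu>. (\<lambda>n. m1 + (\<Sum>f\<in>s n. (\<Sum>e\<in>G n. inner (q f) e * W e x) *\<^sub>R f)) \<longlonglongrightarrow> x"
    by (rule reconstruction[OF \<mu>]) blast
  have prob: "prob_space P1" "prob_space P2" "prob_space \<gamma>" and sets: "sets P1 = sets borel" "sets P2 = sets borel" "sets \<gamma> = sets borel" "sets \<mu> = sets borel"
    using P1(1) P2(1) \<gamma> \<mu> by (auto simp: second_order_def)
  let ?L = "\<lambda>F x. \<Sum>e\<in>F. normal_log_ratio (inner e c1) (p e) (inner e c2) (r e) (W e x)"
  show ?thesis
  proof (rule KL_change_of_reference_le[OF prob sets(1-3) ac, where E = E and L = ?L and
        \<Phi> = "\<lambda>n x. m1 + (\<Sum>f\<in>s n. (\<Sum>e\<in>G n. inner (q f) e * W e x) *\<^sub>R f)"])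
    show "(\<lambda>x. m1 + (\<Sum>f\<in>s n. (\<Sum>e\<in>G n. inner (q f) e * W e x) *\<^sub>R f)) \<in> borel_measurable borel" for n
      by (intro borel_measurable_add borel_measurable_sum borel_measurable_scaleR borel_measurable_times borel_measurable_const W_borel)
    show "AE x in P1. (\<lambda>n. m1 + (\<Sum>f\<in>s n. (\<Sum>e\<in>G n. inner (q f) e * W e x) *\<^sub>R f)) \<longlonglongrightarrow> x"
      by (rule AE_absolutely_continuous[OF ac\<mu> _ rec]) (simp add: sets)
    show "?L F \<in> borel_measurable borel" for F by measurable
    show "integrable \<gamma> (?L F)" if "finite F" "F \<subseteq> E" for F
      using that int by (intro Bochner_Integration.integrable_sum) auto
    have "\<forall>\<^sub>F F in finite_subsets_at_top E. (\<Sum>e\<in>F. \<integral>x. normal_log_ratio (inner e c1) (p e) (inner e c2) (r e) (W e x) \<partial>\<gamma>) = (\<integral>x. ?L F x \<partial>\<gamma>)"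
    proof (rule eventually_finite_subsets_at_top_weakI)
      fix F assume "finite F" "F \<subseteq> E"
      then show "(\<Sum>e\<in>F. \<integral>x. normal_log_ratio (inner e c1) (p e) (inner e c2) (r e) (W e x) \<partial>\<gamma>) = (\<integral>x. ?L F x \<partial>\<gamma>)"
        using int by (intro Bochner_Integration.integral_sum[symmetric]) auto
    qed
    with lim show "((\<lambda>F. \<integral>x. ?L F x \<partial>\<gamma>) \<longlongrightarrow> l) (finite_subsets_at_top E)"
      by (rule Lim_transform_eventually)
    show "KL \<gamma> P1 = ereal k" by (rule k)
    fix n
    show "\<forall>\<^sub>F F in finite_subsets_at_top E. \<forall>u C. u \<in> borel_measurable borel \<longrightarrow> (\<forall>x. \<bar>u x\<bar> \<le> C) \<longrightarrow>
      (\<integral>\<^sup>+x. ennreal (exp (u (m1 + (\<Sum>f\<in>s n. (\<Sum>e\<in>G n. inner (q f) e * W e x) *\<^sub>R f)) + ?L F x)) \<partial>P1)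
      = (\<integral>\<^sup>+x. ennreal (exp (u (m1 + (\<Sum>f\<in>s n. (\<Sum>e\<in>G n. inner (q f) e * W e x) *\<^sub>R f)))) \<partial>P2)"
      unfolding eventually_finite_subsets_at_top
    \<comment> \<open>The density identity holds as soon as \<open>F\<close> contains the
      coordinates that enter the reconstruction at stage \<open>n\<close>.\<close>
    proof (intro exI[of _ "G n"] conjI G(1,2) allI impI)
      fix F and u :: "'a \<Rightarrow> real" and C
      assume F: "finite F \<and> G n \<subseteq> F \<and> F \<subseteq> E" and u: "u \<in> borel_measurable borel"
      show "(\<integral>\<^sup>+x. ennreal (exp (u (m1 + (\<Sum>f\<in>s n. (\<Sum>e\<in>G n. inner (q f) e * W e x) *\<^sub>R f)) + ?L F x)) \<partial>P1)
        = (\<integral>\<^sup>+x. ennreal (exp (u (m1 + (\<Sum>f\<in>s n. (\<Sum>e\<in>G n. inner (q f) e * W e x) *\<^sub>R f)))) \<partial>P2)"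
        by (rule cylinder_density[OF P1 P2 K1 K2 G(1) _ _ _ G(3) u]) (use F in auto)
    qed
  qed
qed

lemma integral_normal_log_ratio:
  assumes \<gamma>: "second_order \<gamma> A c" and p: "0 < p" and r: "0 < r"
  shows "integrable \<gamma> (\<lambda>x. normal_log_ratio a p b r (W e x))"
    "(\<integral>x. normal_log_ratio a p b r (W e x) \<partial>\<gamma>) =
      (inner (A e) e + (inner e c - a)\<^sup>2) / (2 * p) - (inner (A e) e + (inner e c - b)\<^sup>2) / (2 * r) + ln p / 2 - ln r / 2"
proof -
  interpret \<gamma>: prob_space \<gamma> using \<gamma> by (simp add: second_order_def)
  note L = coordinate_limit[OF \<gamma>, of e]
  have eq: "normal_log_ratio a p b r w = (1/(2*p) - 1/(2*r)) * w\<^sup>2 + (b/r - a/p) * w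
      + (a\<^sup>2/(2*p) - b\<^sup>2/(2*r) + ln p / 2 - ln r / 2)" for w
    using p r unfolding normal_log_ratio_def by (simp add: power2_diff field_simps)
  show "integrable \<gamma> (\<lambda>x. normal_log_ratio a p b r (W e x))" unfolding eq using L(2,3) by simp
  have "(\<integral>x. normal_log_ratio a p b r (W e x) \<partial>\<gamma>)
     = (1/(2*p) - 1/(2*r)) * (inner (A e) e + (inner e c)\<^sup>2) + (b/r - a/p) * inner e c
      + (a\<^sup>2/(2*p) - b\<^sup>2/(2*r) + ln p / 2 - ln r / 2)"
    unfolding eq using L(2-5) by (simp add: \<gamma>.prob_space)
  also have "\<dots> = (inner (A e) e + (inner e c - a)\<^sup>2) / (2 * p) - (inner (A e) e + (inner e c - b)\<^sup>2) / (2 * r) + ln p / 2 - ln r / 2"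
    using p r by (simp add: power2_diff field_simps)
  finally show "(\<integral>x. normal_log_ratio a p b r (W e x) \<partial>\<gamma>) =
      (inner (A e) e + (inner e c - a)\<^sup>2) / (2 * p) - (inner (A e) e + (inner e c - b)\<^sup>2) / (2 * r) + ln p / 2 - ln r / 2" .
qed

text \<open>\<open>KL_coordinates_le\<close> is applied in both orders; exchanging the reference
  measures reverses the sign of every summand. Each application starts from one finite entropy and
  bounds the other, so the two are finite or infinite together.\<close>

theorem KL_coordinates:
  assumes \<mu>: "second_order \<mu> id 0" "gaussian_char \<mu> id 0" and \<nu>: "second_order \<nu> K b" "gaussian_char \<nu> K b"
    and K: "\<And>e. e \<in> E \<Longrightarrow> K e = \<kappa> e *\<^sub>R e" "\<And>e. e \<in> E \<Longrightarrow> 0 < \<kappa> e"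
    and \<gamma>: "second_order \<gamma> A c"
    and ac: "absolutely_continuous \<mu> \<nu>" "absolutely_continuous \<nu> \<mu>" "absolutely_continuous \<mu> \<gamma>"
    and sum: "((\<lambda>e. (inner (A e) e + (inner e c)\<^sup>2) / 2 - (inner (A e) e + (inner e c - inner e b)\<^sup>2) / (2 * \<kappa> e)
       - ln (\<kappa> e) / 2) has_sum l) E"
  shows "KL \<gamma> \<mu> = KL \<gamma> \<nu> + ereal l"
proof -
  have prob: "prob_space \<mu>" "prob_space \<nu>" "prob_space \<gamma>" and sets: "sets \<mu> = sets borel" "sets \<nu> = sets borel" "sets \<gamma> = sets borel"
    using \<mu>(1) \<nu>(1) \<gamma> by (auto simp: second_order_def)
  have ac\<gamma>: "absolutely_continuous \<nu> \<gamma>" using ac(2,3) by (auto simp: absolutely_continuous_def)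
  have ac\<mu>: "absolutely_continuous \<mu> \<mu>" by (simp add: absolutely_continuous_def)
  have I: "\<And>e. e \<in> E \<Longrightarrow> id e = 1 *\<^sub>R e" "\<And>e. e \<in> E \<Longrightarrow> (0::real) < 1" by simp_all
  let ?T = "\<lambda>e. (inner (A e) e + (inner e c)\<^sup>2) / 2 - (inner (A e) e + (inner e c - inner e b)\<^sup>2) / (2 * \<kappa> e) - ln (\<kappa> e) / 2"
  have T1: "(\<integral>x. normal_log_ratio (inner e 0) 1 (inner e b) (\<kappa> e) (W e x) \<partial>\<gamma>) = ?T e" if "e \<in> E" for e
    by (subst integral_normal_log_ratio(2)[OF \<gamma> _ K(2)[OF that]]) simp_all
  have T2: "(\<integral>x. normal_log_ratio (inner e b) (\<kappa> e) (inner e 0) 1 (W e x) \<partial>\<gamma>) = - ?T e" if "e \<in> E" for e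
    by (subst integral_normal_log_ratio(2)[OF \<gamma> K(2)[OF that]]) simp_all
  have 1: "KL \<gamma> \<nu> \<le> ereal (k - l)" if k: "KL \<gamma> \<mu> = ereal k" for k
  proof (rule KL_coordinates_le[OF \<mu> \<nu> I K \<mu>(1) ac\<mu> \<gamma> ac _ _ k])
    have "((\<lambda>e. \<integral>x. normal_log_ratio (inner e 0) 1 (inner e b) (\<kappa> e) (W e x) \<partial>\<gamma>) has_sum l) E"
      using has_sum_cong[THEN iffD2, OF T1 sum] .
    then show "((\<lambda>F. \<Sum>e\<in>F. \<integral>x. normal_log_ratio (inner e 0) 1 (inner e b) (\<kappa> e) (W e x) \<partial>\<gamma>) \<longlongrightarrow> l) (finite_subsets_at_top E)"
      unfolding has_sum_def .
    show "integrable \<gamma> (\<lambda>x. normal_log_ratio (inner e 0) 1 (inner e b) (\<kappa> e) (W e x))" if "e \<in> E" for e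
      by (rule integral_normal_log_ratio(1)[OF \<gamma> _ K(2)[OF that]]) simp
  qed
  have 2: "KL \<gamma> \<mu> \<le> ereal (k - (- l))" if k: "KL \<gamma> \<nu> = ereal k" for k
  proof (rule KL_coordinates_le[OF \<nu> \<mu> K I \<mu>(1) ac(1) \<gamma> ac(2,1) ac\<gamma> _ _ k])
    have S: "((\<lambda>e. - ?T e) has_sum - l) E" using sum by (simp only: has_sum_uminus minus_minus)
    have "((\<lambda>e. \<integral>x. normal_log_ratio (inner e b) (\<kappa> e) (inner e 0) 1 (W e x) \<partial>\<gamma>) has_sum - l) E"
      by (rule has_sum_cong[THEN iffD2, OF T2 S])
    then show "((\<lambda>F. \<Sum>e\<in>F. \<integral>x. normal_log_ratio (inner e b) (\<kappa> e) (inner e 0) 1 (W e x) \<partial>\<gamma>) \<longlongrightarrow> - l) (finite_subsets_at_top E)"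
      unfolding has_sum_def .
    show "integrable \<gamma> (\<lambda>x. normal_log_ratio (inner e b) (\<kappa> e) (inner e 0) 1 (W e x))" if "e \<in> E" for e
      by (rule integral_normal_log_ratio(1)[OF \<gamma> K(2)[OF that]]) simp
  qed
  have s: "sets \<gamma> = sets \<mu>" "sets \<gamma> = sets \<nu>" using sets by simp_all
  show ?thesis
  proof (rule KL_cases_real[OF prob(1,3) ac(3) s(1)]; rule KL_cases_real[OF prob(2,3) ac\<gamma> s(2)])
    fix k assume "KL \<gamma> \<mu> = \<infinity>" "KL \<gamma> \<nu> = ereal k"
    then show ?thesis using 2 by force
  next
    fix k assume "KL \<gamma> \<mu> = ereal k" "KL \<gamma> \<nu> = \<infinity>"
    then show ?thesis using 1 by force
  next
    fix k k' assume "KL \<gamma> \<mu> = ereal k" "KL \<gamma> \<nu> = ereal k'"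
    then show ?thesis using 1[of k] 2[of k'] by simp
  qed simp
qed

end

section \<open>Gaussian measures\<close>

lemma gaussian_measure_law:
  assumes "gaussian_measure M m C"
  shows "prob_space M" "sets M = sets borel" "op_pos C"
    "distr M borel (\<lambda>x. inner h x) = normal_law (inner m h) (inner (C h) h)"
  using assms by (auto simp: gaussian_measure_def normal_law_def)

lemma inner_borel [measurable]: "(\<lambda>x. inner h x) \<in> borel_measurable (borel :: 'a::{real_inner,polish_space} measure)"
  by (intro borel_measurable_continuous_onI continuous_intros)

lemma gaussian_measure_char:
  assumes G: "gaussian_measure M m C"
  shows "(CLINT x|M. iexp (inner h (x - a))) = exp (\<i> * of_real (inner h (m - a)) - of_real (inner (C h) h / 2))"
proof -
  note L = gaussian_measure_law[OF G]
  have [measurable]: "(\<lambda>x. inner h x) \<in> borel_measurable M" using measurable_cong_sets[OF L(2) refl] inner_borel by blast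
  have v: "0 \<le> inner (C h) h" by (rule op_posD(4)[OF L(3)])
  have "(CLINT x|M. iexp (inner h (x - a))) = (CLINT x|M. exp (\<i> * of_real (- inner h a)) * iexp (1 * inner h x))"
    by (rule Bochner_Integration.integral_cong) (auto simp: inner_diff_right algebra_simps simp flip: exp_add)
  also have "\<dots> = exp (\<i> * of_real (- inner h a)) * (CLINT x|M. iexp (1 * inner h x))" by simp
  also have "(CLINT x|M. iexp (1 * inner h x)) = char (distr M borel (\<lambda>x. inner h x)) 1"
    unfolding char_def by (subst integral_distr) auto
  also have "exp (\<i> * of_real (- inner h a)) * \<dots> = exp (\<i> * of_real (inner h (m - a)) - of_real (inner (C h) h / 2))"
    unfolding L(4) char_normal_law[OF v] exp_add[symmetric]
    by (simp add: inner_diff_right inner_commute algebra_simps)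
  finally show ?thesis .
qed

lemma gaussian_measure_moments:
  assumes G: "gaussian_measure M m C"
  shows "integrable M (\<lambda>x. (inner h (x - a))\<^sup>2)" "(\<integral>x. inner h (x - a) \<partial>M) = inner h (m - a)"
    "(\<integral>x. (inner h (x - a))\<^sup>2 \<partial>M) = inner (C h) h + (inner h (m - a))\<^sup>2"
proof -
  note L = gaussian_measure_law[OF G]
  interpret M: prob_space M by (rule L)
  have [measurable]: "(\<lambda>x. inner h x) \<in> borel_measurable M" using measurable_cong_sets[OF L(2) refl] inner_borel by blast
  have v: "0 \<le> inner (C h) h" by (rule op_posD(4)[OF L(3)])
  note N = normal_law_moments[OF v, of "inner m h", folded L(4)[of h]]
  have i1: "integrable M (\<lambda>x. inner h x)" using N(1) by (subst (asm) integrable_distr_eq) auto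
  have i2: "integrable M (\<lambda>x. (inner h x)\<^sup>2)" using N(2) by (subst (asm) integrable_distr_eq) auto
  have e1: "(\<integral>x. inner h x \<partial>M) = inner h m" using N(3) by (subst (asm) integral_distr) (auto simp: inner_commute[of m h])
  have e2: "(\<integral>x. (inner h x)\<^sup>2 \<partial>M) = inner (C h) h + (inner h m)\<^sup>2"
    using N(4) by (subst (asm) integral_distr) (auto simp: inner_commute[of m h])
  have sq: "(inner h (x - a))\<^sup>2 = (inner h x)\<^sup>2 - 2 * inner h a * inner h x + (inner h a)\<^sup>2" for x
    by (simp add: inner_diff_right power2_diff)
  show "integrable M (\<lambda>x. (inner h (x - a))\<^sup>2)" unfolding sq using i1 i2 by simp
  show "(\<integral>x. inner h (x - a) \<partial>M) = inner h (m - a)"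
    unfolding inner_diff_right using i1 e1 by (simp add: M.prob_space)
  show "(\<integral>x. (inner h (x - a))\<^sup>2 \<partial>M) = inner (C h) h + (inner h (m - a))\<^sup>2"
    unfolding sq using i1 i2 e1 e2 by (simp add: M.prob_space inner_diff_right power2_diff)
qed

lemma mean_cov_moments:
  fixes M :: "'a::{real_inner,polish_space} measure"
  assumes M: "prob_space M" "sets M = sets borel" and mc: "mean_cov M m R"
  shows "integrable M (\<lambda>x. (inner h (x - a))\<^sup>2)" "(\<integral>x. inner h (x - a) \<partial>M) = inner h (m - a)"
    "(\<integral>x. (inner h (x - a))\<^sup>2 \<partial>M) = inner (R h) h + (inner h (m - a))\<^sup>2"
proof -
  interpret M: prob_space M by (rule M)
  have hm [measurable]: "(\<lambda>x. inner h x) \<in> borel_measurable M" using measurable_cong_sets[OF M(2) refl] inner_borel by blast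
  have n: "integrable M (\<lambda>x. (norm x)\<^sup>2)" using mc by (simp add: mean_cov_def)
  have i2: "integrable M (\<lambda>x. (inner h x)\<^sup>2)"
  proof (rule Bochner_Integration.integrable_bound)
    show "integrable M (\<lambda>x. (norm h)\<^sup>2 * (norm x)\<^sup>2)" using n by simp
    have "(inner h x)\<^sup>2 \<le> (norm h)\<^sup>2 * (norm x)\<^sup>2" for x
      using Cauchy_Schwarz_ineq2[of h x] by (metis abs_ge_zero power2_abs power_mono power_mult_distrib)
    then show "AE x in M. norm ((inner h x)\<^sup>2) \<le> norm ((norm h)\<^sup>2 * (norm x)\<^sup>2)" by simp
  qed measurable
  have i1: "integrable M (\<lambda>x. inner h x)"
    by (rule M.square_integrable_imp_integrable[OF hm i2])
  have e1: "(\<integral>x. inner h x \<partial>M) = inner h m" using mc by (simp add: mean_cov_def)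
  have "(\<integral>x. (inner h (x - m))\<^sup>2 \<partial>M) = inner (R h) h" using mc by (simp add: mean_cov_def power2_eq_square)
  moreover have sq: "(inner h (x - a))\<^sup>2 = (inner h x)\<^sup>2 - 2 * inner h a * inner h x + (inner h a)\<^sup>2" for x a
    by (simp add: inner_diff_right power2_diff)
  ultimately have e2: "(\<integral>x. (inner h x)\<^sup>2 \<partial>M) = inner (R h) h + (inner h m)\<^sup>2"
    using i1 i2 e1 by (simp add: M.prob_space power2_eq_square)
  show "integrable M (\<lambda>x. (inner h (x - a))\<^sup>2)" unfolding sq using i1 i2 by simp
  show "(\<integral>x. inner h (x - a) \<partial>M) = inner h (m - a)"
    unfolding inner_diff_right using i1 e1 by (simp add: M.prob_space)
  show "(\<integral>x. (inner h (x - a))\<^sup>2 \<partial>M) = inner (R h) h + (inner h (m - a))\<^sup>2"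
    unfolding sq using i1 i2 e1 e2 by (simp add: M.prob_space inner_diff_right power2_diff)
qed

section \<open>The square root of a covariance operator\<close>

lemma op_selfadjD:
  assumes "op_selfadj T"
  shows "bounded_linear T" "inner (T x) y = inner x (T y)"
  using assms by (auto simp: op_selfadj_def)

lemma trace_class_sqrt:
  fixes Q :: "'a::{real_inner,polish_space} \<Rightarrow> 'a"
  assumes Q: "op_pos Q" "trace_class Q" and ker: "\<forall>x. Q x = 0 \<longrightarrow> x = 0"
  obtains E r where "onb E" "\<And>e. e \<in> E \<Longrightarrow> op_sqrt Q e = r e *\<^sub>R e" "\<And>e. e \<in> E \<Longrightarrow> 0 < r e"
    "op_pos (op_sqrt Q)" "\<And>x. op_sqrt Q (op_sqrt Q x) = Q x"
proof -
  obtain E where E: "onb E" and ev: "\<And>e. e \<in> E \<Longrightarrow> \<exists>l. Q e = l *\<^sub>R e"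
    using spectral_hilbert_schmidt[OF op_posD(2)[OF Q(1)] trace_class_op_pos_imp_hilbert_schmidt[OF Q]] by blast
  define l where "l e = inner (Q e) e" for e
  have e1: "inner e e = 1" if "e \<in> E" for e using orthonormal_inner[OF onb_imp_orthonormal[OF E] that that] by simp
  have Qe: "Q e = l e *\<^sub>R e" if "e \<in> E" for e using ev[OF that] e1[OF that] by (auto simp: l_def)
  have l0: "0 \<le> l e" for e unfolding l_def by (rule op_posD(4)[OF Q(1)])
  have lpos: "0 < l e" if e: "e \<in> E" for e
  proof (rule ccontr)
    assume "\<not> 0 < l e"
    then have "Q e = 0" using l0[of e] Qe[OF e] by simp
    then show False using ker e1[OF e] by fastforce
  qed
  interpret Q: bounded_linear Q by (rule op_posD(1)[OF Q(1)])
  obtain C where C: "\<And>x. norm (Q x) \<le> norm x * C" using Q.bounded by blast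
  have lC: "l e \<le> C" if e: "e \<in> E" for e
  proof -
    have "norm e = 1" using E e by (simp add: onb_def)
    then show ?thesis using norm_cauchy_schwarz[of "Q e" e] C[of e] by (simp add: l_def)
  qed
  have QE: "inner (Q x) e = l e * inner x e" if "e \<in> E" for x e
    using Qe[OF that] by (simp add: op_posD(3)[OF Q(1)])
  have sq: "op_sqrt Q = diag_op E (\<lambda>e. sqrt (l e))"
    by (rule op_sqrt_eq_diag_op[OF E l0 lC QE])
  have b: "\<bar>sqrt (l e)\<bar> \<le> sqrt C" if "e \<in> E" for e using lC[OF that] l0[of e] by simp
  have I: "inner (op_sqrt Q x) e = sqrt (l e) * inner x e" if "e \<in> E" for x e
    unfolding sq by (rule inner_diag_op[OF E b that])
  show ?thesis
  proof (rule that[OF E, of "\<lambda>e. sqrt (l e)"])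
    show "op_sqrt Q e = sqrt (l e) *\<^sub>R e" if "e \<in> E" for e unfolding sq by (rule diag_op_basis[OF E b that])
    show "0 < sqrt (l e)" if "e \<in> E" for e using lpos[OF that] by simp
    show "op_pos (op_sqrt Q)" unfolding sq
      by (rule op_pos_diag_op[OF E, where C = "sqrt C"]) (use lC l0 in auto)
    show "op_sqrt Q (op_sqrt Q x) = Q x" for x
      by (rule onb_eqI[OF E]) (simp add: I QE l0 mult.assoc[symmetric])
  qed
qed

lemma dense_range_of_eigenbasis:
  assumes q: "bounded_linear q" and E: "onb E" and qe: "\<And>e. e \<in> E \<Longrightarrow> q e = r e *\<^sub>R e" and r: "\<And>e. e \<in> E \<Longrightarrow> 0 < r e"
  shows "closure (range q) = UNIV"
proof -
  interpret q: bounded_linear q by (rule q)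
  have "e \<in> range q" if "e \<in> E" for e
    by (rule range_eqI[of _ _ "(1 / r e) *\<^sub>R e"]) (use qe[OF that] r[OF that] in \<open>simp add: q.scaleR\<close>)
  moreover have "subspace (range q)"
    by (intro linear_subspace_image subspace_UNIV q.linear_axioms)
  ultimately have "span E \<subseteq> range q" by (intro span_minimal) auto
  then have "closure (span E) \<subseteq> closure (range q)" by (rule closure_mono)
  then show ?thesis using E by (auto simp: onb_iff)
qed

text \<open>A preimage of \<open>d\<close> must have the coefficients
  \<open>inner d e / r e\<close>. Testing the bound on finite combinations \<open>h\<close> whose
  image \<open>q h\<close> has exactly these coefficients shows that their squares sum to at most
  \<open>C\<^sup>2\<close>.\<close>

lemma range_of_bounded_functional:
  fixes q :: "'a::{real_inner,polish_space} \<Rightarrow> 'a"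
  assumes q: "op_selfadj q" and E: "onb E" and qe: "\<And>e. e \<in> E \<Longrightarrow> q e = r e *\<^sub>R e" and r: "\<And>e. e \<in> E \<Longrightarrow> 0 < r e"
    and bd: "\<And>h. \<bar>inner h d\<bar> \<le> C * norm (q h)"
  shows "d \<in> range q"
proof -
  interpret q: bounded_linear q by (rule op_selfadjD(1)[OF q])
  have oE: "orthonormal E" by (rule onb_imp_orthonormal[OF E])
  define c where "c e = inner d e / r e" for e
  have "(\<Sum>e\<in>F. (c e)\<^sup>2) \<le> C\<^sup>2" if F: "finite F" "F \<subseteq> E" for F
  proof -
    define h where "h = (\<Sum>e\<in>F. (c e / r e) *\<^sub>R e)"
    define N where "N = (\<Sum>e\<in>F. (c e)\<^sup>2)"
    have "inner h d = (\<Sum>e\<in>F. (c e / r e) * inner e d)" by (simp add: h_def inner_sum_left)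
    also have "\<dots> = N" unfolding N_def
      by (rule sum.cong) (auto simp: c_def inner_commute power2_eq_square)
    finally have hd: "inner h d = N" .
    have "q h = (\<Sum>e\<in>F. c e *\<^sub>R e)" unfolding h_def q.sum q.scaleR
    proof (rule sum.cong[OF refl])
      fix e assume "e \<in> F"
      then have "e \<in> E" using F by auto
      then show "(c e / r e) *\<^sub>R q e = c e *\<^sub>R e" using qe[of e] r[of e] by simp
    qed
    then have qh: "(norm (q h))\<^sup>2 = N" using orthonormal_norm_sum[OF oE F, of c] by (simp add: N_def)
    have "N \<ge> 0" unfolding N_def by (rule sum_nonneg) simp
    have "N \<le> C * norm (q h)" using bd[of h] hd by simp
    then have "N\<^sup>2 \<le> (C * norm (q h))\<^sup>2" using \<open>N \<ge> 0\<close> by (intro power_mono) auto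
    also have "\<dots> = C\<^sup>2 * N" by (simp add: power_mult_distrib qh)
    finally have "N * N \<le> C\<^sup>2 * N" by (simp add: power2_eq_square)
    then show ?thesis using \<open>N \<ge> 0\<close> unfolding N_def[symmetric]
      by (cases "N = 0") auto
  qed
  then have "(\<lambda>e. (c e)\<^sup>2) summable_on E"
    by (intro nonneg_bdd_above_summable_on bdd_aboveI2[where M = "C\<^sup>2"]) auto
  from riesz_fischer[OF oE this]
  obtain b where "b \<in> closure (span E)" and b: "\<And>e. e \<in> E \<Longrightarrow> inner b e = c e"
    by blast
  have "q b = d"
  proof (rule onb_eqI[OF E])
    fix e assume e: "e \<in> E"
    have "inner (q b) e = inner b (q e)" by (rule op_selfadjD(2)[OF q])
    also have "\<dots> = inner d e" using qe[OF e] r[OF e] b[OF e] by (simp add: c_def)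
    finally show "inner (q b) e = inner d e" .
  qed
  then show ?thesis by auto
qed

section \<open>Consequences of equivalence\<close>

context white_noise
begin

text \<open>Otherwise there are \<open>h\<^sub>n\<close> with \<open>q h\<^sub>n \<rightarrow> 0\<close> rapidly, so that \<open>Y h\<^sub>n \<rightarrow> 0\<close> almost surely under
  both measures, although \<open>Y h\<^sub>n\<close> has mean \<open>\<pi>\<close> under \<open>\<nu>\<close>, where its characteristic function at
  \<open>1\<close> tends to \<open>exp (\<i> \<pi>) = -1\<close>.\<close>

lemma shift_bounded:
  assumes \<mu>: "second_order \<mu> id 0" and \<nu>: "prob_space \<nu>" "sets \<nu> = sets borel" and ac: "absolutely_continuous \<mu> \<nu>"
    and K: "bounded_linear K"
    and ch: "\<And>h. (CLINT x|\<nu>. iexp (Y h x)) = exp (\<i> * of_real (inner h d) - of_real (inner (K (q h)) (q h) / 2))"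
  shows "\<exists>C. \<forall>h. \<bar>inner h d\<bar> \<le> C * norm (q h)"
proof (rule ccontr)
  interpret K: bounded_linear K by (rule K)
  interpret q: bounded_linear q by (rule q_linear)
  interpret \<nu>: prob_space \<nu> by (rule \<nu>)
  assume "\<not> (\<exists>C. \<forall>h. \<bar>inner h d\<bar> \<le> C * norm (q h))"
  then have neg: "\<exists>h. \<bar>inner h d\<bar> > C * norm (q h)" for C by (auto simp: not_le)
  have "\<exists>h. inner h d = pi \<and> norm (q h) \<le> pi * (1/2)^n" for n
  proof -
    obtain h where h: "\<bar>inner h d\<bar> > 2^n * norm (q h)" using neg by blast
    have nz: "inner h d \<noteq> 0"
    proof
      assume "inner h d = 0"
      then have "2^n * norm (q h) < 0" using h by simp
      moreover have "0 \<le> 2^n * norm (q h)" by simp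
      ultimately show False by linarith
    qed
    let ?h = "(pi / inner h d) *\<^sub>R h"
    have "norm (q ?h) = pi * norm (q h) / \<bar>inner h d\<bar>" by (simp add: q.scaleR)
    also have "\<dots> \<le> pi * (1/2)^n"
    proof -
      have "norm (q h) * 2^n \<le> \<bar>inner h d\<bar>" using h by (simp add: mult.commute)
      then have "norm (q h) / \<bar>inner h d\<bar> \<le> (1/2)^n" using nz by (simp add: divide_simps power_divide)
      then have "pi * (norm (q h) / \<bar>inner h d\<bar>) \<le> pi * (1/2)^n" by (intro mult_left_mono) auto
      then show ?thesis by simp
    qed
    finally show ?thesis using nz by (intro exI[of _ ?h]) simp
  qed
  then have "\<forall>n. \<exists>h. inner h d = pi \<and> norm (q h) \<le> pi * (1/2)^n" by (rule allI)
  from choice[OF this] obtain h where H: "\<forall>n. inner (h n) d = pi \<and> norm (q (h n)) \<le> pi * (1/2)^n" by (rule exE)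
  have h: "\<And>n. inner (h n) d = pi" "\<And>n. norm (q (h n)) \<le> pi * (1/2)^n" by (simp_all only: H)
  have sm: "sets \<nu> = sets \<mu>" using \<mu> \<nu> by (simp add: second_order_def)
  have "AE x in \<nu>. (\<lambda>n. Y (h n) x) \<longlonglongrightarrow> 0"
    by (rule AE_absolutely_continuous[OF ac sm second_order_AE_tendsto_0[OF \<mu> h(2)]])
  then have lim: "AE x in \<nu>. (\<lambda>n. iexp (Y (h n) x)) \<longlonglongrightarrow> iexp 0"
    by eventually_elim (intro tendsto_intros)
  have [measurable]: "Y h \<in> borel_measurable \<nu>" for h
    unfolding measurable_cong_sets[OF \<nu>(2) refl] by (rule Y_borel)
  have "(\<lambda>n. CLINT x|\<nu>. iexp (Y (h n) x)) \<longlonglongrightarrow> (CLINT x|\<nu>. iexp 0)"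
    by (rule integral_dominated_convergence[where w = "\<lambda>_. 1"]) (use lim in auto)
  then have 1: "(\<lambda>n. CLINT x|\<nu>. iexp (Y (h n) x)) \<longlonglongrightarrow> 1" by (simp add: \<nu>.prob_space)
  have "(\<lambda>n. (1/2::real)^n) \<longlonglongrightarrow> 0" by (rule LIMSEQ_realpow_zero) simp_all
  from tendsto_mult_right_zero[OF this, of pi] have p0: "(\<lambda>n. pi * (1/2::real)^n) \<longlonglongrightarrow> 0" .
  have qh: "(\<lambda>n. q (h n)) \<longlonglongrightarrow> 0"
    by (rule Lim_null_comparison[OF _ p0]) (rule always_eventually, rule allI, rule h(2))
  have "(\<lambda>n. exp (\<i> * of_real pi - of_real (inner (K (q (h n))) (q (h n)) / 2))) \<longlonglongrightarrow> exp (\<i> * of_real pi - of_real (inner (K 0) 0 / 2))"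
    by (intro tendsto_intros qh K.tendsto) simp_all
  then have "(\<lambda>n. CLINT x|\<nu>. iexp (Y (h n) x)) \<longlonglongrightarrow> -1" unfolding ch h(1) by simp
  from LIMSEQ_unique[OF 1 this] show False by simp
qed

text \<open>If \<open>K e = 0\<close>, then linear functionals with \<open>q h \<rightarrow> e\<close> degenerate under \<open>\<nu>\<close>, but have
  asymptotically unit variance under \<open>\<mu>\<close>.\<close>

lemma no_degenerate_direction:
  assumes \<mu>: "prob_space \<mu>" "sets \<mu> = sets borel" and \<nu>: "sets \<nu> = sets borel" and ac: "absolutely_continuous \<nu> \<mu>"
    and K: "op_selfadj K" and e: "K e = 0" "norm e = 1"
    and mom: "\<And>h. integrable \<nu> (\<lambda>x. (inner h (x - m2))\<^sup>2)" "\<And>h. (\<integral>x. (inner h (x - m2))\<^sup>2 \<partial>\<nu>) = inner (K (q h)) (q h)"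
    and ch: "\<And>h. (CLINT x|\<mu>. iexp (inner h (x - m2))) = exp (\<i> * of_real (inner h d) - of_real (inner (q h) (q h) / 2))"
  shows False
proof -
  interpret K: bounded_linear K by (rule op_selfadjD(1)[OF K])
  interpret \<mu>: prob_space \<mu> by (rule \<mu>)
  obtain C where C: "0 \<le> C" "\<And>x. norm (K x) \<le> norm x * C" using K.nonneg_bounded by blast
  have b: "f \<in> borel_measurable \<mu>" "f \<in> borel_measurable \<nu>" if "f \<in> borel_measurable borel" for f :: "'a \<Rightarrow> real"
    using that measurable_cong_sets[OF \<mu>(2) refl] measurable_cong_sets[OF \<nu> refl] by blast+
  have ib: "(\<lambda>x. inner h (x - m2)) \<in> borel_measurable borel" for h
    by (intro borel_measurable_continuous_onI continuous_intros)
  note [measurable] = b(1)[OF ib] b(2)[OF ib]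
  have "AE x in \<nu>. (\<lambda>n. inner (app e n) (x - m2)) \<longlonglongrightarrow> 0"
  proof (rule AE_tendsto_0_of_L2[OF _ mom(1) _ C(1)])
    fix n
    let ?v = "q (app e n)"
    have "inner (K ?v) ?v = inner (K (?v - e)) (?v - e)"
      using e(1) op_selfadjD(2)[OF K, of ?v e] by (simp add: K.diff inner_diff_right)
    also have "\<dots> \<le> norm (K (?v - e)) * norm (?v - e)" by (rule norm_cauchy_schwarz)
    also have "\<dots> \<le> (norm (?v - e) * C) * norm (?v - e)" by (intro mult_right_mono C) auto
    also have "\<dots> = C * (norm (?v - e))\<^sup>2" by (simp add: power2_eq_square)
    also have "\<dots> \<le> C * ((1/2)^n)\<^sup>2" by (intro mult_left_mono power_mono app C) auto
    finally show "(\<integral>x. (inner (app e n) (x - m2))\<^sup>2 \<partial>\<nu>) \<le> C * (1/4)^n" unfolding mom(2) half_power_square .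
  qed measurable
  then have "AE x in \<mu>. (\<lambda>n. inner (app e n) (x - m2)) \<longlonglongrightarrow> 0"
    by (rule AE_absolutely_continuous[OF ac, rotated]) (simp add: \<mu> \<nu>)
  then have lim: "AE x in \<mu>. (\<lambda>n. iexp (inner (app e n) (x - m2))) \<longlonglongrightarrow> iexp 0"
    by eventually_elim (intro tendsto_intros)
  have "(\<lambda>n. CLINT x|\<mu>. iexp (inner (app e n) (x - m2))) \<longlonglongrightarrow> (CLINT x|\<mu>. iexp 0)"
    by (rule integral_dominated_convergence[where w = "\<lambda>_. 1"]) (use lim in auto)
  \<comment> \<open>Taking absolute values removes the phase produced by the shift \<open>d\<close>,
    which is not controlled here.\<close>
  then have "(\<lambda>n. norm (CLINT x|\<mu>. iexp (inner (app e n) (x - m2)))) \<longlonglongrightarrow> norm (CLINT x|\<mu>. iexp 0)"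
    by (rule tendsto_norm)
  moreover have "norm (CLINT x|\<mu>. iexp (inner h (x - m2))) = exp (- (inner (q h) (q h) / 2))" for h
    unfolding ch norm_exp_eq_Re by simp
  ultimately have 1: "(\<lambda>n. exp (- (inner (q (app e n)) (q (app e n)) / 2))) \<longlonglongrightarrow> 1" by (simp add: \<mu>.prob_space)
  have "(\<lambda>n. exp (- (inner (q (app e n)) (q (app e n)) / 2))) \<longlonglongrightarrow> exp (- (inner e e / 2))"
    by (intro tendsto_intros q_app_tendsto) simp_all
  from LIMSEQ_unique[OF 1 this] have "inner e e = 0" by simp
  then show False using e(2) by simp
qed

end

section \<open>Traces and determinants\<close>

text \<open>Since \<open>op_trace\<close> sums over an unspecified basis, its value on an eigenbasis
  is reached by writing the quadratic form of \<open>X\<close> through two Hilbert--Schmidt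
  operators.\<close>

lemma op_trace_hs_product:
  fixes T T' U U' X :: "'a::{real_inner,polish_space} \<Rightarrow> 'a"
  assumes E: "onb E" and adj: "\<And>x y. inner (T x) y = inner x (T' y)" "\<And>x y. inner (U x) y = inner x (U' y)"
    and hs: "(\<lambda>e. (norm (T e))\<^sup>2) summable_on E" "(\<lambda>e. (norm (U e))\<^sup>2) summable_on E"
    and X: "\<And>x. inner (X x) x = inner (T x) (U x)"
  shows "((\<lambda>e. inner (X e) e) has_sum op_trace X) E"
proof -
  let ?B = "SOME B :: 'a set. onb B"
  have B: "onb ?B" using E by (rule someI)
  obtain s where s: "((\<lambda>e. inner (T e) (U e)) has_sum s) E" "((\<lambda>e. inner (T e) (U e)) has_sum s) ?B"
    using hs_inner_basis_indep[OF E B adj hs] by blast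
  have "op_trace X = s" unfolding op_trace_def X using s(2) by (rule infsumI)
  then show ?thesis using s(1) by (simp add: X)
qed

text \<open>Both parts are \<open>ln t \<le> t - 1\<close>, at \<open>1 - s\<close> and at its
  reciprocal. Adding \<open>s\<close> cancels the linear term, so square summability of the
  eigenvalues suffices for the regularized logarithm.\<close>

lemma ln_one_minus_bound:
  fixes s :: real
  assumes "s < 1"
  shows "0 \<le> - (ln (1 - s) + s)" "- (ln (1 - s) + s) \<le> s\<^sup>2 / (1 - s)"
proof -
  show "0 \<le> - (ln (1 - s) + s)" using ln_le_minus_one[of "1 - s"] assms by simp
  have "ln (1 / (1 - s)) \<le> 1 / (1 - s) - 1" using assms by (intro ln_le_minus_one) simp
  then have "- ln (1 - s) \<le> s / (1 - s)" using assms by (simp add: ln_div field_simps)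
  then have "- (ln (1 - s) + s) \<le> s / (1 - s) - s" by simp
  also have "\<dots> = s\<^sup>2 / (1 - s)" using assms by (simp add: field_simps power2_eq_square)
  finally show "- (ln (1 - s) + s) \<le> s\<^sup>2 / (1 - s)" .
qed

text \<open>Outside a finite set the tail of the sum forces \<open>(s e)\<^sup>2 \<le> 1/4\<close>
  and hence a gap of at least 1/2; over the finite set a minimum is taken. The gap makes the inverse
  of \<open>I - S\<close> bounded.\<close>

lemma summable_square_gap:
  fixes s :: "'b \<Rightarrow> real"
  assumes sm: "(\<lambda>e. (s e)\<^sup>2) summable_on E" and lt: "\<And>e. e \<in> E \<Longrightarrow> s e < 1"
  obtains \<delta> where "0 < \<delta>" "\<And>e. e \<in> E \<Longrightarrow> \<delta> \<le> 1 - s e"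
proof -
  obtain t where t: "((\<lambda>e. (s e)\<^sup>2) has_sum t) E" using sm by (auto simp: summable_on_def)
  have "\<forall>\<^sub>F F in finite_subsets_at_top E. dist (\<Sum>e\<in>F. (s e)\<^sup>2) t < 1/4"
    by (rule t[unfolded has_sum_def tendsto_iff, rule_format]) simp
  then obtain F where F: "finite F" "F \<subseteq> E" "dist (\<Sum>e\<in>F. (s e)\<^sup>2) t < 1/4"
    unfolding eventually_finite_subsets_at_top by blast
  define \<delta> where "\<delta> = Min (insert (1/2) ((\<lambda>e. 1 - s e) ` F))"
  have "0 < \<delta>" unfolding \<delta>_def using F lt by (subst Min_gr_iff) auto
  moreover have "\<delta> \<le> 1 - s e" if e: "e \<in> E" for e
  proof (cases "e \<in> F")
    case True then show ?thesis unfolding \<delta>_def using F(1) by (intro Min_le) auto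
  next
    case False
    have "(\<Sum>e\<in>insert e F. (s e)\<^sup>2) \<le> t"
      by (rule finite_sum_le_has_sum[OF t]) (use F e in auto)
    then have "(s e)\<^sup>2 + (\<Sum>e\<in>F. (s e)\<^sup>2) \<le> t" using F(1) False by simp
    then have "(s e)\<^sup>2 \<le> 1/4" using F(3) unfolding dist_real_def by linarith
    then have "(s e)\<^sup>2 \<le> (1/2)\<^sup>2" by (simp add: power2_eq_square)
    then have "s e \<le> 1/2" by (rule power2_le_imp_le) simp
    moreover have "\<delta> \<le> 1/2" unfolding \<delta>_def using F(1) by (intro Min_le) auto
    ultimately show ?thesis by simp
  qed
  ultimately show ?thesis using that by blast
qed

section \<open>Equivalent Gaussian measures\<close>

locale equivalent_gaussians =
  fixes \<mu> \<nu> :: "'a::{real_inner,polish_space} measure" and m1 m2 :: 'a and Q R S :: "'a \<Rightarrow> 'a"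
  assumes mu: "gaussian_measure \<mu> m1 Q" and kerQ: "\<forall>x. Q x = 0 \<longrightarrow> x = 0"
    and nu: "gaussian_measure \<nu> m2 R"
    and ac: "absolutely_continuous \<mu> \<nu>" "absolutely_continuous \<nu> \<mu>"
    and S: "op_selfadj S" "hilbert_schmidt S"
    and R: "R = op_sqrt Q \<circ> (\<lambda>x. x - S x) \<circ> op_sqrt Q"
begin

abbreviation q :: "'a \<Rightarrow> 'a" where "q \<equiv> op_sqrt Q"
abbreviation K :: "'a \<Rightarrow> 'a" where "K \<equiv> \<lambda>x. x - S x"

lemma q_props:
  obtains E r where "onb E" "\<And>e. e \<in> E \<Longrightarrow> q e = r e *\<^sub>R e" "\<And>e. e \<in> E \<Longrightarrow> 0 < r e"
    "op_selfadj q" "\<And>x. q (q x) = Q x" "closure (range q) = UNIV"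
proof -
  have Q: "op_pos Q" "trace_class Q" using mu by (auto simp: gaussian_measure_def)
  show ?thesis
  proof (rule trace_class_sqrt[OF Q kerQ])
    fix E r
    assume *: "onb E" "\<And>e. e \<in> E \<Longrightarrow> q e = r e *\<^sub>R e" "\<And>e. e \<in> E \<Longrightarrow> 0 < r e" "op_pos q" "\<And>x. q (q x) = Q x"
    show ?thesis
      by (rule that[OF *(1-3) op_posD(2)[OF *(4)] *(5) dense_range_of_eigenbasis[OF op_posD(1)[OF *(4)] *(1-3)]])
  qed
qed

lemma q_selfadj: "op_selfadj q" and q_q: "q (q x) = Q x" and q_dense: "closure (range q) = UNIV"
  by (rule q_props; blast)+

lemma inj_q: "inj q"
proof (rule injI)
  fix x y assume "q x = q y"
  interpret q: bounded_linear q by (rule op_selfadjD(1)[OF q_selfadj])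
  have "q (x - y) = 0" using \<open>q x = q y\<close> by (simp add: q.diff)
  then have "Q (x - y) = 0" using q_q[of "x - y"] by (simp add: q.zero)
  then show "x = y" using kerQ[rule_format, of "x - y"] by simp
qed

lemma op_inv_q: "op_inv q (q b) = b"
  unfolding op_inv_def by (rule the_equality) (auto dest: injD[OF inj_q])

lemma S_linear: "bounded_linear S" and S_adj: "inner (S x) y = inner x (S y)"
  using S(1) by (auto simp: op_selfadj_def)

lemma K_selfadj: "op_selfadj K"
  unfolding op_selfadj_def
  by (auto intro!: bounded_linear_sub bounded_linear_ident S_linear simp: inner_diff_left inner_diff_right S_adj)

lemma inner_R: "inner (R h) h = inner (K (q h)) (q h)"
  by (simp add: R op_selfadjD(2)[OF q_selfadj])

lemma inner_Q: "inner (Q h) h = inner (q h) (q h)"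
  using op_selfadjD(2)[OF q_selfadj, of "q h" h] by (simp add: q_q)

definition b :: 'a where "b = op_inv q (m2 - m1)"

context
  fixes E
  assumes E: "onb E" and ev: "\<And>e. e \<in> E \<Longrightarrow> \<exists>l. S e = l *\<^sub>R e"
begin

interpretation white_noise m1 q E
  by unfold_locales (rule q_selfadj q_dense E)+

definition s :: "'a \<Rightarrow> real" where "s e = inner (S e) e"

lemma S_e: "e \<in> E \<Longrightarrow> S e = s e *\<^sub>R e"
  using ev[of e] orthonormal_inner[OF onb_imp_orthonormal[OF E], of e e] by (auto simp: s_def)

lemma inner_S: "e \<in> E \<Longrightarrow> inner (S x) e = s e * inner x e"
  by (simp add: S_adj S_e)

lemma mu_second_order: "second_order \<mu> id 0" and mu_char: "gaussian_char \<mu> id 0"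
  using gaussian_measure_moments[OF mu, of _ m1] gaussian_measure_law(1,2)[OF mu] gaussian_measure_char[OF mu, of _ m1]
  by (auto simp: second_order_def gaussian_char_def Y_def inner_Q bounded_linear_ident id_def)

text \<open>Positivity of the covariance of \<open>\<nu>\<close> carries over to \<open>K\<close>
  along \<open>q (app e k)\<close>, which tends to \<open>e\<close>, and excludes values above 1.
  The value 1 would make \<open>e\<close> a degenerate direction of \<open>\<nu>\<close>, against
  equivalence.\<close>

lemma s_lt_1:
  assumes e: "e \<in> E" shows "s e < 1"
proof -
  interpret K: bounded_linear K by (rule op_selfadjD(1)[OF K_selfadj])
  have n: "norm e = 1" "inner e e = 1" using E e by (auto simp: onb_def dot_square_norm)
  have "0 \<le> inner (K (q (app e k))) (q (app e k))" for k
    using op_posD(4)[OF gaussian_measure_law(3)[OF nu], of "app e k"] by (simp only: inner_R)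
  moreover have "(\<lambda>k. inner (K (q (app e k))) (q (app e k))) \<longlonglongrightarrow> inner (K e) e"
    by (intro tendsto_inner K.tendsto q_app_tendsto)
  ultimately have "0 \<le> inner (K e) e" by (intro LIMSEQ_le_const) auto
  then have le: "s e \<le> 1" using n by (simp add: inner_diff_left s_def)
  have "s e \<noteq> 1"
  proof
    assume "s e = 1"
    then have "K e = 0" using S_e[OF e] by simp
    then show False
    proof (rule no_degenerate_direction[OF gaussian_measure_law(1,2)[OF mu] gaussian_measure_law(2)[OF nu] ac(2) K_selfadj _ n(1)])
      show "integrable \<nu> (\<lambda>x. (inner h (x - m2))\<^sup>2)" for h by (rule gaussian_measure_moments(1)[OF nu])
      show "(\<integral>x. (inner h (x - m2))\<^sup>2 \<partial>\<nu>) = inner (K (q h)) (q h)" for h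
        using gaussian_measure_moments(3)[OF nu, of h m2] by (simp add: inner_R)
      show "(CLINT x|\<mu>. iexp (inner h (x - m2))) = exp (\<i> * of_real (inner h (m1 - m2)) - of_real (inner (q h) (q h) / 2))" for h
        using gaussian_measure_char[OF mu, of h m2] by (simp add: inner_Q)
    qed
  qed
  then show ?thesis using le by simp
qed

lemma mean_shift_in_range: "m2 - m1 \<in> range q"
proof -
  have "(CLINT x|\<nu>. iexp (Y h x)) = exp (\<i> * of_real (inner h (m2 - m1)) - of_real (inner (K (q h)) (q h) / 2))" for h
    using gaussian_measure_char[OF nu, of h m1] by (simp add: Y_def inner_R)
  then obtain C where C: "\<And>h. \<bar>inner h (m2 - m1)\<bar> \<le> C * norm (q h)"
    using shift_bounded[OF mu_second_order gaussian_measure_law(1,2)[OF nu] ac(1) op_selfadjD(1)[OF K_selfadj]] by blast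
  show ?thesis
    by (rule q_props) (rule range_of_bounded_functional[OF q_selfadj _ _ _ C])
qed

lemma q_b: "q b = m2 - m1"
  using mean_shift_in_range op_inv_q by (auto simp: b_def)

lemma second_orderI:
  assumes "prob_space P" "sets P = sets borel" "bounded_linear A"
    and "\<And>h. integrable P (\<lambda>x. (inner h (x - m1))\<^sup>2)" "\<And>h. (\<integral>x. inner h (x - m1) \<partial>P) = inner h (q c)"
      "\<And>h. (\<integral>x. (inner h (x - m1))\<^sup>2 \<partial>P) = inner (A (q h)) (q h) + (inner h (q c))\<^sup>2"
  shows "second_order P A c"
  using assms by (auto simp: second_order_def Y_def op_selfadjD(2)[OF q_selfadj])

lemma nu_second_order: "second_order \<nu> K b" and nu_char: "gaussian_char \<nu> K b"
proof -
  show "second_order \<nu> K b"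
    by (rule second_orderI[OF gaussian_measure_law(1,2)[OF nu] op_selfadjD(1)[OF K_selfadj]])
       (use gaussian_measure_moments[OF nu, of _ m1] in \<open>auto simp: q_b inner_R\<close>)
  show "gaussian_char \<nu> K b"
    using gaussian_measure_char[OF nu, of _ m1]
    by (auto simp: gaussian_char_def Y_def inner_R q_b op_selfadjD(2)[OF q_selfadj])
qed

section \<open>Spectral gap and regularized determinant\<close>

lemma s_summable: "(\<lambda>e. (s e)\<^sup>2) summable_on E"
proof -
  obtain B where B: "onb B" "(\<lambda>e. (norm (S e))\<^sup>2) summable_on B" using S(2) by (auto simp: hilbert_schmidt_def)
  then obtain t where "((\<lambda>e. (norm (S e))\<^sup>2) has_sum t) B" by (auto simp: summable_on_def)
  then have "((\<lambda>e. (norm (S e))\<^sup>2) has_sum t) E" by (rule hs_norm_basis_indep[OF B(1) E S_adj])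
  moreover have "(norm (S e))\<^sup>2 = (s e)\<^sup>2" if "e \<in> E" for e
    using E that by (simp add: S_e onb_def)
  ultimately show ?thesis by (metis (no_types, lifting) has_sum_cong summable_on_def)
qed

lemma gap: obtains \<delta> where "0 < \<delta>" "\<And>e. e \<in> E \<Longrightarrow> \<delta> \<le> 1 - s e"
  using summable_square_gap[OF s_summable s_lt_1] by metis

text \<open>The logarithm of the Hilbert--Carleman determinant of \<open>I - S\<close>, computed on
  the eigenbasis \<open>E\<close>; that it does not depend on \<open>E\<close> is settled in
  \<open>det2_eq\<close>.\<close>

definition D :: real where "D = infsum (\<lambda>e. ln (1 - s e) + s e) E"

lemma D_has_sum: "((\<lambda>e. ln (1 - s e) + s e) has_sum D) E"
proof -
  obtain \<delta> where \<delta>: "0 < \<delta>" "\<And>e. e \<in> E \<Longrightarrow> \<delta> \<le> 1 - s e" using gap by blast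
  have "(\<lambda>e. - (ln (1 - s e) + s e)) summable_on E"
  proof (rule summable_on_comparison_test[OF summable_on_cmult_right[OF s_summable, of "1/\<delta>"]])
    fix e assume e: "e \<in> E"
    show "0 \<le> - (ln (1 - s e) + s e)" by (rule ln_one_minus_bound(1)[OF s_lt_1[OF e]])
    have "- (ln (1 - s e) + s e) \<le> (s e)\<^sup>2 / (1 - s e)" by (rule ln_one_minus_bound(2)[OF s_lt_1[OF e]])
    also have "\<dots> \<le> (s e)\<^sup>2 / \<delta>" using \<delta>(1) \<delta>(2)[OF e] s_lt_1[OF e] by (intro divide_left_mono mult_pos_pos) auto
    finally show "- (ln (1 - s e) + s e) \<le> 1/\<delta> * (s e)\<^sup>2" by simp
  qed
  then have "(\<lambda>e. ln (1 - s e) + s e) summable_on E" by (subst (asm) summable_on_uminus) 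
  then show ?thesis unfolding D_def by (rule has_sum_infsum)
qed

lemma det_limit:
  "((\<lambda>F. \<Prod>e\<in>F. (1 + inner (- S e) e) * exp (- inner (- S e) e)) \<longlongrightarrow> exp D) (finite_subsets_at_top E)"
proof -
  have "((\<lambda>F. exp (\<Sum>e\<in>F. ln (1 - s e) + s e)) \<longlongrightarrow> exp D) (finite_subsets_at_top E)"
    using D_has_sum unfolding has_sum_def by (rule tendsto_exp)
  then show ?thesis
  proof (rule Lim_transform_eventually, intro eventually_finite_subsets_at_top_weakI)
    fix F assume F: "finite F" "F \<subseteq> E"
    have "exp (\<Sum>e\<in>F. ln (1 - s e) + s e) = (\<Prod>e\<in>F. exp (ln (1 - s e) + s e))" by (rule exp_sum[OF F(1)])
    also have "\<dots> = (\<Prod>e\<in>F. (1 + inner (- S e) e) * exp (- inner (- S e) e))"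
      by (rule prod.cong) (use F s_lt_1 in \<open>auto simp: exp_add s_def[symmetric]\<close>)
    finally show "exp (\<Sum>e\<in>F. ln (1 - s e) + s e) = (\<Prod>e\<in>F. (1 + inner (- S e) e) * exp (- inner (- S e) e))" .
  qed
qed

lemma K_e: "e \<in> E \<Longrightarrow> K e = (1 - s e) *\<^sub>R e" "e \<in> E \<Longrightarrow> 0 < 1 - s e"
  using S_e s_lt_1 by (auto simp: scaleR_diff_left)

text \<open>With equal means and covariances each summand of \<open>KL_coordinates\<close> reduces
  to half of \<open>(inner b e)\<^sup>2 - (ln (1 - s e) + s e)\<close>, and Parseval and
  \<open>D_has_sum\<close> give the sum. Taking \<open>\<gamma> = \<nu>\<close> evaluates
  \<open>KL \<nu> \<mu>\<close>.\<close>

lemma KL_matching_second_order: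
  assumes \<gamma>: "second_order \<gamma> K b" and ac\<gamma>: "absolutely_continuous \<mu> \<gamma>"
  shows "KL \<gamma> \<mu> = KL \<gamma> \<nu> + ereal (1/2 * (norm b)\<^sup>2 - 1/2 * D)"
proof -
  have "((\<lambda>e. 1/2 * (inner b e)\<^sup>2 + - (1/2 * (ln (1 - s e) + s e))) has_sum (1/2 * (norm b)\<^sup>2 + - (1/2 * D))) E"
    by (intro has_sum_add has_sum_uminus[THEN iffD2] has_sum_cmult_right onb_parseval[OF E])
       (simp only: minus_minus, rule has_sum_cmult_right[OF D_has_sum])
  then have "((\<lambda>e. (inner (K e) e + (inner e b)\<^sup>2) / 2 - (inner (K e) e + (inner e b - inner e b)\<^sup>2) / (2 * (1 - s e))
       - ln (1 - s e) / 2) has_sum (1/2 * (norm b)\<^sup>2 + - (1/2 * D))) E"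
  proof (rule has_sum_cong[THEN iffD1, rotated])
    fix e assume e: "e \<in> E"
    have "inner e e = 1" using E e by (auto simp: onb_def dot_square_norm)
    then have Kee: "inner (K e) e = 1 - s e" using K_e(1)[OF e] by simp
    show "1/2 * (inner b e)\<^sup>2 + - (1/2 * (ln (1 - s e) + s e)) =
      (inner (K e) e + (inner e b)\<^sup>2) / 2 - (inner (K e) e + (inner e b - inner e b)\<^sup>2) / (2 * (1 - s e)) - ln (1 - s e) / 2"
      unfolding Kee using s_lt_1[OF e] by (simp add: inner_commute[of e b] field_simps)
  qed
  from KL_coordinates[OF mu_second_order mu_char nu_second_order nu_char K_e \<gamma> ac ac\<gamma> this]
  show ?thesis by simp
qed

lemma KL_nu_mu: "KL \<nu> \<mu> = ereal (1/2 * (norm b)\<^sup>2 - 1/2 * D)"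
  using KL_matching_second_order[OF nu_second_order ac(1)] KL_refl[OF gaussian_measure_law(1)[OF nu]] by simp

lemma second_order_of_mean_cov:
  assumes "prob_space \<gamma>" "sets \<gamma> = sets borel" "mean_cov \<gamma> m3 R'"
    and "m3 - m1 = q c" and "bounded_linear A" and "\<And>h. inner (R' h) h = inner (A (q h)) (q h)"
  shows "second_order \<gamma> A c"
  by (rule second_orderI[OF assms(1,2,5)])
     (use mean_cov_moments[OF assms(1-3), of _ m1] assms(4,6) in auto)

lemma KL_matching_moments:
  assumes "prob_space \<gamma>" "sets \<gamma> = sets borel" "mean_cov \<gamma> m2 R" "absolutely_continuous \<mu> \<gamma>"
  shows "KL \<gamma> \<mu> = KL \<gamma> \<nu> + KL \<nu> \<mu>"
  unfolding KL_nu_mu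
  by (rule KL_matching_second_order[OF second_order_of_mean_cov[OF assms(1-3) q_b[symmetric]
        op_selfadjD(1)[OF K_selfadj] inner_R] assms(4)])

section \<open>The inverse of \<open>I - S\<close> and the trace term\<close>

definition V :: "'a \<Rightarrow> 'a" where "V = diag_op E (\<lambda>e. 1 / (1 - s e))"

lemma inner_V: "e \<in> E \<Longrightarrow> inner (V x) e = inner x e / (1 - s e)"
  and V_selfadj: "op_selfadj V"
proof -
  obtain \<delta> where \<delta>: "0 < \<delta>" "\<And>e. e \<in> E \<Longrightarrow> \<delta> \<le> 1 - s e" using gap by blast
  have bd: "\<bar>1 / (1 - s e)\<bar> \<le> 1 / \<delta>" if "e \<in> E" for e
    using \<delta>(1) \<delta>(2)[OF that] by (simp add: frac_le)
  show "e \<in> E \<Longrightarrow> inner (V x) e = inner x e / (1 - s e)" using inner_diag_op[OF E bd] by (simp add: V_def)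
  show "op_selfadj V" unfolding V_def by (rule op_selfadj_diag_op[OF E bd])
qed

lemma inner_K: "e \<in> E \<Longrightarrow> inner (K x) e = (1 - s e) * inner x e"
  by (simp add: inner_diff_left inner_S algebra_simps)

lemma op_inv_K: "op_inv K y = V y"
  unfolding op_inv_def
proof (rule the_equality)
  have "inner (K (V y)) e = inner y e" if "e \<in> E" for e
    using that s_lt_1[OF that] by (simp only: inner_K inner_V) simp
  then show "K (V y) = y" by (rule onb_eqI[OF E])
next
  fix x assume x: "K x = y"
  show "x = V y"
  proof (rule onb_eqI[OF E])
    fix e assume "e \<in> E"
    then show "inner x e = inner (V y) e" using inner_K[of e x] s_lt_1[of e] by (simp add: inner_V x)
  qed
qed

lemma norm_op_inv_sqrt_K: "((\<lambda>e. (inner x e)\<^sup>2 / (1 - s e)) has_sum (norm (op_inv (op_sqrt K) x))\<^sup>2) E"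
proof -
  obtain \<delta> where \<delta>: "0 < \<delta>" "\<And>e. e \<in> E \<Longrightarrow> \<delta> \<le> 1 - s e" using gap by blast
  interpret S: bounded_linear S by (rule S_linear)
  obtain C where C: "\<And>x. norm (S x) \<le> norm x * C" using S.bounded by blast
  have sC: "1 - s e \<le> 1 + C" if "e \<in> E" for e
  proof -
    have "norm e = 1" using E that by (simp add: onb_def)
    then have "\<bar>s e\<bar> \<le> C" using C[of e] S_e[OF that] by simp
    then show ?thesis by simp
  qed
  have s0: "0 \<le> 1 - s e" if "e \<in> E" for e using s_lt_1[OF that] by simp
  have sq: "op_sqrt K = diag_op E (\<lambda>e. sqrt (1 - s e))"
    by (rule op_sqrt_eq_diag_op[OF E s0 sC inner_K])
  have bd: "\<bar>sqrt (1 - s e)\<bar> \<le> sqrt (1 + C)" if "e \<in> E" for e using s0[OF that] sC[OF that] by simp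
  have I: "inner (op_sqrt K x) e = sqrt (1 - s e) * inner x e" if "e \<in> E" for x e
    unfolding sq by (rule inner_diag_op[OF E bd that])
  let ?z = "diag_op E (\<lambda>e. 1 / sqrt (1 - s e)) x"
  have bd': "\<bar>1 / sqrt (1 - s e)\<bar> \<le> 1 / sqrt \<delta>" if "e \<in> E" for e
    using \<delta>(1) \<delta>(2)[OF that] by (simp add: frac_le)
  have z: "inner ?z e = inner x e / sqrt (1 - s e)" if "e \<in> E" for e
    using inner_diag_op[OF E bd' that, where x = x] by simp
  have inv: "op_inv (op_sqrt K) x = ?z" unfolding op_inv_def
  proof (rule the_equality)
    show "op_sqrt K ?z = x"
    proof (rule onb_eqI[OF E])
      fix e assume e: "e \<in> E"
      then show "inner (op_sqrt K ?z) e = inner x e" using s_lt_1[OF e] by (simp add: I z)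
    qed
  next
    fix y assume y: "op_sqrt K y = x"
    show "y = ?z"
    proof (rule onb_eqI[OF E])
      fix e assume e: "e \<in> E"
      then show "inner y e = inner ?z e" using s_lt_1[OF e] I[OF e, of y] y by (simp add: z)
    qed
  qed
  have "(inner ?z e)\<^sup>2 = (inner x e)\<^sup>2 / (1 - s e)" if "e \<in> E" for e
    using s_lt_1[OF that] by (simp add: z[OF that] power_divide)
  from has_sum_cong[THEN iffD1, OF this onb_parseval[OF E]] show ?thesis unfolding inv by simp
qed

text \<open>The operator is a product of two Hilbert--Schmidt operators: \<open>S\<close> and
  \<open>I - V A = V ((I - A) - S)\<close> if \<open>I - A\<close> is Hilbert--Schmidt, and \<open>\<bar>S\<bar>\<^sup>1\<^sup>/\<^sup>2\<close> and
  \<open>sgn S \<bar>S\<bar>\<^sup>1\<^sup>/\<^sup>2 (I - V A)\<close> if \<open>S\<close> is trace class.\<close>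

lemma trace_has_sum:
  assumes A: "op_pos A" and alt: "trace_class S \<or> hilbert_schmidt (\<lambda>x. x - A x)"
  shows "((\<lambda>e. s e * (1 - inner (A e) e / (1 - s e))) has_sum op_trace (S \<circ> (\<lambda>x. x - V (A x)))) E"
proof -
  interpret A: bounded_linear A by (rule op_posD(1)[OF A])
  interpret V: bounded_linear V by (rule op_selfadjD(1)[OF V_selfadj])
  interpret S: bounded_linear S by (rule S_linear)
  note adjs = op_posD(3)[OF A] op_selfadjD(2)[OF V_selfadj] S_adj
  let ?K = "\<lambda>x. x - V (A x)" and ?K' = "\<lambda>x. x - A (V x)"
  have Kadj: "inner (?K x) y = inner x (?K' y)" for x y
    by (simp add: inner_diff_left inner_diff_right adjs)
  have Sn: "(norm (S e))\<^sup>2 = (s e)\<^sup>2" if "e \<in> E" for e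
    using E that by (simp add: S_e onb_def)
  have Ssm: "(\<lambda>e. (norm (S e))\<^sup>2) summable_on E"
    using s_summable summable_on_cong[of E "\<lambda>e. (norm (S e))\<^sup>2" "\<lambda>e. (s e)\<^sup>2"] Sn by simp
  have "((\<lambda>e. inner ((S \<circ> ?K) e) e) has_sum op_trace (S \<circ> ?K)) E"
    using alt
  proof
    assume "hilbert_schmidt (\<lambda>x. x - A x)"
    then obtain B where B: "onb B" "(\<lambda>e. (norm (e - A e))\<^sup>2) summable_on B" by (auto simp: hilbert_schmidt_def)
    then obtain t where t: "((\<lambda>e. (norm (e - A e))\<^sup>2) has_sum t) B" by (auto simp: summable_on_def)
    have "((\<lambda>e. (norm (e - A e))\<^sup>2) has_sum t) E"
      by (rule hs_norm_basis_indep[OF B(1) E _ t, where T' = "\<lambda>x. x - A x"]) (simp add: inner_diff_left inner_diff_right adjs)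
    then have IA: "(\<lambda>e. (norm (e - A e))\<^sup>2) summable_on E" by (auto simp: summable_on_def)
    obtain C where C: "\<And>x. norm (V x) \<le> norm x * C" using V.bounded by blast
    have KV: "?K x = V ((x - A x) - S x)" for x
    proof (rule onb_eqI[OF E])
      fix e assume e: "e \<in> E"
      show "inner (?K x) e = inner (V ((x - A x) - S x)) e"
        using s_lt_1[OF e] by (simp add: inner_diff_left inner_add_left inner_V[OF e] inner_S[OF e] field_simps)
    qed
    have Ksm: "(\<lambda>e. (norm (?K e))\<^sup>2) summable_on E"
    proof (rule summable_on_comparison_test)
      show "(\<lambda>e. C\<^sup>2 * (2 * (norm (e - A e))\<^sup>2 + 2 * (norm (S e))\<^sup>2)) summable_on E"
        by (intro summable_on_cmult_right summable_on_add IA Ssm)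
      fix e
      have "(norm (?K e))\<^sup>2 \<le> (norm ((e - A e) - S e) * C)\<^sup>2" unfolding KV by (intro power_mono C) simp
      also have "\<dots> = C\<^sup>2 * (norm ((e - A e) - S e))\<^sup>2" by (simp add: power_mult_distrib)
      also have "(norm ((e - A e) - S e))\<^sup>2 \<le> 2 * (norm (e - A e))\<^sup>2 + 2 * (norm (S e))\<^sup>2"
      proof -
        have "0 \<le> inner ((e - A e) + S e) ((e - A e) + S e)" by simp
        then show ?thesis unfolding power2_norm_eq_inner
          by (simp add: inner_add_left inner_add_right inner_diff_left inner_diff_right inner_commute)
      qed
      finally show "(norm (?K e))\<^sup>2 \<le> C\<^sup>2 * (2 * (norm (e - A e))\<^sup>2 + 2 * (norm (S e))\<^sup>2)"
        by (simp add: mult_left_mono)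
    qed simp
    show ?thesis
      by (rule op_trace_hs_product[OF E Kadj S_adj Ksm Ssm]) (simp add: S_adj)
  next
    assume tr: "trace_class S"
    obtain C where C: "\<And>x. norm (S x) \<le> norm x * C" using S.bounded by blast
    have sC: "\<bar>s e\<bar> \<le> C" if "e \<in> E" for e
    proof -
      have "norm e = 1" using E that by (simp add: onb_def)
      then show ?thesis using C[of e] S_e[OF that] by simp
    qed
    define S1 where "S1 = diag_op E (\<lambda>e. sqrt \<bar>s e\<bar>)"
    define S2 where "S2 = diag_op E (\<lambda>e. sgn (s e) * sqrt \<bar>s e\<bar>)"
    have b1: "\<bar>sqrt \<bar>s e\<bar>\<bar> \<le> sqrt C" if "e \<in> E" for e using sC[OF that] by simp
    have b2: "\<bar>sgn (s e) * sqrt \<bar>s e\<bar>\<bar> \<le> sqrt C" if "e \<in> E" for e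
      using sC[OF that] by (auto simp: abs_mult sgn_if)
    have I1: "inner (S1 x) e = sqrt \<bar>s e\<bar> * inner x e" if "e \<in> E" for x e
      unfolding S1_def by (rule inner_diag_op[OF E b1 that])
    have I2: "inner (S2 x) e = sgn (s e) * sqrt \<bar>s e\<bar> * inner x e" if "e \<in> E" for x e
      unfolding S2_def by (rule inner_diag_op[OF E b2 that])
    have sa1: "op_selfadj S1" and sa2: "op_selfadj S2"
      unfolding S1_def S2_def by (rule op_selfadj_diag_op[OF E b1] op_selfadj_diag_op[OF E b2], assumption)+
    note adj12 = op_selfadjD(2)[OF sa1] op_selfadjD(2)[OF sa2]
    have S12: "S x = S1 (S2 x)" for x
    proof (rule onb_eqI[OF E])
      fix e assume e: "e \<in> E"
      have "sqrt \<bar>s e\<bar> * (sgn (s e) * sqrt \<bar>s e\<bar>) = s e" by (simp add: mult.left_commute sgn_mult_abs)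
      then show "inner (S x) e = inner (S1 (S2 x)) e"
        by (simp add: I1[OF e] I2[OF e] inner_S[OF e] mult.assoc[symmetric])
    qed
    have "op_sqrt (op_adj S \<circ> S) = diag_op E (\<lambda>e. sqrt ((s e)\<^sup>2))"
    proof (rule op_sqrt_eq_diag_op[OF E])
      show "(s e)\<^sup>2 \<le> C\<^sup>2" if "e \<in> E" for e
        using sC[OF that] by (metis abs_ge_zero power2_abs power_mono)
      show "inner ((op_adj S \<circ> S) x) e = (s e)\<^sup>2 * inner x e" if "e \<in> E" for e x
        unfolding op_adj_selfadj[OF S(1)] by (simp add: inner_S[OF that] power2_eq_square)
    qed simp
    then have abs_S: "op_sqrt (op_adj S \<circ> S) = diag_op E (\<lambda>e. \<bar>s e\<bar>)" by simp
    \<comment> \<open>The trace condition on \<open>S\<close> thereby becomes the Hilbert--Schmidt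
      condition on \<open>S1\<close>, which can be moved from the basis \<open>B\<close> to
      \<open>E\<close>.\<close>
    have absS1: "inner (op_sqrt (op_adj S \<circ> S) x) x = (norm (S1 x))\<^sup>2" for x
    proof -
      have "op_sqrt (op_adj S \<circ> S) x = S1 (S1 x)" unfolding abs_S
      proof (rule onb_eqI[OF E])
        fix e assume e: "e \<in> E"
        have "inner (diag_op E (\<lambda>e. \<bar>s e\<bar>) x) e = \<bar>s e\<bar> * inner x e"
          by (rule inner_diag_op[OF E _ e, where C = C]) (simp add: sC)
        then show "inner (diag_op E (\<lambda>e. \<bar>s e\<bar>) x) e = inner (S1 (S1 x)) e"
          by (simp add: I1[OF e] mult.assoc[symmetric])
      qed
      then show ?thesis by (simp add: adj12 power2_norm_eq_inner)
    qed
    obtain B where B: "onb B" "(\<lambda>e. inner (op_sqrt (op_adj S \<circ> S) e) e) summable_on B"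
      using tr unfolding trace_class_def by blast
    then obtain t where t: "((\<lambda>e. (norm (S1 e))\<^sup>2) has_sum t) B" unfolding absS1 summable_on_def by blast
    have "((\<lambda>e. (norm (S1 e))\<^sup>2) has_sum t) E" by (rule hs_norm_basis_indep[OF B(1) E adj12(1) t])
    then have S1sm: "(\<lambda>e. (norm (S1 e))\<^sup>2) summable_on E" by (auto simp: summable_on_def)
    have n12: "norm (S2 e) \<le> norm (S1 e)" if "e \<in> E" for e
    proof -
      have "S1 e = sqrt \<bar>s e\<bar> *\<^sub>R e" unfolding S1_def by (rule diag_op_basis[OF E b1 that])
      moreover have "S2 e = (sgn (s e) * sqrt \<bar>s e\<bar>) *\<^sub>R e" unfolding S2_def by (rule diag_op_basis[OF E b2 that])
      ultimately show ?thesis using E that by (auto simp: onb_def abs_mult sgn_if)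
    qed
    have blK': "bounded_linear ?K'"
      by (intro bounded_linear_sub bounded_linear_ident bounded_linear_compose[OF A.bounded_linear_axioms V.bounded_linear_axioms])
    then obtain C' where C': "\<And>x. norm (?K' x) \<le> norm x * C'" using bounded_linear.bounded by blast
    \<comment> \<open>Summability for \<open>S2 \<circ> ?K\<close> is proved through its adjoint,
      where the bounded factor is applied last and can be estimated term by term.\<close>
    have "(\<lambda>e. (norm (?K' (S2 e)))\<^sup>2) summable_on E"
    proof (rule summable_on_comparison_test[OF summable_on_cmult_right[OF S1sm, of "C'\<^sup>2"]])
      fix e assume e: "e \<in> E"
      have "(norm (?K' (S2 e)))\<^sup>2 \<le> (norm (S2 e) * C')\<^sup>2" by (intro power_mono C') simp
      also have "\<dots> = C'\<^sup>2 * (norm (S2 e))\<^sup>2" by (simp add: power_mult_distrib)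
      also have "\<dots> \<le> C'\<^sup>2 * (norm (S1 e))\<^sup>2" by (intro mult_left_mono power_mono n12 e) auto
      finally show "(norm (?K' (S2 e)))\<^sup>2 \<le> C'\<^sup>2 * (norm (S1 e))\<^sup>2" .
    qed simp
    then obtain t' where t': "((\<lambda>e. (norm (?K' (S2 e)))\<^sup>2) has_sum t') E" by (auto simp: summable_on_def)
    have adjT: "inner (S2 (?K x)) y = inner x (?K' (S2 y))" for x y by (simp only: adj12 Kadj)
    have "((\<lambda>e. (norm (S2 (?K e)))\<^sup>2) has_sum t') E"
      by (rule hs_norm_adjoint[OF E E _ t', where T' = "\<lambda>x. S2 (?K x)"]) (metis adjT inner_commute)
    then have Tsm: "(\<lambda>e. (norm (S2 (?K e)))\<^sup>2) summable_on E" by (auto simp: summable_on_def)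
    show ?thesis
      by (rule op_trace_hs_product[OF E adjT adj12(1) Tsm S1sm]) (simp only: o_apply S12 adj12(1))
  qed
  moreover have "inner ((S \<circ> ?K) e) e = s e * (1 - inner (A e) e / (1 - s e))" if e: "e \<in> E" for e
  proof -
    have "inner e e = 1" using E e by (auto simp: onb_def dot_square_norm)
    then show ?thesis by (simp add: inner_S[OF e] inner_diff_left inner_V[OF e])
  qed
  ultimately show ?thesis by (rule has_sum_cong[THEN iffD1, rotated])
qed

text \<open>All five correction terms are expanded on the same eigenbasis, and the sum of the five
  series agrees term by term with the series in \<open>KL_coordinates\<close>.\<close>

lemma KL_formula:
  assumes \<gamma>: "prob_space \<gamma>" "sets \<gamma> = sets borel" "mean_cov \<gamma> m3 R'" and ac\<gamma>: "absolutely_continuous \<mu> \<gamma>"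
    and c: "m3 - m1 = q c" and A: "op_pos A" and R': "R' = q \<circ> A \<circ> q"
    and alt: "trace_class S \<or> hilbert_schmidt (\<lambda>x. x - A x)"
  shows "KL \<gamma> \<mu> = KL \<gamma> \<nu> + ereal (- (1/2 * (norm (op_inv (op_sqrt K) b))\<^sup>2) - 1/2 * inner (S (V c)) c
     + inner (V b) c + 1/2 * op_trace (S \<circ> (\<lambda>x. x - V (A x))) - 1/2 * D)"
proof -
  have \<gamma>2: "second_order \<gamma> A c"
    by (rule second_order_of_mean_cov[OF \<gamma> c op_posD(1)[OF A]]) (simp add: R' op_selfadjD(2)[OF q_selfadj])
  have 1: "((\<lambda>e. inner (S (V c)) e * inner c e) has_sum inner (S (V c)) c) E"
    by (rule onb_parseval_inner[OF E])
  have 2: "((\<lambda>e. inner (V b) e * inner c e) has_sum inner (V b) c) E"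
    by (rule onb_parseval_inner[OF E])
  have "((\<lambda>e. (- (1/2)) * ((inner b e)\<^sup>2 / (1 - s e)) + ((- (1/2)) * (inner (S (V c)) e * inner c e)
       + (inner (V b) e * inner c e + (1/2 * (s e * (1 - inner (A e) e / (1 - s e))) + (- (1/2)) * (ln (1 - s e) + s e)))))
     has_sum ((- (1/2)) * (norm (op_inv (op_sqrt K) b))\<^sup>2 + ((- (1/2)) * inner (S (V c)) c
       + (inner (V b) c + (1/2 * op_trace (S \<circ> (\<lambda>x. x - V (A x))) + (- (1/2)) * D))))) E"
    by (rule has_sum_add[OF has_sum_cmult_right[OF norm_op_inv_sqrt_K]
          has_sum_add[OF has_sum_cmult_right[OF 1] has_sum_add[OF 2
          has_sum_add[OF has_sum_cmult_right[OF trace_has_sum[OF A alt]] has_sum_cmult_right[OF D_has_sum]]]]])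
  then have "((\<lambda>e. (inner (A e) e + (inner e c)\<^sup>2) / 2 - (inner (A e) e + (inner e c - inner e b)\<^sup>2) / (2 * (1 - s e))
       - ln (1 - s e) / 2) has_sum ((- (1/2)) * (norm (op_inv (op_sqrt K) b))\<^sup>2 + ((- (1/2)) * inner (S (V c)) c
       + (inner (V b) c + (1/2 * op_trace (S \<circ> (\<lambda>x. x - V (A x))) + (- (1/2)) * D))))) E"
  proof (rule has_sum_cong[THEN iffD1, rotated])
    fix e assume e: "e \<in> E"
    define \<kappa> where "\<kappa> = 1 - s e"
    have \<kappa>: "0 < \<kappa>" "s e = 1 - \<kappa>" using s_lt_1[OF e] by (auto simp: \<kappa>_def)
    show "(- (1/2)) * ((inner b e)\<^sup>2 / (1 - s e)) + ((- (1/2)) * (inner (S (V c)) e * inner c e)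
       + (inner (V b) e * inner c e + (1/2 * (s e * (1 - inner (A e) e / (1 - s e))) + (- (1/2)) * (ln (1 - s e) + s e))))
      = (inner (A e) e + (inner e c)\<^sup>2) / 2 - (inner (A e) e + (inner e c - inner e b)\<^sup>2) / (2 * (1 - s e)) - ln (1 - s e) / 2"
      unfolding inner_S[OF e] inner_V[OF e] \<kappa>_def[symmetric] inner_commute[of e b] inner_commute[of e c] \<kappa>(2)
      using \<kappa>(1) by (simp add: field_simps power2_eq_square)
  qed
  from KL_coordinates[OF mu_second_order mu_char nu_second_order nu_char K_e \<gamma>2 ac ac\<gamma> this]
  show ?thesis by (simp add: algebra_simps)
qed

end

text \<open>The product does not depend on the eigenbasis, because \<open>KL \<nu> \<mu>\<close> determines it.\<close>

lemma det2_eq: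
  assumes E: "onb E" and ev: "\<And>e. e \<in> E \<Longrightarrow> \<exists>l. S e = l *\<^sub>R e"
  shows "det2_id_plus (\<lambda>x. - S x) = exp (D E)"
proof -
  let ?P = "\<lambda>d. \<exists>E. onb E \<and> (\<forall>e\<in>E. \<exists>l. - S e = l *\<^sub>R e) \<and>
     ((\<lambda>F. \<Prod>e\<in>F. (1 + inner (- S e) e) * exp (- inner (- S e) e)) \<longlongrightarrow> d) (finite_subsets_at_top E)"
  have "\<exists>l. - S e = l *\<^sub>R e" if "e \<in> E" for e using ev[OF that] by (metis scaleR_minus_left)
  then have ex: "?P (exp (D E))"
    by (intro exI[of _ E] conjI ballI E det_limit[OF E ev])
  have un: "d = exp (D E)" if P: "?P d" for d
  proof -
    obtain E' where E': "onb E'" "\<forall>e\<in>E'. \<exists>l. - S e = l *\<^sub>R e"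
      "((\<lambda>F. \<Prod>e\<in>F. (1 + inner (- S e) e) * exp (- inner (- S e) e)) \<longlongrightarrow> d) (finite_subsets_at_top E')"
      using P by blast
    have ev': "\<exists>l. S e = l *\<^sub>R e" if "e \<in> E'" for e
      using E'(2) that by (metis minus_minus scaleR_minus_left)
    have "d = exp (D E')"
      by (rule tendsto_unique[OF _ E'(3) det_limit[OF E'(1) ev']]) simp
    moreover have "D E' = D E"
      using KL_nu_mu[OF E ev] KL_nu_mu[OF E'(1) ev'] by simp
    ultimately show ?thesis by simp
  qed
  show ?thesis unfolding det2_id_plus_def by (rule the_equality[where P = ?P, OF ex un])
qed

end

theorem mainTheorem2:
  fixes \<mu> \<nu> \<gamma> :: "'a::{real_inner,polish_space} measure"
    and m1 m2 m3 :: 'a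
    and Q R\<^sub>\<nu> R\<^sub>\<gamma> S A :: "'a \<Rightarrow> 'a"
  assumes mu: "gaussian_measure \<mu> m1 Q"
    and kerQ: "\<forall>x. Q x = 0 \<longrightarrow> x = 0"
    and nu: "gaussian_measure \<nu> m2 R\<^sub>\<nu>"
    and equiv: "absolutely_continuous \<mu> \<nu>" "absolutely_continuous \<nu> \<mu>"
    and S: "op_selfadj S" "hilbert_schmidt S"
    and Rnu: "R\<^sub>\<nu> = op_sqrt Q \<circ> (\<lambda>x. x - S x) \<circ> op_sqrt Q"
    and gam: "prob_space \<gamma>" "sets \<gamma> = sets borel" "mean_cov \<gamma> m3 R\<^sub>\<gamma>"
    and gam_ac: "absolutely_continuous \<mu> \<gamma>"
    and m3: "m3 - m1 \<in> range (op_sqrt Q)"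
    and A: "op_pos A"
    and Rgam: "R\<^sub>\<gamma> = op_sqrt Q \<circ> A \<circ> op_sqrt Q"
    and alt: "trace_class S \<or> hilbert_schmidt (\<lambda>x. x - A x)"
  shows "KL \<gamma> \<mu> = KL \<gamma> \<nu>
      - ereal (1/2 * (norm (op_inv (op_sqrt (\<lambda>x. x - S x)) (op_inv (op_sqrt Q) (m2 - m1))))\<^sup>2)
      - ereal (1/2 * inner (S (op_inv (\<lambda>x. x - S x) (op_inv (op_sqrt Q) (m3 - m1))))
                           (op_inv (op_sqrt Q) (m3 - m1)))
      + ereal (inner (op_inv (\<lambda>x. x - S x) (op_inv (op_sqrt Q) (m2 - m1)))
                     (op_inv (op_sqrt Q) (m3 - m1)))
      + ereal (1/2 * op_trace (S \<circ> (\<lambda>x. x - op_inv (\<lambda>y. y - S y) (A x))))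
      - ereal (1/2 * ln (det2_id_plus (\<lambda>x. - S x)))
    \<and> (m3 = m2 \<and> A = (\<lambda>x. x - S x) \<longrightarrow>
         KL \<gamma> \<mu> = KL \<gamma> \<nu> + ereal (1/2 * (norm (op_inv (op_sqrt Q) (m2 - m1)))\<^sup>2)
                   - ereal (1/2 * ln (det2_id_plus (\<lambda>x. - S x)))
       \<and> KL \<gamma> \<nu> + ereal (1/2 * (norm (op_inv (op_sqrt Q) (m2 - m1)))\<^sup>2)
                   - ereal (1/2 * ln (det2_id_plus (\<lambda>x. - S x))) = KL \<gamma> \<nu> + KL \<nu> \<mu>
       \<and> KL \<nu> \<mu> \<le> KL \<gamma> \<mu>
       \<and> (KL \<gamma> \<mu> = KL \<nu> \<mu> \<longleftrightarrow> \<gamma> = \<nu>))"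
proof -
  interpret equivalent_gaussians \<mu> \<nu> m1 m2 Q R\<^sub>\<nu> S
    by unfold_locales (use mu kerQ nu equiv S Rnu in auto)
  obtain E where E: "onb E" and ev: "\<And>e. e \<in> E \<Longrightarrow> \<exists>l. S e = l *\<^sub>R e"
    using spectral_hilbert_schmidt[OF S] by blast
  obtain c where c: "m3 - m1 = q c" using m3 by blast
  have ic: "op_inv q (m3 - m1) = c" unfolding c by (rule op_inv_q)
  have "det2_id_plus (\<lambda>x. - S x) = exp (D E)" by (rule det2_eq[OF E ev])
  then have ln_det: "ln (det2_id_plus (\<lambda>x. - S x)) = D E" by simp
  have iK: "op_inv K = V E" using op_inv_K[OF E ev] by (intro ext)
  let ?N = "1/2 * (norm (op_inv (op_sqrt K) b))\<^sup>2" and ?P = "1/2 * inner (S (V E c)) c" and ?R = "inner (V E b) c"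
  let ?T = "1/2 * op_trace (S \<circ> (\<lambda>x. x - V E (A x)))"
  have acn: "absolutely_continuous \<nu> \<gamma>" using equiv gam_ac by (auto simp: absolutely_continuous_def)
  have sn: "sets \<gamma> = sets \<nu>" using gam(2) gaussian_measure_law(2)[OF nu] by simp
  have main: "KL \<gamma> \<mu> = KL \<gamma> \<nu> + ereal (- ?N - ?P + ?R + ?T - 1/2 * D E)"
    by (rule KL_formula[OF E ev gam gam_ac c A Rgam alt])
  \<comment> \<open>All corrections are real, so the extended-real sum may be regrouped whether
    \<open>KL \<gamma> \<nu>\<close> is real or infinite.\<close>
  have split: "KL \<gamma> \<mu> = KL \<gamma> \<nu> - ereal ?N - ereal ?P + ereal ?R + ereal ?T - ereal (1/2 * D E)"
    unfolding main by (rule KL_cases_real[OF gaussian_measure_law(1)[OF nu] gam(1) acn sn]) auto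
  show ?thesis
  proof (intro conjI impI)
    show "KL \<gamma> \<mu> = KL \<gamma> \<nu>
      - ereal (1/2 * (norm (op_inv (op_sqrt (\<lambda>x. x - S x)) (op_inv (op_sqrt Q) (m2 - m1))))\<^sup>2)
      - ereal (1/2 * inner (S (op_inv (\<lambda>x. x - S x) (op_inv (op_sqrt Q) (m3 - m1))))
                           (op_inv (op_sqrt Q) (m3 - m1)))
      + ereal (inner (op_inv (\<lambda>x. x - S x) (op_inv (op_sqrt Q) (m2 - m1)))
                     (op_inv (op_sqrt Q) (m3 - m1)))
      + ereal (1/2 * op_trace (S \<circ> (\<lambda>x. x - op_inv (\<lambda>y. y - S y) (A x))))
      - ereal (1/2 * ln (det2_id_plus (\<lambda>x. - S x)))"
      unfolding ic iK ln_det b_def[symmetric] by (rule split)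
  next
    assume eq: "m3 = m2 \<and> A = (\<lambda>x. x - S x)"
    have nu_mu: "KL \<nu> \<mu> = ereal (1/2 * (norm b)\<^sup>2 - 1/2 * D E)" by (rule KL_nu_mu[OF E ev])
    have "R\<^sub>\<gamma> = R\<^sub>\<nu>" using eq Rgam Rnu by simp
    then have same: "KL \<gamma> \<mu> = KL \<gamma> \<nu> + KL \<nu> \<mu>"
      using KL_matching_moments[OF E ev gam(1,2) _ gam_ac] gam(3) eq by simp
    show "KL \<gamma> \<mu> = KL \<gamma> \<nu> + ereal (1/2 * (norm (op_inv (op_sqrt Q) (m2 - m1)))\<^sup>2)
        - ereal (1/2 * ln (det2_id_plus (\<lambda>x. - S x)))"
      unfolding ln_det b_def[symmetric] same nu_mu
      by (rule KL_cases_real[OF gaussian_measure_law(1)[OF nu] gam(1) acn sn]) auto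
    show "KL \<gamma> \<nu> + ereal (1/2 * (norm (op_inv (op_sqrt Q) (m2 - m1)))\<^sup>2)
        - ereal (1/2 * ln (det2_id_plus (\<lambda>x. - S x))) = KL \<gamma> \<nu> + KL \<nu> \<mu>"
      unfolding ln_det b_def[symmetric] nu_mu
      by (rule KL_cases_real[OF gaussian_measure_law(1)[OF nu] gam(1) acn sn]) auto
    have nonneg: "0 \<le> KL \<gamma> \<nu>" by (rule KL_nonneg[OF gaussian_measure_law(1)[OF nu] gam(1) acn sn])
    show "KL \<nu> \<mu> \<le> KL \<gamma> \<mu>"
      unfolding same nu_mu using nonneg by (cases "KL \<gamma> \<nu>") auto
    show "KL \<gamma> \<mu> = KL \<nu> \<mu> \<longleftrightarrow> \<gamma> = \<nu>"
    proof
      assume "KL \<gamma> \<mu> = KL \<nu> \<mu>"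
      \<comment> \<open>The term \<open>KL \<nu> \<mu>\<close> is a real number and may therefore be
        cancelled.\<close>
      then have "KL \<gamma> \<nu> = 0" unfolding same nu_mu using nonneg by (cases "KL \<gamma> \<nu>") auto
      then show "\<gamma> = \<nu>" by (rule KL_eq_0_imp_eq[OF gaussian_measure_law(1)[OF nu] gam(1) acn sn])
    qed simp
  qed
qed

end
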